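(* (a) Let $E$ be a unital, not necessarily commutative, Fréchet ${}^*$-algebra which is isomorphic as a Fréchet space to a nuclear power series space $\Lambda_\infty(\alpha)$ of infinite type. If $E$ is a DN-algebra, then $E$ is isomorphic as a Fréchet ${}^*$-algebra to a complemented ${}^*$-subalgebra of $\mathscr{L}^*(s)$. If $E$ is a $\beta$DN-algebra, then $E$ is isomorphic as a Fréchet ${}^*$-algebra to a complemented ${}^*$-subalgebra $F$ of $\mathscr{L}^*(s)$ with $F\subset\mathscr{L}(\ell_2)$. (b) Let $E$ be any commutative Fréchet ${}^*$-algebra. If $E$ is isomorphic as a Fréchet ${}^*$-algebra to a closed ${}^*$-subalgebra of $\mathscr{L}^*(s)$, then $E$ is a DN-algebra. If $E$ is isomorphic as a Fréchet ${}^*$-algebra to a closed ${}^*$-subalgebra $F$ of $\mathscr{L}^*(s)$ with $F\subset\mathscr{L}(\ell_2)$, then $E$ is a $\beta$DN-algebra.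
   Context: All spaces are over $\mathbb{C}$. A topological ${}^*$-algebra is a topological vector space that is a ${}^*$-algebra with separately continuous multiplication and continuous involution; a Fréchet ${}^*$-algebra is a topological ${}^*$-algebra whose underlying space is a Fréchet space (metrizable, complete, locally convex; local $m$-convexity is not required). An isomorphism of Fréchet (topological) ${}^*$-algebras is a ${}^*$-algebra isomorphism that is a homeomorphism; a subalgebra carries the subspace topology. Power series spaces: for a monotonically increasing sequence $\alpha=(\alpha_j)_{j\in\mathbb{N}}\subset(0,\infty)$ with $\alpha_j\to\infty$, $\Lambda_\infty(\alpha)=\{(\xi_j)\in\mathbb{C}^{\mathbb{N}}:|\xi|_{\alpha,q}^2=\sum_j|\xi_j|^2e^{2q\alpha_j}<\infty\text{ for all }q\in\mathbb{N}_0\}$, with the Fréchet topology given by the norms $|\cdot|_{\alpha,q}$. It is nuclear if and only if $\sup_j \frac{\log j}{\alpha_j}<\infty$. Dominating norm: let $E$ be a Fréchet space with an (increasing) fundamental system of seminorms $(\|\cdot\|_q)_{q\in\mathbb{N}_0}$. A continuous norm $\|\cdot\|$ on $E$ is dominating if for every $q$ there are $r\in\mathbb{N}_0$ and $C>0$ with $\|x\|_q^2\le C\|x\|\,\|x\|_r$ for all $x\in E$. It is a dominating Hilbert norm if moreover $\|\cdot\|=\sqrt{(\cdot,\cdot)}$ for a scalar product $(\cdot,\cdot)$ on $E$. A Fréchet ${}^*$-algebra $E$ is a DN-algebra if it admits a dominating Hilbert norm $\|\cdot\|=\sqrt{(\cdot,\cdot)}$ with ($\alpha$) $(xy,z)=(y,x^*z)$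 for all $x,y,z\in E$. It is a $\beta$DN-algebra if it admits a dominating Hilbert norm satisfying both ($\alpha$) and ($\beta$): for every $x\in E$ there is $C>0$ with $\|xy\|\le C\|y\|$ for all $y\in E$. The algebra $\mathscr{L}^*(s)$: $s=\{\xi\in\mathbb{C}^{\mathbb{N}}:|\xi|_q^2=\sum_j|\xi_j|^2j^{2q}<\infty\text{ for all }q\in\mathbb{N}_0\}$ with the Fréchet topology given by the norms $|\cdot|_q$; it is a dense subspace of $\ell_2$. $\mathscr{L}^*(s)$ is the set of all linear maps $x\colon s\to s$ such that, regarding $x$ as an unbounded operator in $\ell_2$ with domain $s$, its Hilbert space adjoint $x^*$ satisfies $s\subset\mathscr{D}(x^* )$ and $x^*(s)\subset s$. It is a ${}^*$-algebra under composition with involution $x\mapsto x^*|_s$ (again written $x^*$). Its topology $\tau^*$ is the locally convex topology given by the seminorms $p_{N,B}(x)=\max\{\sup_{\xi\in B}|x\xi|_N,\sup_{\xi\in B}|x^*\xi|_N\}$, where $N\in\mathbb{N}_0$ and $B$ runs over the bounded subsets of $s$. A ${}^*$-subalgebra of $\mathscr{L}^*(s)$ is complemented if it is the range of a continuous linear projection on $\mathscr{L}^*(s)$. The notation $F\subset\mathscr{L}(\ell_2)$ means that every $x\in F$ extends to a bounded operator on $\ell_2$. *)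

theory Defs
  imports "HOL-Analysis.Analysis" "HOL-Library.Function_Algebras"
begin

section \<open>Locally convex spaces over the complex numbers\<close>

text \<open>
  A complex vector space is an abelian group type with a scalar multiplication
  \<open>sc\<close> satisfying the library locale \<open>vector_space\<close>.  A topology on (a subspace
  of) it is an abstract topology \<open>T\<close>; the carrier is \<open>topspace T\<close>.  The operations on
  \<open>nat \<Rightarrow> complex\<close> are the pointwise ones of \<open>Function_Algebras\<close>.
\<close>

definition lin_on ::
  "(complex \<Rightarrow> 'v::ab_group_add \<Rightarrow> 'v) \<Rightarrow> (complex \<Rightarrow> 'w::ab_group_add \<Rightarrow> 'w)
    \<Rightarrow> 'v set \<Rightarrow> ('v \<Rightarrow> 'w) \<Rightarrow> bool"
  where "lin_on sc1 sc2 X f \<longleftrightarrow>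
    (\<forall>x\<in>X. \<forall>y\<in>X. f (x + y) = f x + f y) \<and>
    (\<forall>c. \<forall>x\<in>X. f (sc1 c x) = sc2 c (f x))"

definition seminorm_on ::
  "(complex \<Rightarrow> 'v::ab_group_add \<Rightarrow> 'v) \<Rightarrow> 'v set \<Rightarrow> ('v \<Rightarrow> real) \<Rightarrow> bool"
  where "seminorm_on sc X p \<longleftrightarrow>
    (\<forall>x\<in>X. 0 \<le> p x) \<and>
    (\<forall>x\<in>X. \<forall>y\<in>X. p (x + y) \<le> p x + p y) \<and>
    (\<forall>c. \<forall>x\<in>X. p (sc c x) = cmod c * p x)"

definition continuous_seminorm ::
  "(complex \<Rightarrow> 'v::ab_group_add \<Rightarrow> 'v) \<Rightarrow> 'v topology \<Rightarrow> ('v \<Rightarrow> real) \<Rightarrow> bool"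
  where "continuous_seminorm sc T p \<longleftrightarrow>
    seminorm_on sc (topspace T) p \<and> continuous_map T euclideanreal p"

text \<open>The locally convex topology on \<open>X\<close> given by a family \<open>P\<close> of seminorms.\<close>

definition seminorm_topology :: "'v::ab_group_add set \<Rightarrow> ('v \<Rightarrow> real) set \<Rightarrow> 'v topology"
  where "seminorm_topology X P =
    topology_generated_by
      (insert X {{y \<in> X. p (y - x) < \<epsilon>} | p x \<epsilon>. p \<in> P \<and> x \<in> X \<and> 0 < \<epsilon>})"

locale frechet_space = vector_space sc
  for sc :: "complex \<Rightarrow> 'v::ab_group_add \<Rightarrow> 'v" and T :: "'v topology" +
  assumes topspace_UNIV: "topspace T = UNIV"
    and continuous_add: "continuous_map (prod_topology T T) T (\<lambda>(x, y). x + y)"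
    and continuous_scale: "continuous_map (prod_topology euclidean T) T (\<lambda>(c, x). sc c x)"
    and locally_convex: "openin T U \<Longrightarrow> 0 \<in> U \<Longrightarrow>
      \<exists>V. openin T V \<and> 0 \<in> V \<and> V \<subseteq> U \<and>
        (\<forall>x\<in>V. \<forall>y\<in>V. \<forall>t\<in>{0..1::real}.
          sc (of_real t) x + sc (of_real (1 - t)) y \<in> V)"
    and metrizable: "metrizable_space T"
    and complete: "(\<forall>U. openin T U \<and> 0 \<in> U \<longrightarrow> (\<exists>N::nat. \<forall>m\<ge>N. \<forall>n\<ge>N. \<sigma> m - \<sigma> n \<in> U)) \<Longrightarrow>
      \<exists>l. limitin T \<sigma> l sequentially"

text \<open>
  \<open>nuclear_map_on sc X q p\<close>: the canonical map from the local Banach space of \<open>q\<close> to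
  that of \<open>p\<close> is nuclear, i.e. of the form \<open>\<Sum>k. f\<^sub>k(\<cdot>) y\<^sub>k\<close> with
  \<open>\<Sum>k. \<parallel>f\<^sub>k\<parallel>\<^sub>q * p y\<^sub>k < \<infinity>\<close>; \<open>a k\<close> bounds the dual norm of \<open>f k\<close>.  The
  \<open>y k\<close> may be taken in \<open>X\<close>, whose image is dense in the local Banach space of \<open>p\<close>:
  each vector of the completion is the sum of a series from \<open>X\<close> whose sum of norms is
  arbitrarily close to its norm.
\<close>

definition nuclear_map_on ::
  "(complex \<Rightarrow> 'v::ab_group_add \<Rightarrow> 'v) \<Rightarrow> 'v set \<Rightarrow> ('v \<Rightarrow> real) \<Rightarrow> ('v \<Rightarrow> real) \<Rightarrow> bool"
  where "nuclear_map_on sc X q p \<longleftrightarrow>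
    (\<exists>(f :: nat \<Rightarrow> 'v \<Rightarrow> complex) (y :: nat \<Rightarrow> 'v) (a :: nat \<Rightarrow> real).
      (\<forall>k. lin_on sc (*) X (f k)) \<and>
      (\<forall>k. 0 \<le> a k \<and> (\<forall>x\<in>X. cmod (f k x) \<le> a k * q x)) \<and>
      (\<forall>k. y k \<in> X) \<and>
      summable (\<lambda>k. a k * p (y k)) \<and>
      (\<forall>x\<in>X. (\<lambda>n. p (x - (\<Sum>k<n. sc (f k x) (y k)))) \<longlonglongrightarrow> 0))"

definition nuclear_space :: "(complex \<Rightarrow> 'v::ab_group_add \<Rightarrow> 'v) \<Rightarrow> 'v topology \<Rightarrow> bool"
  where "nuclear_space sc T \<longleftrightarrow>
    (\<forall>p. continuous_seminorm sc T p \<longrightarrow>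
      (\<exists>q. continuous_seminorm sc T q \<and> (\<forall>x\<in>topspace T. p x \<le> q x) \<and>
        nuclear_map_on sc (topspace T) q p))"

text \<open>Isomorphism of a Frechet space with the topological vector space carried by \<open>topspace T2\<close>.\<close>

definition frechet_isomorphic ::
  "(complex \<Rightarrow> 'v::ab_group_add \<Rightarrow> 'v) \<Rightarrow> 'v topology
    \<Rightarrow> (complex \<Rightarrow> 'w::ab_group_add \<Rightarrow> 'w) \<Rightarrow> 'w topology \<Rightarrow> bool"
  where "frechet_isomorphic sc1 T1 sc2 T2 \<longleftrightarrow>
    (\<exists>\<phi>. lin_on sc1 sc2 (topspace T1) \<phi> \<and> homeomorphic_map T1 T2 \<phi>)"


section \<open>Power series spaces of infinite type\<close>

definition seq_scale :: "complex \<Rightarrow> (nat \<Rightarrow> complex) \<Rightarrow> nat \<Rightarrow> complex"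
  where "seq_scale c \<xi> = (\<lambda>j. c * \<xi> j)"

definition exponent_sequence :: "(nat \<Rightarrow> real) \<Rightarrow> bool"
  where "exponent_sequence \<alpha> \<longleftrightarrow> mono \<alpha> \<and> (\<forall>j. 0 < \<alpha> j) \<and> filterlim \<alpha> at_top sequentially"

definition Lambda_inf :: "(nat \<Rightarrow> real) \<Rightarrow> (nat \<Rightarrow> complex) set"
  where "Lambda_inf \<alpha> =
    {\<xi>. \<forall>q::nat. summable (\<lambda>j. (cmod (\<xi> j))\<^sup>2 * exp (2 * real q * \<alpha> j))}"

definition Lambda_norm :: "(nat \<Rightarrow> real) \<Rightarrow> nat \<Rightarrow> (nat \<Rightarrow> complex) \<Rightarrow> real"
  where "Lambda_norm \<alpha> q \<xi> = sqrt (\<Sum>j. (cmod (\<xi> j))\<^sup>2 * exp (2 * real q * \<alpha> j))"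

definition Lambda_topology :: "(nat \<Rightarrow> real) \<Rightarrow> (nat \<Rightarrow> complex) topology"
  where "Lambda_topology \<alpha> = seminorm_topology (Lambda_inf \<alpha>) (range (Lambda_norm \<alpha>))"


section \<open>Frechet *-algebras, dominating norms, DN-algebras\<close>

locale star_algebra = vector_space sc
  for sc :: "complex \<Rightarrow> 'a::ring \<Rightarrow> 'a" and star :: "'a \<Rightarrow> 'a" +
  assumes scale_mult_left: "sc c x * y = sc c (x * y)"
    and scale_mult_right: "x * sc c y = sc c (x * y)"
    and star_add: "star (x + y) = star x + star y"
    and star_scale: "star (sc c x) = sc (cnj c) (star x)"
    and star_mult: "star (x * y) = star y * star x"
    and star_star: "star (star x) = x"

locale frechet_star_algebra = star_algebra sc star + frechet_space sc T
  for sc :: "complex \<Rightarrow> 'a::ring \<Rightarrow> 'a" and star :: "'a \<Rightarrow> 'a" and T :: "'a topology" +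
  assumes continuous_mult_left: "continuous_map T T (\<lambda>y. x * y)"
    and continuous_mult_right: "continuous_map T T (\<lambda>y. y * x)"
    and continuous_star: "continuous_map T T star"

definition fundamental_seminorms ::
  "(complex \<Rightarrow> 'v::ab_group_add \<Rightarrow> 'v) \<Rightarrow> 'v topology \<Rightarrow> (nat \<Rightarrow> 'v \<Rightarrow> real) \<Rightarrow> bool"
  where "fundamental_seminorms sc T p \<longleftrightarrow>
    (\<forall>q. continuous_seminorm sc T (p q)) \<and>
    (\<forall>q. \<forall>x\<in>topspace T. p q x \<le> p (Suc q) x) \<and>
    (\<forall>U. openin T U \<and> 0 \<in> U \<longrightarrow> (\<exists>q. \<exists>\<epsilon>>0. {x \<in> topspace T. p q x < \<epsilon>} \<subseteq> U))"

text \<open>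
  The condition does not depend on the fundamental system \<open>p\<close>;
  see \<open>dominating_norm_indep\<close> below.
\<close>

definition dominating_norm ::
  "(complex \<Rightarrow> 'v::ab_group_add \<Rightarrow> 'v) \<Rightarrow> 'v topology \<Rightarrow> ('v \<Rightarrow> real) \<Rightarrow> bool"
  where "dominating_norm sc T nrm \<longleftrightarrow>
    continuous_seminorm sc T nrm \<and> (\<forall>x\<in>topspace T. nrm x = 0 \<longrightarrow> x = 0) \<and>
    (\<exists>p. fundamental_seminorms sc T p \<and>
      (\<forall>q. \<exists>r. \<exists>C>0. \<forall>x\<in>topspace T. (p q x)\<^sup>2 \<le> C * nrm x * p r x))"

definition scalar_product ::
  "(complex \<Rightarrow> 'v::ab_group_add \<Rightarrow> 'v) \<Rightarrow> ('v \<Rightarrow> 'v \<Rightarrow> complex) \<Rightarrow> bool"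
  where "scalar_product sc ip \<longleftrightarrow>
    (\<forall>x y z. ip (x + y) z = ip x z + ip y z) \<and>
    (\<forall>c x y. ip (sc c x) y = c * ip x y) \<and>
    (\<forall>x y. ip y x = cnj (ip x y)) \<and>
    (\<forall>x. x \<noteq> 0 \<longrightarrow> 0 < Re (ip x x))"

definition hilbert_norm :: "('v \<Rightarrow> 'v \<Rightarrow> complex) \<Rightarrow> 'v \<Rightarrow> real"
  where "hilbert_norm ip x = sqrt (Re (ip x x))"

definition dominating_hilbert_norm ::
  "(complex \<Rightarrow> 'v::ab_group_add \<Rightarrow> 'v) \<Rightarrow> 'v topology \<Rightarrow> ('v \<Rightarrow> 'v \<Rightarrow> complex) \<Rightarrow> bool"
  where "dominating_hilbert_norm sc T ip \<longleftrightarrow>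
    scalar_product sc ip \<and> dominating_norm sc T (hilbert_norm ip)"

definition DN_algebra ::
  "(complex \<Rightarrow> 'a::ring \<Rightarrow> 'a) \<Rightarrow> ('a \<Rightarrow> 'a) \<Rightarrow> 'a topology \<Rightarrow> bool"
  where "DN_algebra sc star T \<longleftrightarrow>
    frechet_star_algebra sc star T \<and>
    (\<exists>ip. dominating_hilbert_norm sc T ip \<and>
      (\<forall>x y z. ip (x * y) z = ip y (star x * z)))"

definition beta_DN_algebra ::
  "(complex \<Rightarrow> 'a::ring \<Rightarrow> 'a) \<Rightarrow> ('a \<Rightarrow> 'a) \<Rightarrow> 'a topology \<Rightarrow> bool"
  where "beta_DN_algebra sc star T \<longleftrightarrow>
    frechet_star_algebra sc star T \<and>
    (\<exists>ip. dominating_hilbert_norm sc T ip \<and>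
      (\<forall>x y z. ip (x * y) z = ip y (star x * z)) \<and>
      (\<forall>x. \<exists>C>0. \<forall>y. hilbert_norm ip (x * y) \<le> C * hilbert_norm ip y))"

lemma seminorm_le_of_fundamental:
  assumes vs: "vector_space sc" and top: "topspace T = UNIV"
    and f: "fundamental_seminorms sc T p" and s: "continuous_seminorm sc T u"
  shows "\<exists>q. \<exists>C>0. \<forall>x. u x \<le> C * p q x"
proof -
  interpret vector_space sc by fact
  have u0: "u 0 = 0"
  proof -
    have "u (sc 0 0) = cmod 0 * u 0"
      using s top unfolding continuous_seminorm_def seminorm_on_def by blast
    then show ?thesis by simp
  qed
  have "openin T {x \<in> topspace T. u x \<in> {..<1}}"
    using s unfolding continuous_seminorm_def
    by (intro openin_continuous_map_preimage[where Y=euclideanreal]) auto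
  moreover have "0 \<in> {x \<in> topspace T. u x \<in> {..<1}}" using u0 top by simp
  ultimately obtain q \<epsilon> where e: "\<epsilon> > 0" "{x \<in> topspace T. p q x < \<epsilon>} \<subseteq> {x \<in> topspace T. u x \<in> {..<1}}"
    using f unfolding fundamental_seminorms_def by blast
  have P: "seminorm_on sc UNIV (p q)" "seminorm_on sc UNIV u"
    using f s top unfolding fundamental_seminorms_def continuous_seminorm_def by auto
  have key: "u x * \<epsilon> \<le> 2 * p q x" for x
  proof (rule ccontr)
    assume "\<not> ?thesis"
    then have lt: "2 * p q x < u x * \<epsilon>" by simp
    have pp: "0 \<le> p q x" "0 \<le> u x" using P unfolding seminorm_on_def by auto
    have upos: "0 < u x"
    proof (rule ccontr)
      assume "\<not> 0 < u x"
      then have "u x = 0" using pp by simp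
      then show False using lt pp by simp
    qed
    let ?c = "complex_of_real (1 / u x)"
    have c: "cmod ?c = 1 / u x" using upos by (simp only: norm_of_real) simp
    have "p q (sc ?c x) = 1 / u x * p q x" "u (sc ?c x) = 1 / u x * u x"
      using P c unfolding seminorm_on_def by auto
    moreover have "1 / u x * p q x < \<epsilon>"
    proof -
      have "p q x < \<epsilon> * u x" using lt pp by (simp add: mult.commute)
      then show ?thesis using upos by (simp add: pos_divide_less_eq)
    qed
    ultimately have "p q (sc ?c x) < \<epsilon>" "u (sc ?c x) = 1" using upos by simp_all
    then show False using e(2) top by auto
  qed
  show ?thesis
  proof (intro exI conjI allI)
    show "0 < 2 / \<epsilon>" using e by simp
    show "u x \<le> 2 / \<epsilon> * p q x" for x using key[of x] e by (simp add: field_simps)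
  qed
qed

lemma dominating_norm_indep:
  assumes vs: "vector_space sc" and top: "topspace T = UNIV"
    and d: "dominating_norm sc T nrm" and f: "fundamental_seminorms sc T p'"
  shows "\<forall>q. \<exists>r. \<exists>C>0. \<forall>x. (p' q x)\<^sup>2 \<le> C * nrm x * p' r x"
proof
  fix q
  obtain p where p: "fundamental_seminorms sc T p"
    and dom: "\<And>q. \<exists>r. \<exists>C>0. \<forall>x. (p q x)\<^sup>2 \<le> C * nrm x * p r x"
    using d top unfolding dominating_norm_def by auto
  have cs: "continuous_seminorm sc T (p' q)" "continuous_seminorm sc T (p r)" for q r
    using p f unfolding fundamental_seminorms_def by auto
  obtain q1 C1 where 1: "C1 > 0" "\<And>x. p' q x \<le> C1 * p q1 x"
    using seminorm_le_of_fundamental[OF vs top p cs(1)] by blast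
  obtain r C where 2: "C > 0" "\<And>x. (p q1 x)\<^sup>2 \<le> C * nrm x * p r x" using dom by blast
  obtain r' C2 where 3: "C2 > 0" "\<And>x. p r x \<le> C2 * p' r' x"
    using seminorm_le_of_fundamental[OF vs top f cs(2)] by blast
  show "\<exists>r. \<exists>C>0. \<forall>x. (p' q x)\<^sup>2 \<le> C * nrm x * p' r x"
  proof (intro exI conjI allI)
    show "C1\<^sup>2 * C * C2 > 0" using 1 2 3 by simp
    fix x
    have nn: "0 \<le> nrm x" "0 \<le> p' q x"
      using d cs top unfolding dominating_norm_def continuous_seminorm_def seminorm_on_def by auto
    have "(p' q x)\<^sup>2 \<le> (C1 * p q1 x)\<^sup>2" using 1 nn by (intro power_mono) auto
    also have "\<dots> \<le> C1\<^sup>2 * (C * nrm x * p r x)"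
      using 2 by (auto simp: power_mult_distrib intro: mult_left_mono)
    also have "\<dots> \<le> C1\<^sup>2 * (C * nrm x * (C2 * p' r' x))"
      using 2 3 nn by (intro mult_left_mono) auto
    finally show "(p' q x)\<^sup>2 \<le> C1\<^sup>2 * C * C2 * nrm x * p' r' x" by (simp add: mult_ac)
  qed
qed


section \<open>The spaces \<open>\<ell>\<^sub>2\<close> and \<open>s\<close>\<close>

definition ell2 :: "(nat \<Rightarrow> complex) set"
  where "ell2 = {\<xi>. summable (\<lambda>j. (cmod (\<xi> j))\<^sup>2)}"

definition ell2_inner :: "(nat \<Rightarrow> complex) \<Rightarrow> (nat \<Rightarrow> complex) \<Rightarrow> complex"
  where "ell2_inner \<xi> \<eta> = (\<Sum>j. \<xi> j * cnj (\<eta> j))"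

definition ell2_norm :: "(nat \<Rightarrow> complex) \<Rightarrow> real"
  where "ell2_norm \<xi> = sqrt (\<Sum>j. (cmod (\<xi> j))\<^sup>2)"

text \<open>Sequences indexed by \<open>1, 2, \<dots>\<close> are shifted to start at \<open>0\<close>, whence the weight \<open>Suc j\<close>.\<close>

definition rapidly_decreasing :: "(nat \<Rightarrow> complex) set"
  where "rapidly_decreasing =
    {\<xi>. \<forall>q::nat. summable (\<lambda>j. (cmod (\<xi> j))\<^sup>2 * real (Suc j) ^ (2 * q))}"

lemma summable_weighted_add:
  assumes "summable (\<lambda>j. (cmod (x j))\<^sup>2 * w j)" "summable (\<lambda>j. (cmod (y j))\<^sup>2 * w j)"
    and w: "\<And>j. 0 \<le> (w j :: real)"
  shows "summable (\<lambda>j. (cmod (x j + y j))\<^sup>2 * w j)"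
proof (rule summable_comparison_test)
  show "summable (\<lambda>j. 2 * ((cmod (x j))\<^sup>2 * w j) + 2 * ((cmod (y j))\<^sup>2 * w j))"
    using assms by (intro summable_add summable_mult) auto
  have "norm ((cmod (x j + y j))\<^sup>2 * w j) \<le> 2 * ((cmod (x j))\<^sup>2 * w j) + 2 * ((cmod (y j))\<^sup>2 * w j)" for j
  proof -
    have "(cmod (x j + y j))\<^sup>2 \<le> (cmod (x j) + cmod (y j))\<^sup>2"
      by (intro power_mono norm_triangle_ineq) auto
    also have "\<dots> \<le> 2 * (cmod (x j))\<^sup>2 + 2 * (cmod (y j))\<^sup>2"
      using sum_squares_bound[of "cmod (x j)" "cmod (y j)"] by (simp add: power2_sum)
    finally have "(cmod (x j + y j))\<^sup>2 * w j \<le> (2 * (cmod (x j))\<^sup>2 + 2 * (cmod (y j))\<^sup>2) * w j"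
      using w by (intro mult_right_mono) auto
    then show ?thesis using w by (simp add: algebra_simps)
  qed
  then show "\<exists>N. \<forall>n\<ge>N. norm ((cmod (x n + y n))\<^sup>2 * w n)
      \<le> 2 * ((cmod (x n))\<^sup>2 * w n) + 2 * ((cmod (y n))\<^sup>2 * w n)" by blast
qed

lemma rapidly_decreasing_zero: "(\<lambda>_. 0) \<in> rapidly_decreasing"
  by (simp add: rapidly_decreasing_def)

lemma rapidly_decreasing_add:
  "x \<in> rapidly_decreasing \<Longrightarrow> y \<in> rapidly_decreasing \<Longrightarrow> x + y \<in> rapidly_decreasing"
  unfolding rapidly_decreasing_def by (auto intro!: summable_weighted_add)

lemma rapidly_decreasing_scale:
  "x \<in> rapidly_decreasing \<Longrightarrow> seq_scale c x \<in> rapidly_decreasing"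
  unfolding rapidly_decreasing_def seq_scale_def
  by (auto simp: norm_mult power_mult_distrib mult.assoc intro!: summable_mult)

lemma rapidly_decreasing_uminus: "x \<in> rapidly_decreasing \<Longrightarrow> - x \<in> rapidly_decreasing"
  unfolding rapidly_decreasing_def by auto

lemma rapidly_decreasing_diff:
  "x \<in> rapidly_decreasing \<Longrightarrow> y \<in> rapidly_decreasing \<Longrightarrow> x - y \<in> rapidly_decreasing"
  using rapidly_decreasing_add[OF _ rapidly_decreasing_uminus, of x y] by simp

lemma rapidly_decreasing_subset_ell2: "rapidly_decreasing \<subseteq> ell2"
proof
  fix x assume "x \<in> rapidly_decreasing"
  then have "summable (\<lambda>j. (cmod (x j))\<^sup>2 * real (Suc j) ^ (2 * 0))"
    unfolding rapidly_decreasing_def by blast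
  then show "x \<in> ell2" by (simp add: ell2_def)
qed

typedef s_space = rapidly_decreasing
  morphisms seq Abs_s
  using rapidly_decreasing_zero by blast

instantiation s_space :: ab_group_add
begin

definition zero_s_space_def: "0 = Abs_s 0"
definition plus_s_space_def: "\<xi> + \<eta> = Abs_s (seq \<xi> + seq \<eta>)"
definition uminus_s_space_def: "- \<xi> = Abs_s (- seq \<xi>)"
definition minus_s_space_def: "\<xi> - \<eta> = Abs_s (seq \<xi> - seq \<eta>)"

lemma seq_zero: "seq 0 = 0"
  using rapidly_decreasing_zero by (simp add: zero_s_space_def Abs_s_inverse zero_fun_def)

lemma seq_add: "seq (\<xi> + \<eta>) = seq \<xi> + seq \<eta>"
  by (simp add: plus_s_space_def Abs_s_inverse rapidly_decreasing_add seq)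

lemma seq_uminus: "seq (- \<xi>) = - seq \<xi>"
  by (simp add: uminus_s_space_def Abs_s_inverse rapidly_decreasing_uminus seq)

lemma seq_diff: "seq (\<xi> - \<eta>) = seq \<xi> - seq \<eta>"
  by (simp add: minus_s_space_def Abs_s_inverse rapidly_decreasing_diff seq)

instance
  by standard
    (simp_all add: seq_inject[symmetric] seq_zero seq_add seq_uminus seq_diff add_ac)

end

definition s_scale :: "complex \<Rightarrow> s_space \<Rightarrow> s_space"
  where "s_scale c \<xi> = Abs_s (seq_scale c (seq \<xi>))"

lemma seq_s_scale: "seq (s_scale c \<xi>) = seq_scale c (seq \<xi>)"
  by (simp add: s_scale_def Abs_s_inverse rapidly_decreasing_scale seq)

definition s_norm :: "nat \<Rightarrow> s_space \<Rightarrow> real"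
  where "s_norm q \<xi> = sqrt (\<Sum>j. (cmod (seq \<xi> j))\<^sup>2 * real (Suc j) ^ (2 * q))"

definition s_bounded :: "s_space set \<Rightarrow> bool"
  where "s_bounded B \<longleftrightarrow> (\<forall>q. bdd_above (s_norm q ` B))"


section \<open>The algebra \<open>L\<^sup>*(s)\<close>\<close>

text \<open>Hilbert space adjoint of \<open>x\<close>, an unbounded operator in \<open>\<ell>\<^sub>2\<close> with domain \<open>s\<close>.\<close>

definition adj_dom :: "(s_space \<Rightarrow> s_space) \<Rightarrow> (nat \<Rightarrow> complex) set"
  where "adj_dom x =
    {\<eta> \<in> ell2. \<exists>\<zeta>\<in>ell2. \<forall>\<xi>. ell2_inner (seq (x \<xi>)) \<eta> = ell2_inner (seq \<xi>) \<zeta>}"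

definition adj :: "(s_space \<Rightarrow> s_space) \<Rightarrow> (nat \<Rightarrow> complex) \<Rightarrow> nat \<Rightarrow> complex"
  where "adj x \<eta> =
    (THE \<zeta>. \<zeta> \<in> ell2 \<and> (\<forall>\<xi>. ell2_inner (seq (x \<xi>)) \<eta> = ell2_inner (seq \<xi>) \<zeta>))"

definition Lstar_carrier :: "(s_space \<Rightarrow> s_space) set"
  where "Lstar_carrier =
    {x. lin_on s_scale s_scale UNIV x \<and>
        range seq \<subseteq> adj_dom x \<and> adj x ` range seq \<subseteq> range seq}"

definition adj_s :: "(s_space \<Rightarrow> s_space) \<Rightarrow> s_space \<Rightarrow> s_space"
  where "adj_s x \<eta> = Abs_s (adj x (seq \<eta>))"

definition s_inner :: "s_space \<Rightarrow> s_space \<Rightarrow> complex"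
  where "s_inner \<xi> \<eta> = ell2_inner (seq \<xi>) (seq \<eta>)"

lemma seq_ell2: "seq \<xi> \<in> ell2"
  using rapidly_decreasing_subset_ell2 seq by blast

lemma summable_ell2_inner:
  assumes "\<xi> \<in> ell2" "\<eta> \<in> ell2"
  shows "summable (\<lambda>j. \<xi> j * cnj (\<eta> j))"
proof (rule summable_comparison_test)
  show "summable (\<lambda>j. (cmod (\<xi> j))\<^sup>2 + (cmod (\<eta> j))\<^sup>2)"
    using assms by (auto simp: ell2_def intro: summable_add)
  have "norm (\<xi> j * cnj (\<eta> j)) \<le> (cmod (\<xi> j))\<^sup>2 + (cmod (\<eta> j))\<^sup>2" for j
  proof -
    have "2 * cmod (\<xi> j) * cmod (\<eta> j) \<le> (cmod (\<xi> j))\<^sup>2 + (cmod (\<eta> j))\<^sup>2"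
      by (rule sum_squares_bound)
    moreover have "0 \<le> cmod (\<xi> j) * cmod (\<eta> j)" by simp
    ultimately have "cmod (\<xi> j) * cmod (\<eta> j) \<le> (cmod (\<xi> j))\<^sup>2 + (cmod (\<eta> j))\<^sup>2"
      by linarith
    then show ?thesis by (simp add: norm_mult)
  qed
  then show "\<exists>N. \<forall>n\<ge>N. norm (\<xi> n * cnj (\<eta> n)) \<le> (cmod (\<xi> n))\<^sup>2 + (cmod (\<eta> n))\<^sup>2" by blast
qed

definition unit_seq :: "nat \<Rightarrow> nat \<Rightarrow> complex"
  where "unit_seq i = (\<lambda>j. if j = i then 1 else 0)"

lemma unit_seq_rapidly_decreasing: "unit_seq i \<in> rapidly_decreasing"
  unfolding rapidly_decreasing_def unit_seq_def
  by (auto intro!: summable_finite[of "{i}"] split: if_splits)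

lemma ell2_inner_unit: "ell2_inner (unit_seq i) \<eta> = cnj (\<eta> i)"
proof -
  have "(\<Sum>j. unit_seq i j * cnj (\<eta> j)) = (\<Sum>j\<in>{i}. unit_seq i j * cnj (\<eta> j))"
    by (rule suminf_finite) (auto simp: unit_seq_def)
  then show ?thesis by (simp add: ell2_inner_def unit_seq_def)
qed

lemma adj_unique:
  assumes "\<forall>\<xi>. ell2_inner (seq \<xi>) \<zeta> = ell2_inner (seq \<xi>) \<zeta>'"
  shows "\<zeta> = \<zeta>'"
proof
  fix i
  show "\<zeta> i = \<zeta>' i"
    using spec[OF assms, of "Abs_s (unit_seq i)"]
    by (simp add: Abs_s_inverse unit_seq_rapidly_decreasing ell2_inner_unit)
qed

lemma adj_eqI:
  assumes "\<zeta> \<in> ell2" "\<And>\<xi>. ell2_inner (seq (x \<xi>)) \<eta> = ell2_inner (seq \<xi>) \<zeta>"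
  shows "adj x \<eta> = \<zeta>"
  unfolding adj_def
proof (rule the_equality)
  show "\<zeta> \<in> ell2 \<and> (\<forall>\<xi>. ell2_inner (seq (x \<xi>)) \<eta> = ell2_inner (seq \<xi>) \<zeta>)"
    using assms by blast
  fix \<zeta>' assume "\<zeta>' \<in> ell2 \<and> (\<forall>\<xi>. ell2_inner (seq (x \<xi>)) \<eta> = ell2_inner (seq \<xi>) \<zeta>')"
  then show "\<zeta>' = \<zeta>" using assms(2) by (intro adj_unique) simp
qed

lemma Lstar_carrierI:
  assumes "lin_on s_scale s_scale UNIV x" and y: "\<And>\<xi> \<eta>. s_inner (x \<xi>) \<eta> = s_inner \<xi> (y \<eta>)"
  shows "x \<in> Lstar_carrier" "adj_s x = y"
proof -
  have a: "adj x (seq \<eta>) = seq (y \<eta>)" for \<eta>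
    using y by (intro adj_eqI seq_ell2) (simp add: s_inner_def)
  then show "adj_s x = y" by (intro ext) (simp add: adj_s_def seq_inverse)
  have "seq \<eta> \<in> adj_dom x" for \<eta>
    unfolding adj_dom_def using y[of _ \<eta>] seq_ell2 by (auto simp: s_inner_def)
  then show "x \<in> Lstar_carrier" using assms(1) a by (auto simp: Lstar_carrier_def)
qed

lemma s_inner_adj_s:
  assumes "x \<in> Lstar_carrier"
  shows "s_inner (x \<xi>) \<eta> = s_inner \<xi> (adj_s x \<eta>)"
proof -
  have "seq \<eta> \<in> adj_dom x" "adj x (seq \<eta>) \<in> range seq"
    using assms by (auto simp: Lstar_carrier_def)
  then obtain \<zeta> where z: "\<zeta> \<in> ell2" "\<And>\<xi>. ell2_inner (seq (x \<xi>)) (seq \<eta>) = ell2_inner (seq \<xi>) \<zeta>"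
    by (auto simp: adj_dom_def)
  then have "adj x (seq \<eta>) = \<zeta>" by (rule adj_eqI)
  moreover have "seq (adj_s x \<eta>) = adj x (seq \<eta>)"
    using \<open>adj x (seq \<eta>) \<in> range seq\<close> by (auto simp: adj_s_def seq_inverse)
  ultimately show ?thesis using z by (simp add: s_inner_def)
qed

lemma s_inner_add_left: "s_inner (\<xi> + \<xi>') \<eta> = s_inner \<xi> \<eta> + s_inner \<xi>' \<eta>"
  by (simp add: s_inner_def ell2_inner_def seq_add distrib_right suminf_add summable_ell2_inner seq_ell2)

lemma s_inner_scale_left: "s_inner (s_scale c \<xi>) \<eta> = c * s_inner \<xi> \<eta>"
  by (simp add: s_inner_def ell2_inner_def seq_s_scale seq_scale_def mult.assoc
      suminf_mult summable_ell2_inner seq_ell2)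

lemma s_inner_commute: "s_inner \<eta> \<xi> = cnj (s_inner \<xi> \<eta>)"
proof -
  have "(\<lambda>j. seq \<xi> j * cnj (seq \<eta> j)) sums s_inner \<xi> \<eta>"
    unfolding s_inner_def ell2_inner_def by (intro summable_sums summable_ell2_inner seq_ell2)
  then have "(\<lambda>j. cnj (seq \<xi> j * cnj (seq \<eta> j))) sums cnj (s_inner \<xi> \<eta>)"
    by (simp only: sums_cnj)
  then show ?thesis
    by (simp add: s_inner_def ell2_inner_def sums_iff mult.commute)
qed

lemma s_inner_add_right: "s_inner \<eta> (\<xi> + \<xi>') = s_inner \<eta> \<xi> + s_inner \<eta> \<xi>'"
  using arg_cong[OF s_inner_add_left[of \<xi> \<xi>' \<eta>], of cnj]
  by (simp add: s_inner_commute[symmetric])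

lemma s_inner_scale_right: "s_inner \<eta> (s_scale c \<xi>) = cnj c * s_inner \<eta> \<xi>"
  using arg_cong[OF s_inner_scale_left[of c \<xi> \<eta>], of cnj]
  by (simp add: s_inner_commute[symmetric])

lemma s_inner_right_cancel: "(\<And>\<xi>. s_inner \<xi> \<zeta> = s_inner \<xi> \<zeta>') \<Longrightarrow> \<zeta> = \<zeta>'"
  using adj_unique[of "seq \<zeta>" "seq \<zeta>'"] by (simp add: s_inner_def seq_inject)

lemma vector_space_s: "vector_space s_scale"
  by standard
    (simp_all add: seq_inject[symmetric] seq_add seq_s_scale seq_scale_def fun_eq_iff algebra_simps)

lemma s_scale_minus_one: "s_scale (- 1) \<xi> = - \<xi>"
  by (simp add: seq_inject[symmetric] seq_s_scale seq_uminus seq_scale_def fun_eq_iff)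

lemma Lstar_carrier_lin: "x \<in> Lstar_carrier \<Longrightarrow> lin_on s_scale s_scale UNIV x"
  by (simp add: Lstar_carrier_def)

lemma Lstar_carrier_zero: "(\<lambda>_. 0) \<in> Lstar_carrier" "adj_s (\<lambda>_. 0) = (\<lambda>_. 0)"
proof -
  interpret vector_space s_scale by (rule vector_space_s)
  have l: "lin_on s_scale s_scale UNIV (\<lambda>_. 0)"
    by (simp add: lin_on_def)
  have z: "s_inner 0 \<eta> = s_inner \<xi> 0" for \<xi> \<eta>
    using s_inner_add_left[of 0 0 \<eta>] s_inner_add_right[of \<xi> 0 0] by simp
  show "(\<lambda>_. 0) \<in> Lstar_carrier" "adj_s (\<lambda>_. 0) = (\<lambda>_. 0)"
    using Lstar_carrierI[OF l, of "\<lambda>_. 0"] z by blast+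
qed

lemma Lstar_carrier_add:
  assumes "x \<in> Lstar_carrier" "y \<in> Lstar_carrier"
  shows "(\<lambda>\<xi>. x \<xi> + y \<xi>) \<in> Lstar_carrier"
    "adj_s (\<lambda>\<xi>. x \<xi> + y \<xi>) = (\<lambda>\<xi>. adj_s x \<xi> + adj_s y \<xi>)"
proof -
  interpret vector_space s_scale by (rule vector_space_s)
  have l: "lin_on s_scale s_scale UNIV (\<lambda>\<xi>. x \<xi> + y \<xi>)"
    using assms[THEN Lstar_carrier_lin] by (simp add: lin_on_def scale_right_distrib add_ac)
  show "(\<lambda>\<xi>. x \<xi> + y \<xi>) \<in> Lstar_carrier"
    "adj_s (\<lambda>\<xi>. x \<xi> + y \<xi>) = (\<lambda>\<xi>. adj_s x \<xi> + adj_s y \<xi>)"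
    using assms Lstar_carrierI[OF l, of "\<lambda>\<xi>. adj_s x \<xi> + adj_s y \<xi>"]
    by (simp_all add: s_inner_add_left s_inner_add_right s_inner_adj_s)
qed

lemma Lstar_carrier_scale:
  assumes "x \<in> Lstar_carrier"
  shows "(\<lambda>\<xi>. s_scale c (x \<xi>)) \<in> Lstar_carrier"
    "adj_s (\<lambda>\<xi>. s_scale c (x \<xi>)) = (\<lambda>\<xi>. s_scale (cnj c) (adj_s x \<xi>))"
proof -
  interpret vector_space s_scale by (rule vector_space_s)
  have l: "lin_on s_scale s_scale UNIV (\<lambda>\<xi>. s_scale c (x \<xi>))"
    using assms[THEN Lstar_carrier_lin] by (simp add: lin_on_def scale_right_distrib mult.commute)
  show "(\<lambda>\<xi>. s_scale c (x \<xi>)) \<in> Lstar_carrier"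
    "adj_s (\<lambda>\<xi>. s_scale c (x \<xi>)) = (\<lambda>\<xi>. s_scale (cnj c) (adj_s x \<xi>))"
    using assms Lstar_carrierI[OF l, of "\<lambda>\<xi>. s_scale (cnj c) (adj_s x \<xi>)"]
    by (simp_all add: s_inner_scale_left s_inner_scale_right s_inner_adj_s)
qed

lemma Lstar_carrier_comp:
  assumes "x \<in> Lstar_carrier" "y \<in> Lstar_carrier"
  shows "x \<circ> y \<in> Lstar_carrier" "adj_s (x \<circ> y) = adj_s y \<circ> adj_s x"
proof -
  have l: "lin_on s_scale s_scale UNIV (x \<circ> y)"
    using assms[THEN Lstar_carrier_lin] by (simp add: lin_on_def)
  show "x \<circ> y \<in> Lstar_carrier" "adj_s (x \<circ> y) = adj_s y \<circ> adj_s x"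
    using assms Lstar_carrierI[OF l, of "adj_s y \<circ> adj_s x"] by (simp_all add: s_inner_adj_s)
qed

lemma Lstar_carrier_adj:
  assumes "x \<in> Lstar_carrier"
  shows "adj_s x \<in> Lstar_carrier" "adj_s (adj_s x) = x"
proof -
  have e: "s_inner (adj_s x \<xi>) \<eta> = s_inner \<xi> (x \<eta>)" for \<xi> \<eta>
    using arg_cong[OF s_inner_adj_s[OF assms, of \<eta> \<xi>], of cnj]
    by (simp add: s_inner_commute[symmetric])
  have l: "lin_on s_scale s_scale UNIV (adj_s x)"
    unfolding lin_on_def
    by (auto intro!: s_inner_right_cancel
        simp: s_inner_adj_s[OF assms, symmetric] s_inner_add_right s_inner_scale_right)
  show "adj_s x \<in> Lstar_carrier" "adj_s (adj_s x) = x"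
    using Lstar_carrierI[OF l e] by auto
qed

lemma Lstar_carrier_uminus: "x \<in> Lstar_carrier \<Longrightarrow> (\<lambda>\<xi>. - x \<xi>) \<in> Lstar_carrier"
  using Lstar_carrier_scale(1)[of x "- 1"] by (simp add: s_scale_minus_one)

lemma Lstar_carrier_diff:
  "x \<in> Lstar_carrier \<Longrightarrow> y \<in> Lstar_carrier \<Longrightarrow> (\<lambda>\<xi>. x \<xi> - y \<xi>) \<in> Lstar_carrier"
  using Lstar_carrier_add(1)[OF _ Lstar_carrier_uminus, of x y] by simp

typedef Lstar = Lstar_carrier
  morphisms op Abs_Lstar
  using Lstar_carrier_zero by blast

text \<open>Multiplication is composition, not the pointwise product of \<open>Function_Algebras\<close>.\<close>

instantiation Lstar :: ring
begin

definition zero_Lstar_def: "0 = Abs_Lstar (\<lambda>_. 0)"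
definition plus_Lstar_def: "x + y = Abs_Lstar (\<lambda>\<xi>. op x \<xi> + op y \<xi>)"
definition uminus_Lstar_def: "- x = Abs_Lstar (\<lambda>\<xi>. - op x \<xi>)"
definition minus_Lstar_def: "x - y = Abs_Lstar (\<lambda>\<xi>. op x \<xi> - op y \<xi>)"
definition times_Lstar_def: "x * y = Abs_Lstar (op x \<circ> op y)"

lemma op_zero: "op 0 = (\<lambda>_. 0)"
  by (simp add: zero_Lstar_def Abs_Lstar_inverse Lstar_carrier_zero)

lemma op_add: "op (x + y) = (\<lambda>\<xi>. op x \<xi> + op y \<xi>)"
  by (simp add: plus_Lstar_def Abs_Lstar_inverse Lstar_carrier_add op)

lemma op_uminus: "op (- x) = (\<lambda>\<xi>. - op x \<xi>)"
  by (simp add: uminus_Lstar_def Abs_Lstar_inverse Lstar_carrier_uminus op)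

lemma op_diff: "op (x - y) = (\<lambda>\<xi>. op x \<xi> - op y \<xi>)"
  by (simp add: minus_Lstar_def Abs_Lstar_inverse Lstar_carrier_diff op)

lemma op_mult: "op (x * y) = op x \<circ> op y"
  by (simp add: times_Lstar_def Abs_Lstar_inverse Lstar_carrier_comp op)

lemma op_linear:
  "op x (\<xi> + \<eta>) = op x \<xi> + op x \<eta>" "op x (s_scale c \<xi>) = s_scale c (op x \<xi>)"
  using Lstar_carrier_lin[OF op[of x]] by (auto simp: lin_on_def)

instance
  by standard
    (simp_all add: op_inject[symmetric] op_zero op_add op_uminus op_diff op_mult op_linear
      fun_eq_iff add_ac)

end

definition Lstar_scale :: "complex \<Rightarrow> Lstar \<Rightarrow> Lstar"
  where "Lstar_scale c x = Abs_Lstar (\<lambda>\<xi>. s_scale c (op x \<xi>))"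

definition Lstar_star :: "Lstar \<Rightarrow> Lstar"
  where "Lstar_star x = Abs_Lstar (adj_s (op x))"

lemma op_scale: "op (Lstar_scale c x) = (\<lambda>\<xi>. s_scale c (op x \<xi>))"
  by (simp add: Lstar_scale_def Abs_Lstar_inverse Lstar_carrier_scale op)

lemma op_star: "op (Lstar_star x) = adj_s (op x)"
  by (simp add: Lstar_star_def Abs_Lstar_inverse Lstar_carrier_adj op)

lemma star_algebra_Lstar: "star_algebra Lstar_scale Lstar_star"
proof -
  interpret vector_space s_scale by (rule vector_space_s)
  show ?thesis
    by standard
      (simp_all add: op_inject[symmetric] op_add op_scale op_mult op_star op_linear
        Lstar_carrier_add Lstar_carrier_scale Lstar_carrier_comp Lstar_carrier_adj op fun_eq_iff
        scale_right_distrib scale_left_distrib)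
qed

text \<open>
  Elements of \<open>L\<^sup>*(s)\<close> are continuous on \<open>s\<close> by the closed graph theorem, so the suprema
  are over bounded sets of reals.
\<close>

definition Lstar_seminorm :: "nat \<Rightarrow> s_space set \<Rightarrow> Lstar \<Rightarrow> real"
  where "Lstar_seminorm N B x =
    max (SUP \<xi>\<in>B. s_norm N (op x \<xi>)) (SUP \<xi>\<in>B. s_norm N (op (Lstar_star x) \<xi>))"

definition tau_star :: "Lstar topology"
  where "tau_star =
    seminorm_topology UNIV {Lstar_seminorm N B | N B. s_bounded B \<and> B \<noteq> {}}"

definition star_subalgebra :: "Lstar set \<Rightarrow> bool"
  where "star_subalgebra F \<longleftrightarrow>
    0 \<in> F \<and> (\<forall>x\<in>F. \<forall>y\<in>F. x + y \<in> F \<and> x * y \<in> F) \<and>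
    (\<forall>c. \<forall>x\<in>F. Lstar_scale c x \<in> F) \<and> (\<forall>x\<in>F. Lstar_star x \<in> F)"

definition complemented :: "Lstar set \<Rightarrow> bool"
  where "complemented F \<longleftrightarrow>
    (\<exists>P. lin_on Lstar_scale Lstar_scale UNIV P \<and> continuous_map tau_star tau_star P \<and>
      (\<forall>x. P (P x) = P x) \<and> range P = F)"

text \<open>\<open>F \<subseteq> L(\<ell>\<^sub>2)\<close>: every element of \<open>F\<close> extends to a bounded operator on \<open>\<ell>\<^sub>2\<close>.\<close>

definition extends_bounded :: "Lstar \<Rightarrow> bool"
  where "extends_bounded x \<longleftrightarrow>
    (\<exists>X. X ` ell2 \<subseteq> ell2 \<and> lin_on seq_scale seq_scale ell2 X \<and>
      (\<exists>C. \<forall>\<xi>\<in>ell2. ell2_norm (X \<xi>) \<le> C * ell2_norm \<xi>) \<and>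
      (\<forall>\<xi>. X (seq \<xi>) = seq (op x \<xi>)))"

definition bounded_operators :: "Lstar set \<Rightarrow> bool"
  where "bounded_operators F \<longleftrightarrow> (\<forall>x\<in>F. extends_bounded x)"

definition star_isomorphic_to ::
  "(complex \<Rightarrow> 'a::ring \<Rightarrow> 'a) \<Rightarrow> ('a \<Rightarrow> 'a) \<Rightarrow> 'a topology \<Rightarrow> Lstar set \<Rightarrow> bool"
  where "star_isomorphic_to sc star T F \<longleftrightarrow>
    (\<exists>\<phi>. lin_on sc Lstar_scale UNIV \<phi> \<and>
      (\<forall>x y. \<phi> (x * y) = \<phi> x * \<phi> y) \<and>
      (\<forall>x. \<phi> (star x) = Lstar_star (\<phi> x)) \<and>
      homeomorphic_map T (subtopology tau_star F) \<phi>)"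

end

theory Submission
  imports Defs
begin

text \<open>
  (a) Let \<open>X\<^sub>k\<close> be the span of the first \<open>k\<close> unit vectors of \<open>\<Lambda>\<^sub>\<infinity>(\<alpha>)\<close>.  Gram--Schmidt with respect to
  the dominating scalar product gives unit vectors \<open>e\<^sub>k \<in> X\<^sub>k\<^sub>+\<^sub>1\<close> orthogonal to \<open>X\<^sub>k\<close>.  Domination bounds
  \<open>|e\<^sub>k|\<^sub>q\<close> by a power of \<open>exp \<alpha>\<^sub>k\<close>, and since \<open>(x, e\<^sub>k)\<close> only depends on the tail of \<open>x\<close>, it decays
  faster than every power of \<open>exp (- \<alpha>\<^sub>k)\<close>.  Nuclearity makes \<open>exp \<alpha>\<^sub>k\<close> comparable, up to powers, with
  distinct integers \<open>n\<^sub>k\<close>, so that \<open>e\<^sub>k \<mapsto>\<close> (unit vector \<open>n\<^sub>k\<close>) is an isometric embedding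
  \<open>V : E \<rightarrow> s\<close> whose adjoint \<open>W : s \<rightarrow> E\<close> is a continuous left inverse.  The left regular
  representation \<open>x \<mapsto> V (x \<cdot> W \<xi>)\<close> is the required embedding, and \<open>t \<mapsto> W (t (V 1))\<close> is its
  continuous left inverse on all of \<open>L\<^sup>*(s)\<close>.

  (b) By Baire's theorem there is a single \<open>k\<close> with \<open>|x e\<^sub>j|\<^sub>0 \<le> C p(x) j\<^sup>k\<close> for all \<open>x\<close> and \<open>j\<close>,
  so \<open>(x, y) = \<Sum>\<^sub>j \<langle>x e\<^sub>j, y e\<^sub>j\<rangle> j\<^sup>-\<^sup>2\<^sup>k\<^sup>-\<^sup>2\<close> is a continuous scalar product.  It dominates, because
  \<open>|x \<xi>|\<^sub>N\<^sup>2 \<le> |x \<xi>|\<^sub>0 |x \<xi>|\<^sub>2\<^sub>N\<close> and \<open>|x \<xi>|\<^sub>0 \<le> |\<xi>|\<^sub>k\<^sub>+\<^sub>1 \<parallel>x\<parallel>\<close>; commutativity enters only through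
  \<open>|x\<^sup>* \<xi>|\<^sub>0 = |x \<xi>|\<^sub>0\<close>.
\<close>

section \<open>Weighted \<open>\<ell>\<^sub>2\<close> norms\<close>

text \<open>The obstacle is uniformity. Multiplication in \<open>E\<close> is only separately
  continuous, and an element of L*(s) is by definition just a linear map with an adjoint. One Baire
  argument, \<open>uniform_bound\<close>, turns pointwise bounds into uniform ones in three places:
  continuity of each operator on s, boundedness of x \<mapsto> x * W \<xi> uniformly for \<xi> in a
  bounded set, and the common exponent k in (b). In (a) the algebra rests on two facts: W is the
  adjoint of V, and W (V x) = x. Hence W V cancels in a product of two operators V (x * W .), and
  the adjoint of such an operator belongs to the adjoint of x. The integers n_k leave gaps, and W
  sends the unit vectors at the gaps to 0, so V W is a projection rather than the identity. In (b)
  the topology has a seminorm for each of uncountably many bounded sets; metrizability of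
  \<open>E\<close> selects a sequence of them. The exponent 2k + 2 allows one power of j beyond the
  growth j^k, which makes the series converge.\<close>

lemma suminf_Cauchy_Schwarz:
  fixes a b :: "nat \<Rightarrow> real"
  assumes a: "summable (\<lambda>j. (a j)\<^sup>2)" and b: "summable (\<lambda>j. (b j)\<^sup>2)"
  shows "summable (\<lambda>j. \<bar>a j * b j\<bar>)"
    and "(\<Sum>j. \<bar>a j * b j\<bar>) \<le> sqrt (\<Sum>j. (a j)\<^sup>2) * sqrt (\<Sum>j. (b j)\<^sup>2)"
proof -
  have le: "(\<Sum>j<n. \<bar>a j * b j\<bar>) \<le> sqrt (\<Sum>j. (a j)\<^sup>2) * sqrt (\<Sum>j. (b j)\<^sup>2)" for n
  proof -
    have "(\<Sum>j<n. \<bar>a j * b j\<bar>) \<le> L2_set a {..<n} * L2_set b {..<n}"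
      using L2_set_mult_ineq[of a b "{..<n}"] by (simp add: abs_mult)
    also have "\<dots> \<le> sqrt (\<Sum>j. (a j)\<^sup>2) * sqrt (\<Sum>j. (b j)\<^sup>2)"
      unfolding L2_set_def
      by (intro mult_mono real_sqrt_le_mono sum_le_suminf a b real_sqrt_ge_zero sum_nonneg suminf_nonneg) auto
    finally show ?thesis .
  qed
  show s: "summable (\<lambda>j. \<bar>a j * b j\<bar>)"
    by (rule bounded_imp_summable[where B="sqrt (\<Sum>j. (a j)\<^sup>2) * sqrt (\<Sum>j. (b j)\<^sup>2)"])
      (use le[of "Suc _"] in \<open>auto simp: lessThan_Suc_atMost\<close>)
  show "(\<Sum>j. \<bar>a j * b j\<bar>) \<le> sqrt (\<Sum>j. (a j)\<^sup>2) * sqrt (\<Sum>j. (b j)\<^sup>2)"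
    by (rule suminf_le_const[OF s le])
qed

text \<open>Common form of \<open>s_norm\<close>, \<open>Lambda_norm\<close> and
  \<open>ell2_norm\<close>. The weight multiplies the squared modulus.\<close>

definition weighted_norm :: "(nat \<Rightarrow> real) \<Rightarrow> (nat \<Rightarrow> complex) \<Rightarrow> real"
  where "weighted_norm w \<xi> = sqrt (\<Sum>j. (cmod (\<xi> j))\<^sup>2 * w j)"

lemma weighted_norm_nonneg:
  assumes "\<And>j. 0 \<le> w j" "summable (\<lambda>j. (cmod (\<xi> j))\<^sup>2 * w j)"
  shows "0 \<le> weighted_norm w \<xi>"
  unfolding weighted_norm_def using assms by (intro real_sqrt_ge_zero suminf_nonneg) auto

lemma weighted_norm_sq:
  assumes "\<And>j. 0 \<le> w j" "summable (\<lambda>j. (cmod (\<xi> j))\<^sup>2 * w j)"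
  shows "(weighted_norm w \<xi>)\<^sup>2 = (\<Sum>j. (cmod (\<xi> j))\<^sup>2 * w j)"
  unfolding weighted_norm_def using assms by (subst real_sqrt_pow2) (auto intro: suminf_nonneg)

lemma weighted_partial_sum_le:
  assumes "\<And>j. 0 \<le> w j" "summable (\<lambda>j. (cmod (\<xi> j))\<^sup>2 * w j)"
  shows "(\<Sum>j<n. (cmod (\<xi> j))\<^sup>2 * w j) \<le> (weighted_norm w \<xi>)\<^sup>2"
  using assms by (subst weighted_norm_sq) (auto intro!: sum_le_suminf)

text \<open>Bounded finite sections give membership and norm at once. This is how a bound survives a
  coordinatewise limit, in the completeness of s and in the extension to
  \<open>ell2\<close>.\<close>

lemma weighted_norm_boundI:
  assumes w: "\<And>j. 0 \<le> w j" and M: "0 \<le> M"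
    and le: "\<And>n. (\<Sum>j<n. (cmod (\<xi> j))\<^sup>2 * w j) \<le> M\<^sup>2"
  shows "summable (\<lambda>j. (cmod (\<xi> j))\<^sup>2 * w j)" "weighted_norm w \<xi> \<le> M"
proof -
  show s: "summable (\<lambda>j. (cmod (\<xi> j))\<^sup>2 * w j)"
    by (rule bounded_imp_summable[where B="M\<^sup>2"])
      (use w le[of "Suc _"] in \<open>auto simp: lessThan_Suc_atMost\<close>)
  have "(weighted_norm w \<xi>)\<^sup>2 \<le> M\<^sup>2"
    using weighted_norm_sq[OF w s] suminf_le_const[OF s le] by simp
  then show "weighted_norm w \<xi> \<le> M" using M power2_le_imp_le by blast
qed

lemma weighted_norm_coord:
  assumes "\<And>j. 0 \<le> w j" "summable (\<lambda>j. (cmod (\<xi> j))\<^sup>2 * w j)"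
  shows "cmod (\<xi> i) * sqrt (w i) \<le> weighted_norm w \<xi>"
proof -
  have "(cmod (\<xi> i) * sqrt (w i))\<^sup>2 \<le> (\<Sum>j<Suc i. (cmod (\<xi> j))\<^sup>2 * w j)"
    using assms by (auto simp: power_mult_distrib intro!: sum_nonneg)
  also have "\<dots> \<le> (weighted_norm w \<xi>)\<^sup>2" by (rule weighted_partial_sum_le[OF assms])
  finally show ?thesis using weighted_norm_nonneg[OF assms] power2_le_imp_le by blast
qed

lemma weighted_norm_triangle:
  assumes w: "\<And>j. 0 \<le> w j"
    and s: "summable (\<lambda>j. (cmod (\<xi> j))\<^sup>2 * w j)" "summable (\<lambda>j. (cmod (\<eta> j))\<^sup>2 * w j)"
  shows "weighted_norm w (\<xi> + \<eta>) \<le> weighted_norm w \<xi> + weighted_norm w \<eta>"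
proof (rule weighted_norm_boundI(2)[OF w])
  have nn: "0 \<le> weighted_norm w \<xi>" "0 \<le> weighted_norm w \<eta>"
    using weighted_norm_nonneg[OF w] s by auto
  then show "0 \<le> weighted_norm w \<xi> + weighted_norm w \<eta>" by simp
  fix n
  \<comment> \<open>Absorbing the root of the weight into the coefficients reduces the claim to
    Minkowski's inequality for \<open>L2_set\<close> on finite sections.\<close>
  let ?a = "\<lambda>j. cmod (\<xi> j) * sqrt (w j)" and ?b = "\<lambda>j. cmod (\<eta> j) * sqrt (w j)"
  have 1: "L2_set ?a {..<n} \<le> weighted_norm w \<xi>" "L2_set ?b {..<n} \<le> weighted_norm w \<eta>"
    using weighted_partial_sum_le[OF w s(1), of n] weighted_partial_sum_le[OF w s(2), of n] nn w
    by (auto simp: L2_set_def power_mult_distrib intro!: real_le_lsqrt sum_nonneg)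
  have "(\<Sum>j<n. (cmod ((\<xi> + \<eta>) j))\<^sup>2 * w j) \<le> (\<Sum>j<n. (?a j + ?b j)\<^sup>2)"
  proof (rule sum_mono)
    fix j
    have "(cmod ((\<xi> + \<eta>) j))\<^sup>2 * w j \<le> (cmod (\<xi> j) + cmod (\<eta> j))\<^sup>2 * w j"
      using w by (intro mult_right_mono power_mono) (auto intro: norm_triangle_ineq)
    also have "\<dots> = (?a j + ?b j)\<^sup>2"
      using w by (simp add: distrib_right[symmetric] power_mult_distrib)
    finally show "(cmod ((\<xi> + \<eta>) j))\<^sup>2 * w j \<le> (?a j + ?b j)\<^sup>2" .
  qed
  also have "\<dots> = (L2_set (\<lambda>j. ?a j + ?b j) {..<n})\<^sup>2"
    by (simp add: L2_set_def sum_nonneg)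
  also have "\<dots> \<le> (weighted_norm w \<xi> + weighted_norm w \<eta>)\<^sup>2"
    using L2_set_triangle_ineq[of ?a ?b "{..<n}"] 1
    by (intro power_mono) auto
  finally show "(\<Sum>j<n. (cmod ((\<xi> + \<eta>) j))\<^sup>2 * w j) \<le> (weighted_norm w \<xi> + weighted_norm w \<eta>)\<^sup>2" .
qed

lemma weighted_norm_scale:
  assumes "summable (\<lambda>j. (cmod (\<xi> j))\<^sup>2 * w j)"
  shows "weighted_norm w (seq_scale c \<xi>) = cmod c * weighted_norm w \<xi>"
proof -
  have "(\<Sum>j. (cmod (seq_scale c \<xi> j))\<^sup>2 * w j) = (cmod c)\<^sup>2 * (\<Sum>j. (cmod (\<xi> j))\<^sup>2 * w j)"
    using assms by (subst suminf_mult[symmetric])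
      (auto simp: seq_scale_def norm_mult power_mult_distrib mult.assoc)
  then show ?thesis by (simp add: weighted_norm_def real_sqrt_mult)
qed

section \<open>The space \<open>s\<close>\<close>

abbreviation s_weight :: "nat \<Rightarrow> nat \<Rightarrow> real"
  where "s_weight q \<equiv> (\<lambda>j. real (Suc j) ^ (2 * q))"

lemma s_norm_eq: "s_norm q \<xi> = weighted_norm (s_weight q) (seq \<xi>)"
  by (simp add: s_norm_def weighted_norm_def)

lemma s_summable: "summable (\<lambda>j. (cmod (seq \<xi> j))\<^sup>2 * real (Suc j) ^ (2 * q))"
  using seq[of \<xi>] unfolding rapidly_decreasing_def by blast

lemma s_norm_nonneg: "0 \<le> s_norm q \<xi>"
  unfolding s_norm_eq by (rule weighted_norm_nonneg[OF _ s_summable]) simp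

lemma s_norm_seminorm: "seminorm_on s_scale UNIV (s_norm q)"
  unfolding seminorm_on_def
proof (intro conjI ballI allI)
  show "0 \<le> s_norm q \<xi>" for \<xi> by (rule s_norm_nonneg)
  show "s_norm q (\<xi> + \<eta>) \<le> s_norm q \<xi> + s_norm q \<eta>" for \<xi> \<eta>
    unfolding s_norm_eq seq_add by (rule weighted_norm_triangle[OF _ s_summable s_summable]) simp
  show "s_norm q (s_scale c \<xi>) = cmod c * s_norm q \<xi>" for c \<xi>
    unfolding s_norm_eq seq_s_scale by (rule weighted_norm_scale[OF s_summable])
qed

lemma s_norm_mono: "q \<le> r \<Longrightarrow> s_norm q \<xi> \<le> s_norm r \<xi>"
  unfolding s_norm_def
  by (intro real_sqrt_le_mono suminf_le s_summable mult_left_mono power_increasing) auto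

lemma s_norm_coord: "cmod (seq \<xi> j) * real (Suc j) ^ q \<le> s_norm q \<xi>"
  using weighted_norm_coord[of "s_weight q" "seq \<xi>" j, OF _ s_summable]
  by (simp add: s_norm_eq power_mult power_even_eq real_sqrt_power)

lemma s_inner_bound: "cmod (s_inner \<xi> \<eta>) \<le> s_norm 0 \<xi> * s_norm 0 \<eta>"
proof -
  have s: "summable (\<lambda>j. (cmod (seq \<xi> j))\<^sup>2)" for \<xi> using s_summable[of \<xi> 0] by simp
  note CS = suminf_Cauchy_Schwarz[OF s s, of \<xi> \<eta>]
  have "cmod (s_inner \<xi> \<eta>) \<le> (\<Sum>j. cmod (seq \<xi> j * cnj (seq \<eta> j)))"
    unfolding s_inner_def ell2_inner_def
    by (rule summable_norm) (use CS(1) in \<open>simp add: norm_mult abs_mult\<close>)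
  also have "\<dots> \<le> s_norm 0 \<xi> * s_norm 0 \<eta>"
    using CS(2) by (simp add: norm_mult abs_mult s_norm_def)
  finally show ?thesis .
qed

lemma s_inner_self: "s_inner \<xi> \<xi> = of_real ((s_norm 0 \<xi>)\<^sup>2)"
proof -
  have s: "summable (\<lambda>j. (cmod (seq \<xi> j))\<^sup>2)" using s_summable[of \<xi> 0] by simp
  have "(s_norm 0 \<xi>)\<^sup>2 = (\<Sum>j. (cmod (seq \<xi> j))\<^sup>2)"
    using s by (simp add: s_norm_def suminf_nonneg)
  then show ?thesis
    using s by (simp add: s_inner_def ell2_inner_def complex_norm_square[symmetric] suminf_of_real)
qed

lemma s_norm_zero_imp: "s_norm 0 \<xi> = 0 \<Longrightarrow> \<xi> = 0"
proof -
  assume "s_norm 0 \<xi> = 0"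
  then have "seq \<xi> j = 0" for j using s_norm_coord[of \<xi> j 0] by simp
  then show "\<xi> = 0" by (simp add: seq_inject[symmetric] seq_zero fun_eq_iff)
qed

text \<open>With j for \<open>Suc j\<close>, each term |\<xi>_j|^2 j^(2N) splits as |\<xi>_j| times
  |\<xi>_j| j^(2N), and Cauchy-Schwarz applies. The domination in part (b) stems from this
  inequality.\<close>

lemma s_norm_interpolation: "(s_norm N \<xi>)\<^sup>2 \<le> s_norm 0 \<xi> * s_norm (2 * N) \<xi>"
proof -
  have s0: "summable (\<lambda>j. (cmod (seq \<xi> j))\<^sup>2)" using s_summable[of \<xi> 0] by simp
  have s2: "summable (\<lambda>j. (cmod (seq \<xi> j) * real (Suc j) ^ (2 * N))\<^sup>2)"
    using s_summable[of \<xi> "2 * N"] by (simp add: power_mult_distrib power_mult[symmetric] mult_ac)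
  have "(s_norm N \<xi>)\<^sup>2 = (\<Sum>j. (cmod (seq \<xi> j))\<^sup>2 * real (Suc j) ^ (2 * N))"
    unfolding s_norm_eq by (rule weighted_norm_sq[OF _ s_summable]) simp
  also have "\<dots> = (\<Sum>j. \<bar>cmod (seq \<xi> j) * (cmod (seq \<xi> j) * real (Suc j) ^ (2 * N))\<bar>)"
    by (simp add: power2_eq_square mult.assoc)
  also have "\<dots> \<le> sqrt (\<Sum>j. (cmod (seq \<xi> j))\<^sup>2) * sqrt (\<Sum>j. (cmod (seq \<xi> j) * real (Suc j) ^ (2 * N))\<^sup>2)"
    by (rule suminf_Cauchy_Schwarz(2)[OF s0 s2])
  also have "\<dots> = s_norm 0 \<xi> * s_norm (2 * N) \<xi>"
    by (simp add: s_norm_def power_mult_distrib power_mult[symmetric] mult_ac)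
  finally show ?thesis .
qed

section \<open>Seminorms and topologies\<close>

lemma seminorm_onD:
  assumes "seminorm_on sc X p"
  shows "x \<in> X \<Longrightarrow> 0 \<le> p x" "x \<in> X \<Longrightarrow> y \<in> X \<Longrightarrow> p (x + y) \<le> p x + p y"
    "x \<in> X \<Longrightarrow> p (sc c x) = cmod c * p x"
  using assms unfolding seminorm_on_def by auto

locale complex_vector_space = vector_space scale
  for scale :: "complex \<Rightarrow> 'v::ab_group_add \<Rightarrow> 'v"
begin

lemma seminorm_zero:
  assumes "subspace X" "seminorm_on scale X p"
  shows "p 0 = 0"
  using seminorm_onD(3)[OF assms(2), of 0 0] subspace_0[OF assms(1)] by simp

lemma seminorm_uminus:
  assumes "seminorm_on scale X p" "x \<in> X"
  shows "p (- x) = p x"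
  using seminorm_onD(3)[OF assms, of "- 1"] by simp

lemma seminorm_minus_commute:
  assumes "subspace X" "seminorm_on scale X p" "x \<in> X" "y \<in> X"
  shows "p (x - y) = p (y - x)"
  using seminorm_uminus[OF assms(2), of "x - y"] subspace_diff[OF assms(1)] assms(3,4) by simp

lemma seminorm_diff_triangle:
  assumes "subspace X" "seminorm_on scale X p" "x \<in> X" "y \<in> X" "z \<in> X"
  shows "p (x - z) \<le> p (x - y) + p (y - z)"
  using seminorm_onD(2)[OF assms(2), of "x - y" "y - z"] subspace_diff[OF assms(1)] assms(3-5) by simp

lemma seminorm_sum_le:
  assumes "seminorm_on scale UNIV p"
  shows "p (sum f A) \<le> (\<Sum>a\<in>A. p (f a))"
proof (cases "finite A")
  case True
  then show ?thesis
  proof (induction A)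
    case empty
    then show ?case using seminorm_zero[OF subspace_UNIV assms] by simp
  next
    case (insert a A)
    then show ?case using seminorm_onD(2)[OF assms, of "f a" "sum f A"] by simp
  qed
next
  case False
  then show ?thesis using seminorm_zero[OF subspace_UNIV assms] by simp
qed

end

text \<open>Balls of a single member of \<open>P\<close> form a neighbourhood base, so open sets are
  tested with one seminorm instead of finite intersections. For \<open>seminorm_topology\<close>,
  given by a subbase, this holds once \<open>P\<close> is directed.\<close>

definition seminorm_generated :: "'v::ab_group_add set \<Rightarrow> ('v \<Rightarrow> real) set \<Rightarrow> 'v topology \<Rightarrow> bool"
  where "seminorm_generated X P T \<longleftrightarrow> P \<noteq> {} \<and>
    (\<forall>U. openin T U \<longleftrightarrow> U \<subseteq> X \<and> (\<forall>x\<in>U. \<exists>p\<in>P. \<exists>\<epsilon>>0. {y \<in> X. p (y - x) < \<epsilon>} \<subseteq> U))"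

lemma seminorm_generated_topspace:
  assumes "seminorm_generated X P T"
  shows "topspace T = X"
proof
  show "topspace T \<subseteq> X" using assms openin_topspace[of T] unfolding seminorm_generated_def by blast
  have "P \<noteq> {}" using assms unfolding seminorm_generated_def by (rule conjunct1)
  then obtain p where "p \<in> P" by blast
  then have "\<forall>x\<in>X. \<exists>p\<in>P. \<exists>\<epsilon>>0. {y \<in> X. p (y - x) < \<epsilon>} \<subseteq> X"
    by (intro ballI bexI[of _ p] exI[of _ "1::real"]) auto
  then have "openin T X" using assms unfolding seminorm_generated_def by simp
  then show "X \<subseteq> topspace T" by (rule openin_subset)
qed

lemma seminorm_generated_openD:
  assumes "seminorm_generated X P T" "openin T U" "x \<in> U"
  shows "\<exists>p\<in>P. \<exists>\<epsilon>>0. \<forall>y\<in>X. p (y - x) < \<epsilon> \<longrightarrow> y \<in> U"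
proof -
  have "\<forall>x\<in>U. \<exists>p\<in>P. \<exists>\<epsilon>>0. {y \<in> X. p (y - x) < \<epsilon>} \<subseteq> U"
    using assms(1,2) unfolding seminorm_generated_def by simp
  then have "\<exists>p\<in>P. \<exists>\<epsilon>>0. {y \<in> X. p (y - x) < \<epsilon>} \<subseteq> U" using assms(3) by (rule bspec)
  then show ?thesis by blast
qed

lemma seminorm_generated_openI:
  assumes "seminorm_generated X P T" "U \<subseteq> X"
    and "\<And>x. x \<in> U \<Longrightarrow> \<exists>p\<in>P. \<exists>\<epsilon>>0. \<forall>y\<in>X. p (y - x) < \<epsilon> \<longrightarrow> y \<in> U"
  shows "openin T U"
proof -
  have "\<exists>p\<in>P. \<exists>\<epsilon>>0. {y \<in> X. p (y - x) < \<epsilon>} \<subseteq> U" if "x \<in> U" for x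
    using assms(3)[OF that] by blast
  then show ?thesis using assms(1,2) unfolding seminorm_generated_def by simp
qed

lemma seminorm_generated_seminorm_topology:
  assumes vs: "vector_space sc" and X: "module.subspace sc X"
    and P: "P \<noteq> {}" "\<And>p. p \<in> P \<Longrightarrow> seminorm_on sc X p"
    and dir: "\<And>p q. p \<in> P \<Longrightarrow> q \<in> P \<Longrightarrow> \<exists>r\<in>P. \<forall>x\<in>X. p x \<le> r x \<and> q x \<le> r x"
  shows "seminorm_generated X P (seminorm_topology X P)"
proof -
  interpret complex_vector_space sc using vs by (simp add: complex_vector_space_def)
  let ?S = "insert X {{y \<in> X. p (y - x) < \<epsilon>} | p x \<epsilon>. p \<in> P \<and> x \<in> X \<and> 0 < \<epsilon>}"
  define nb where "nb U \<longleftrightarrow> U \<subseteq> X \<and> (\<forall>x\<in>U. \<exists>p\<in>P. \<exists>\<epsilon>>0. {y \<in> X. p (y - x) < \<epsilon>} \<subseteq> U)" for U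
  have nbX: "x \<in> X" if "nb U" "x \<in> U" for U x using that unfolding nb_def by blast
  have nbD: "\<exists>p\<in>P. \<exists>\<epsilon>>0. {y \<in> X. p (y - x) < \<epsilon>} \<subseteq> U" if "nb U" "x \<in> U" for U x
    using that unfolding nb_def by blast
  have nbI: "nb U" if "U \<subseteq> X" "\<And>x. x \<in> U \<Longrightarrow> \<exists>p\<in>P. \<exists>\<epsilon>>0. {y \<in> X. p (y - x) < \<epsilon>} \<subseteq> U" for U
    unfolding nb_def by (intro conjI ballI that)
  \<comment> \<open>Induction over the subbase: directedness serves for intersections, and a
    subbasic ball is handled by shrinking the radius to
    \<open>\<epsilon> - p (z - x)\<close>.\<close>
  have "nb U" if "generate_topology_on ?S U" for U
    using that
  proof (induction U)
    case Empty
    show ?case by (simp add: nb_def)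
  next
    case (Int a b)
    have "\<exists>p\<in>P. \<exists>\<epsilon>>0. {y \<in> X. p (y - x) < \<epsilon>} \<subseteq> a \<inter> b" if xab: "x \<in> a \<inter> b" for x
    proof -
      obtain p \<epsilon> where p: "p \<in> P" "\<epsilon> > 0" "{y \<in> X. p (y - x) < \<epsilon>} \<subseteq> a"
        using nbD[OF Int.IH(1), of x] xab by blast
      obtain q \<delta> where q: "q \<in> P" "\<delta> > 0" "{y \<in> X. q (y - x) < \<delta>} \<subseteq> b"
        using nbD[OF Int.IH(2), of x] xab by blast
      have xX: "x \<in> X" using xab nbX[OF Int.IH(1)] by blast
      obtain r where r: "r \<in> P" "\<And>x. x \<in> X \<Longrightarrow> p x \<le> r x \<and> q x \<le> r x" using dir p(1) q(1) by blast
      have "{y \<in> X. r (y - x) < min \<epsilon> \<delta>} \<subseteq> a \<inter> b"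
      proof
        fix y assume "y \<in> {y \<in> X. r (y - x) < min \<epsilon> \<delta>}"
        then have y: "y \<in> X" "r (y - x) < \<epsilon>" "r (y - x) < \<delta>" by auto
        then have "p (y - x) < \<epsilon>" "q (y - x) < \<delta>" using r(2)[of "y - x"] subspace_diff[OF X y(1) xX] by auto
        then show "y \<in> a \<inter> b" using p(3) q(3) y(1) by blast
      qed
      then show ?thesis using r(1) p(2) q(2) by (intro bexI[of _ r] exI[of _ "min \<epsilon> \<delta>"]) auto
    qed
    then show ?case using nbX[OF Int.IH(1)] by (intro nbI) auto
  next
    case (UN K)
    have "\<Union>K \<subseteq> X" using nbX[OF UN.IH] by blast
    moreover have "\<exists>p\<in>P. \<exists>\<epsilon>>0. {y \<in> X. p (y - x) < \<epsilon>} \<subseteq> \<Union>K" if xK: "x \<in> \<Union>K" for x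
    proof -
      obtain k where k: "k \<in> K" "x \<in> k" using xK by blast
      obtain p \<epsilon> where "p \<in> P" "\<epsilon> > 0" "{y \<in> X. p (y - x) < \<epsilon>} \<subseteq> k"
        using nbD[OF UN.IH[OF k(1)] k(2)] by blast
      then show ?thesis using k(1) by (meson Union_upper order_trans)
    qed
    ultimately show ?case by (intro nbI)
  next
    case (Basis U)
    show ?case
    proof (cases "U = X")
      case True
      obtain p where "p \<in> P" using P(1) by blast
      then show ?thesis using True unfolding nb_def by (auto intro!: bexI[of _ p] exI[of _ "1::real"])
    next
      case False
      then obtain p x \<epsilon> where U: "U = {y \<in> X. p (y - x) < \<epsilon>}" "p \<in> P" "x \<in> X" "0 < \<epsilon>"
        using Basis by blast
      have "{y \<in> X. p (y - z) < \<epsilon> - p (z - x)} \<subseteq> U" if "z \<in> U" for z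
      proof
        fix y assume y: "y \<in> {y \<in> X. p (y - z) < \<epsilon> - p (z - x)}"
        have "p (y - x) \<le> p (y - z) + p (z - x)"
          using seminorm_diff_triangle[OF X P(2)[OF U(2)]] y that U by blast
        then show "y \<in> U" using y U by auto
      qed
      moreover have "\<epsilon> - p (z - x) > 0" if "z \<in> U" for z using that U by simp
      ultimately have "\<exists>p\<in>P. \<exists>\<epsilon>>0. {y \<in> X. p (y - z) < \<epsilon>} \<subseteq> U" if "z \<in> U" for z
        using U(2) that by (intro bexI[of _ p] exI[of _ "\<epsilon> - p (z - x)"]) auto
      then show ?thesis using U(1) by (intro nbI) auto
    qed
  qed
  moreover have "generate_topology_on ?S U" if nbU: "nb U" for U
  proof -
    let ?K = "{V \<in> ?S. V \<subseteq> U}"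
    have "\<Union>?K = U"
    proof
      show "U \<subseteq> \<Union>?K"
      proof
        fix x assume x: "x \<in> U"
        obtain p \<epsilon> where p: "p \<in> P" "\<epsilon> > 0" "{y \<in> X. p (y - x) < \<epsilon>} \<subseteq> U"
          using nbD[OF nbU x] by blast
        have xX: "x \<in> X" using nbX[OF nbU x] .
        have "x \<in> {y \<in> X. p (y - x) < \<epsilon>}" using seminorm_zero[OF X P(2)[OF p(1)]] p(2) xX by simp
        moreover have "{y \<in> X. p (y - x) < \<epsilon>} \<in> ?S"
          using p(1,2) xX by (intro insertI2 CollectI exI[of _ p] exI[of _ x] exI[of _ \<epsilon>]) simp
        then have "{y \<in> X. p (y - x) < \<epsilon>} \<in> ?K" using p(3) by (intro CollectI conjI)
        ultimately show "x \<in> \<Union>?K" by (rule UnionI[rotated])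
      qed
    qed blast
    moreover have "generate_topology_on ?S (\<Union>?K)"
      by (rule generate_topology_on.UN) (blast intro: generate_topology_on.Basis)
    ultimately show ?thesis by simp
  qed
  ultimately have eq: "generate_topology_on ?S U \<longleftrightarrow> nb U" for U by (intro iffI)
  show ?thesis
    unfolding seminorm_generated_def seminorm_topology_def openin_topology_generated_by_iff eq nb_def
    by (intro conjI allI refl P(1))
qed

lemma seminorm_generated_continuous_map:
  assumes T: "seminorm_generated X P T" and S: "seminorm_generated Y Q S"
    and f: "f ` X \<subseteq> Y" "\<And>x y. x \<in> X \<Longrightarrow> y \<in> X \<Longrightarrow> f (x - y) = f x - f y"
    and X: "\<And>x y. x \<in> X \<Longrightarrow> y \<in> X \<Longrightarrow> x - y \<in> X"
    and bd: "\<And>q. q \<in> Q \<Longrightarrow> \<exists>p\<in>P. \<exists>C. \<forall>x\<in>X. q (f x) \<le> C * p x"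
    and nn: "\<And>p x. p \<in> P \<Longrightarrow> x \<in> X \<Longrightarrow> 0 \<le> p x"
  shows "continuous_map T S f"
  unfolding continuous_map_def
proof (intro conjI allI impI)
  show "f \<in> topspace T \<rightarrow> topspace S"
    using f(1) seminorm_generated_topspace[OF T] seminorm_generated_topspace[OF S] by auto
  fix U assume U: "openin S U"
  show "openin T {x \<in> topspace T. f x \<in> U}"
  proof (rule seminorm_generated_openI[OF T])
    show "{x \<in> topspace T. f x \<in> U} \<subseteq> X" using seminorm_generated_topspace[OF T] by auto
    fix x assume "x \<in> {x \<in> topspace T. f x \<in> U}"
    then have x: "x \<in> X" "f x \<in> U" using seminorm_generated_topspace[OF T] by auto
    obtain q \<epsilon> where q: "q \<in> Q" "\<epsilon> > 0" "\<And>y. y \<in> Y \<Longrightarrow> q (y - f x) < \<epsilon> \<Longrightarrow> y \<in> U"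
      using seminorm_generated_openD[OF S U x(2)] by blast
    obtain p C where p: "p \<in> P" "\<And>x. x \<in> X \<Longrightarrow> q (f x) \<le> C * p x" using bd[OF q(1)] by blast
    \<comment> \<open>\<open>C\<close> may have any sign; dividing by
      \<open>\<bar>C\<bar> + 1\<close> keeps the radius positive.\<close>
    have "f y \<in> U" if y: "y \<in> X" "p (y - x) < \<epsilon> / (\<bar>C\<bar> + 1)" for y
    proof (rule q(3))
      show "f y \<in> Y" using f y by auto
      have "q (f y - f x) \<le> C * p (y - x)" using p(2)[of "y - x"] X f(2) y x by simp
      also have "\<dots> \<le> (\<bar>C\<bar> + 1) * p (y - x)" using nn[OF p(1) X[OF y(1) x(1)]] by (intro mult_right_mono) auto
      also have "\<dots> < \<epsilon>" using y(2) by (simp add: field_simps)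
      finally show "q (f y - f x) < \<epsilon>" .
    qed
    then show "\<exists>p\<in>P. \<exists>\<epsilon>>0. \<forall>y\<in>X. p (y - x) < \<epsilon> \<longrightarrow> y \<in> {x \<in> topspace T. f x \<in> U}"
      using p(1) q(2) seminorm_generated_topspace[OF T]
      by (intro bexI[of _ p] exI[of _ "\<epsilon> / (\<bar>C\<bar> + 1)"]) auto
  qed
qed

lemma seminorm_generated_continuous_seminorm:
  assumes vs: "vector_space sc" and X: "module.subspace sc X"
    and T: "seminorm_generated X P T" and u: "seminorm_on sc X u"
    and p: "p \<in> P" "seminorm_on sc X p" "\<And>x. x \<in> X \<Longrightarrow> u x \<le> C * p x"
  shows "continuous_seminorm sc T u"
proof -
  interpret complex_vector_space sc using vs by (simp add: complex_vector_space_def)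
  note ts = seminorm_generated_topspace[OF T]
  have "continuous_map T euclideanreal u"
    unfolding continuous_map_def
  proof (intro conjI allI impI)
    fix U :: "real set" assume U: "openin euclideanreal U"
    show "openin T {x \<in> topspace T. u x \<in> U}"
    proof (rule seminorm_generated_openI[OF T])
      show "{x \<in> topspace T. u x \<in> U} \<subseteq> X" using ts by auto
      fix x assume "x \<in> {x \<in> topspace T. u x \<in> U}"
      then have x: "x \<in> X" "u x \<in> U" using ts by auto
      obtain \<epsilon> where e: "\<epsilon> > 0" "\<And>r. \<bar>r - u x\<bar> < \<epsilon> \<Longrightarrow> r \<in> U"
        using U x(2) by (auto simp: open_dist dist_real_def)
      have "u y \<in> U" if y: "y \<in> X" "p (y - x) < \<epsilon> / (\<bar>C\<bar> + 1)" for y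
      proof (rule e(2))
        have yx: "y - x \<in> X" "x - y \<in> X" using subspace_diff[OF X] x y by auto
        have "u (y - x) \<le> C * p (y - x)" using p(3) yx by blast
        also have "\<dots> \<le> (\<bar>C\<bar> + 1) * p (y - x)" using seminorm_onD(1)[OF p(2) yx(1)] by (intro mult_right_mono) auto
        also have "\<dots> < \<epsilon>" using y(2) by (simp add: field_simps)
        finally have "u (y - x) < \<epsilon>" .
        moreover have "u y \<le> u (y - x) + u x" "u x \<le> u (y - x) + u y"
          using seminorm_onD(2)[OF u yx(1) x(1)] seminorm_onD(2)[OF u yx(2) y(1)]
            seminorm_minus_commute[OF X u x(1) y(1)] by auto
        ultimately show "\<bar>u y - u x\<bar> < \<epsilon>" by linarith
      qed
      then show "\<exists>p\<in>P. \<exists>\<epsilon>>0. \<forall>y\<in>X. p (y - x) < \<epsilon> \<longrightarrow> y \<in> {x \<in> topspace T. u x \<in> U}"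
        using p(1) e(1) ts by (intro bexI[of _ p] exI[of _ "\<epsilon> / (\<bar>C\<bar> + 1)"]) auto
    qed
  qed auto
  then show ?thesis using u ts by (simp add: continuous_seminorm_def)
qed

text \<open>The unit ball of \<open>u\<close> contains a ball of some \<open>p\<close>, and
  homogeneity turns this inclusion into an inequality: a violating \<open>x\<close>, rescaled to
  \<open>u x = 1\<close>, would lie in the ball of \<open>p\<close>.\<close>

lemma seminorm_generated_dominates:
  assumes vs: "vector_space sc" and X: "module.subspace sc X"
    and T: "seminorm_generated X P T" and P: "\<And>p. p \<in> P \<Longrightarrow> seminorm_on sc X p"
    and u: "continuous_seminorm sc T u"
  shows "\<exists>p\<in>P. \<exists>C>0. \<forall>x\<in>X. u x \<le> C * p x"
proof -
  interpret complex_vector_space sc using vs by (simp add: complex_vector_space_def)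
  note ts = seminorm_generated_topspace[OF T]
  have us: "seminorm_on sc X u" using u ts by (simp add: continuous_seminorm_def)
  have X0: "0 \<in> X" using subspace_0[OF X] .
  have op: "openin T {x \<in> topspace T. u x \<in> {..<1}}"
    using u unfolding continuous_seminorm_def
    by (intro openin_continuous_map_preimage[where Y=euclideanreal]) auto
  have "0 \<in> {x \<in> topspace T. u x \<in> {..<1}}" using seminorm_zero[OF X us] X0 ts by simp
  from seminorm_generated_openD[OF T op this] obtain p \<epsilon>
    where p: "p \<in> P" "\<epsilon> > 0" "\<And>x. x \<in> X \<Longrightarrow> p x < \<epsilon> \<Longrightarrow> u x < 1" by auto
  note ps = P[OF p(1)]
  have "u x \<le> 2 / \<epsilon> * p x" if x: "x \<in> X" for x
  proof (rule ccontr)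
    assume "\<not> ?thesis"
    then have lt: "2 / \<epsilon> * p x < u x" by simp
    have pn: "0 \<le> p x" using seminorm_onD(1)[OF ps x] .
    have up: "0 < u x" using lt pn p(2) by (smt (verit) divide_nonneg_pos mult_nonneg_nonneg)
    let ?c = "complex_of_real (1 / u x)"
    have c: "cmod ?c = 1 / u x" using up by (simp only: norm_of_real) simp
    have cx: "sc ?c x \<in> X" using subspace_scale[OF X x] .
    have "u (sc ?c x) = 1" using seminorm_onD(3)[OF us x, of ?c] c up by simp
    moreover have "p (sc ?c x) = p x / u x" using seminorm_onD(3)[OF ps x, of ?c] c by simp
    moreover have "p x / u x < \<epsilon>"
    proof -
      have "2 * p x < \<epsilon> * u x" using lt p(2) by (simp add: field_simps)
      then have "p x < \<epsilon> * u x" using pn by linarith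
      then show ?thesis using up by (simp add: field_simps)
    qed
    ultimately show False using p(3)[OF cx] by simp
  qed
  then show ?thesis using p(1,2) by (intro bexI[of _ p] exI[of _ "2 / \<epsilon>"]) auto
qed

section \<open>The Baire category argument\<close>

text \<open>A Frechet space seen through its seminorms alone, so that the Baire argument applies
  alike to s and to \<open>E\<close>. The limit \<open>l\<close> is only asserted to exist.\<close>

locale complete_seminorms = complex_vector_space sc
  for sc :: "complex \<Rightarrow> 'v::ab_group_add \<Rightarrow> 'v" and p :: "nat \<Rightarrow> 'v \<Rightarrow> real" +
  assumes seminorm: "seminorm_on sc UNIV (p q)"
    and mono_step: "p q x \<le> p (Suc q) x"
    and Cauchy_converges: "(\<And>q \<epsilon>. 0 < \<epsilon> \<Longrightarrow> \<exists>N::nat. \<forall>m\<ge>N. \<forall>n\<ge>N. p q (\<sigma> m - \<sigma> n) < \<epsilon>) \<Longrightarrow>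
      \<exists>l. \<forall>q. (\<lambda>n. p q (\<sigma> n - l)) \<longlonglongrightarrow> 0"
begin

lemmas pD = seminorm_onD[OF seminorm, simplified]

lemma p_mono: "q \<le> r \<Longrightarrow> p q x \<le> p r x"
  by (rule lift_Suc_mono_le[of "\<lambda>q. p q x"]) (use mono_step in auto)

lemma p_zero [simp]: "p q 0 = 0"
  using seminorm_zero[OF subspace_UNIV seminorm] .

lemma p_minus_commute: "p q (x - y) = p q (y - x)"
  using seminorm_minus_commute[OF subspace_UNIV seminorm] by simp

lemma p_triangle: "p q (x - z) \<le> p q (x - y) + p q (y - z)"
  using seminorm_diff_triangle[OF subspace_UNIV seminorm] by simp

text \<open>Grothendieck's factorization: nested balls inside the open sets where some \<open>v i\<close> exceeds \<open>w k i\<close>.\<close>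

lemma factorization:
  fixes v :: "'i \<Rightarrow> 'v \<Rightarrow> real" and w :: "nat \<Rightarrow> 'i \<Rightarrow> real"
  assumes v: "\<And>i. i \<in> I \<Longrightarrow> seminorm_on sc UNIV (v i)"
    and vc: "\<And>i. i \<in> I \<Longrightarrow> \<exists>q C. \<forall>x. v i x \<le> C * p q x"
    and pw: "\<And>x. \<exists>k. \<forall>i\<in>I. v i x \<le> w k i"
  shows "\<exists>k q. \<exists>\<epsilon>>0. \<forall>x. p q x < \<epsilon> \<longrightarrow> (\<forall>i\<in>I. v i x \<le> w k i)"
proof (rule ccontr)
  assume contra: "\<not> ?thesis"
  \<comment> \<open>A state \<open>(y, q, \<epsilon>)\<close> stands for the ball of the points
    \<open>z\<close> with \<open>p q (z - y) \<le> \<epsilon>\<close>. \<open>R k\<close> leads to a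
    smaller ball inside it on which a single \<open>v i\<close> exceeds \<open>w k i\<close>
    throughout.\<close>
  define R where "R k s s' \<longleftrightarrow> (case s of (y, q, \<epsilon>) \<Rightarrow> case s' of (y', q', \<epsilon>') \<Rightarrow>
      q < q' \<and> \<epsilon>' \<le> \<epsilon> / 2 \<and> p q (y' - y) < \<epsilon> / 2 \<and>
      (\<exists>i\<in>I. \<forall>z. p q' (z - y') \<le> \<epsilon>' \<longrightarrow> w k i < v i z))" for k and s s' :: "'v \<times> nat \<times> real"
  have step: "\<exists>s'. 0 < snd (snd s') \<and> R k s s'" if pos: "0 < snd (snd s)" for k s
  proof -
    obtain y q \<epsilon> where s: "s = (y, q, \<epsilon>)" by (cases s)
    have e: "0 < \<epsilon> / 2" using pos s by simp
    then obtain x i where x: "p q x < \<epsilon> / 2" "i \<in> I" "w k i < v i x"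
      using contra by (meson not_le)
    note vi = v[OF x(2)]
    \<comment> \<open>The small vector \<open>x\<close> violates the bound near 0, but the violation
      is wanted near \<open>y\<close>. Since 2 x = (y + x) - (y - x), one of the two translates
      inherits it.\<close>
    have "2 * v i x \<le> v i (y + x) + v i (y - x)"
    proof -
      have "v i (sc 2 x) = 2 * v i x" using seminorm_onD(3)[OF vi, of x 2] by simp
      moreover have "sc 2 x = (y + x) + - (y - x)"
        using scale_left_distrib[of 1 1 x] by simp
      ultimately show ?thesis
        using seminorm_onD(2)[OF vi, of "y + x" "- (y - x)"] seminorm_uminus[OF vi, of "y - x"] by simp
    qed
    then have "w k i < v i (y + x) \<or> w k i < v i (y - x)" using x(3) by linarith
    then obtain y' where y': "y' = y + x \<or> y' = y - x" "w k i < v i y'" by blast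
    have y'y: "p q (y' - y) < \<epsilon> / 2" using y'(1) x(1) seminorm_uminus[OF seminorm, of x] by auto
    obtain q1 C where C: "\<And>x. v i x \<le> C * p q1 x" using vc[OF x(2)] by blast
    \<comment> \<open>\<open>q'\<close> is large enough to control \<open>v i\<close>, and the
      radius is chosen so that \<open>v i\<close> changes by at most half of the gap
      \<open>v i y' - w k i\<close>.\<close>
    define q' where "q' = max q1 (Suc q)"
    define \<epsilon>' where "\<epsilon>' = min (\<epsilon> / 2) ((v i y' - w k i) / (2 * (\<bar>C\<bar> + 1)))"
    have e': "0 < \<epsilon>'" using e y'(2) by (simp add: \<epsilon>'_def)
    have "w k i < v i z" if z: "p q' (z - y') \<le> \<epsilon>'" for z
    proof -
      have "v i (y' - z) \<le> C * p q1 (z - y')" using C[of "y' - z"] p_minus_commute[of q1 y' z] by simp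
      also have "\<dots> \<le> (\<bar>C\<bar> + 1) * p q1 (z - y')" using pD(1) by (intro mult_right_mono) auto
      also have "\<dots> \<le> (\<bar>C\<bar> + 1) * ((v i y' - w k i) / (2 * (\<bar>C\<bar> + 1)))"
        using p_mono[of q1 q' "z - y'"] z by (intro mult_left_mono) (auto simp: q'_def \<epsilon>'_def)
      also have "\<dots> = (v i y' - w k i) / 2" by (simp add: field_simps)
      finally have "v i (y' - z) \<le> (v i y' - w k i) / 2" .
      moreover have "v i y' \<le> v i (y' - z) + v i z" using seminorm_onD(2)[OF vi, of "y' - z" z] by simp
      ultimately show ?thesis using y'(2) by (simp add: field_simps)
    qed
    moreover have "q < q'" "\<epsilon>' \<le> \<epsilon> / 2"
      unfolding q'_def \<epsilon>'_def by (simp, rule min.cobounded1)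
    ultimately have "R k s (y', q', \<epsilon>')" unfolding R_def s using y'y x(2) by auto
    then show ?thesis using e' by auto
  qed
  have "\<exists>S. \<forall>n. 0 < snd (snd (S n)) \<and> R n (S n) (S (Suc n))"
  proof (rule dependent_nat_choice)
    show "\<exists>s::'v \<times> nat \<times> real. 0 < snd (snd s)" by (intro exI[of _ "(0, 0, 1)"]) simp
  qed (rule step)
  then obtain S where S: "\<And>n. 0 < snd (snd (S n))" "\<And>n. R n (S n) (S (Suc n))" by blast
  define y q \<epsilon> where "y n = fst (S n)" and "q n = fst (snd (S n))" and "\<epsilon> n = snd (snd (S n))" for n
  have SS: "S n = (y n, q n, \<epsilon> n)" for n by (simp add: y_def q_def \<epsilon>_def)
  have R': "q n < q (Suc n)" "\<epsilon> (Suc n) \<le> \<epsilon> n / 2" "p (q n) (y (Suc n) - y n) < \<epsilon> n / 2"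
    and R4: "\<exists>i\<in>I. \<forall>z. p (q (Suc n)) (z - y (Suc n)) \<le> \<epsilon> (Suc n) \<longrightarrow> w n i < v i z" for n
    using S(2)[of n] unfolding R_def SS by auto
  have qm: "strict_mono q" using R'(1) by (simp add: strict_mono_Suc_iff)
  have epos: "0 < \<epsilon> n" for n using S(1) by (simp add: \<epsilon>_def)
  \<comment> \<open>Telescoping: a step is shorter than \<open>\<epsilon> n / 2\<close>, and halving
    of the radii makes this at most \<open>\<epsilon> n - \<epsilon> (Suc n)\<close>.\<close>
  have near: "p (q n) (y (n + d) - y n) \<le> \<epsilon> n - \<epsilon> (n + d)" for n d
  proof (induction d)
    case 0
    then show ?case by simp
  next
    case (Suc d)
    have "p (q n) (y (Suc (n + d)) - y n) \<le> p (q n) (y (Suc (n + d)) - y (n + d)) + p (q n) (y (n + d) - y n)"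
      by (rule p_triangle)
    moreover have "p (q n) (y (Suc (n + d)) - y (n + d)) \<le> p (q (n + d)) (y (Suc (n + d)) - y (n + d))"
      using qm by (intro p_mono) (simp add: strict_mono_less_eq)
    ultimately show ?case using Suc R'(2,3)[of "n + d"] by simp
  qed
  have eps_small: "\<epsilon> n \<le> \<epsilon> 0 / 2 ^ n" for n
  proof (induction n)
    case (Suc n)
    then have "\<epsilon> n / 2 \<le> \<epsilon> 0 / 2 ^ Suc n" by (simp add: field_simps)
    then show ?case using R'(2)[of n] by linarith
  qed simp
  have near2: "p (q n) (y m - y n) \<le> \<epsilon> n" if "n \<le> m" for m n
    using near[of n "m - n"] that epos[of m] by simp
  have "\<exists>l. \<forall>q. (\<lambda>n. p q (y n - l)) \<longlonglongrightarrow> 0"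
  proof (rule Cauchy_converges)
    fix r :: nat and \<delta> :: real assume d: "0 < \<delta>"
    have "(\<lambda>n. \<epsilon> 0 / 2 ^ n) \<longlonglongrightarrow> 0"
      using tendsto_mult[OF tendsto_const[of "\<epsilon> 0"] LIMSEQ_realpow_zero[of "1/2::real"]] by (simp add: power_divide)
    then obtain N0 where N0: "\<And>n. n \<ge> N0 \<Longrightarrow> \<bar>\<epsilon> 0 / 2 ^ n\<bar> < \<delta> / 2"
      using d unfolding LIMSEQ_def by (metis dist_real_def diff_zero half_gt_zero)
    define N where "N = max N0 r"
    have eN: "\<epsilon> N < \<delta> / 2" using eps_small[of N] N0[of N] unfolding N_def by linarith
    have rq: "r \<le> q N" using strict_mono_imp_increasing[OF qm, of N] unfolding N_def by linarith
    have "p r (y m - y n) < \<delta>" if "m \<ge> N" "n \<ge> N" for m n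
    proof -
      have "p r (y m - y n) \<le> p (q N) (y m - y n)" by (rule p_mono[OF rq])
      also have "\<dots> \<le> p (q N) (y m - y N) + p (q N) (y N - y n)" by (rule p_triangle)
      also have "\<dots> \<le> \<epsilon> N + \<epsilon> N"
        using near2[OF that(1)] near2[OF that(2)] p_minus_commute[of "q N" "y N" "y n"] by simp
      finally show ?thesis using eN by simp
    qed
    then show "\<exists>N. \<forall>m\<ge>N. \<forall>n\<ge>N. p r (y m - y n) < \<delta>" by blast
  qed
  then obtain l where l: "\<And>q. (\<lambda>n. p q (y n - l)) \<longlonglongrightarrow> 0" by blast
  \<comment> \<open>The limit stays in every closed ball. Whatever \<open>k\<close> bounds all
    \<open>v i l\<close>, the ball of index \<open>Suc k\<close> yields an \<open>i\<close> that
    violates this bound.\<close>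
  have lim: "p (q n) (l - y n) \<le> \<epsilon> n" for n
  proof -
    have "(\<lambda>m. p (q n) (y m - l) + \<epsilon> n) \<longlonglongrightarrow> 0 + \<epsilon> n" by (intro tendsto_add l tendsto_const)
    moreover have "p (q n) (l - y n) \<le> p (q n) (y m - l) + \<epsilon> n" if "m \<ge> n" for m
      using p_triangle[of "q n" l "y n" "y m"] near2[OF that] p_minus_commute[of "q n" l "y m"] by linarith
    ultimately show ?thesis using LIMSEQ_le_const by fastforce
  qed
  obtain k where k: "\<And>i. i \<in> I \<Longrightarrow> v i l \<le> w k i" using pw[of l] by blast
  obtain i where "i \<in> I" "w k i < v i l" using R4[of k] lim[of "Suc k"] by blast
  then show False using k[of i] by simp
qed

text \<open>Homogeneous form of the factorization: rescaling \<open>x\<close> into the ball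
  \<open>p q x < \<epsilon>\<close> brings out the factor \<open>p q x\<close>.\<close>

lemma uniform_bound:
  fixes v :: "'i \<Rightarrow> 'v \<Rightarrow> real" and w :: "nat \<Rightarrow> 'i \<Rightarrow> real"
  assumes v: "\<And>i. i \<in> I \<Longrightarrow> seminorm_on sc UNIV (v i)"
    and vc: "\<And>i. i \<in> I \<Longrightarrow> \<exists>q C. \<forall>x. v i x \<le> C * p q x"
    and pw: "\<And>x. \<exists>k. \<forall>i\<in>I. v i x \<le> w k i"
  shows "\<exists>k q. \<exists>C>0. \<forall>x. \<forall>i\<in>I. v i x \<le> C * p q x * w k i"
proof -
  obtain k q \<epsilon> where e: "\<epsilon> > 0" "\<And>x i. p q x < \<epsilon> \<Longrightarrow> i \<in> I \<Longrightarrow> v i x \<le> w k i"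
    using factorization[where v=v and w=w and I=I] assms by blast
  have "v i x \<le> 2 / \<epsilon> * p q x * w k i" if i: "i \<in> I" for x i
  proof -
    have scaled: "t * v i x \<le> w k i" if "t \<ge> 0" "t * p q x < \<epsilon>" for t :: real
      using e(2)[of "sc (of_real t) x" i] i that pD(3)[of q "of_real t" x]
        seminorm_onD(3)[OF v[OF i], of x "of_real t"] by simp
    \<comment> \<open>On the kernel of \<open>p q\<close> all multiples of \<open>x\<close> lie in
      the ball, which forces \<open>v i x \<le> 0\<close>; elsewhere \<open>x\<close> is scaled to
      have \<open>p q\<close> equal to \<open>\<epsilon> / 2\<close>.\<close>
    show ?thesis
    proof (cases "p q x = 0")
      case True
      have "v i x \<le> 0"
      proof (rule ccontr)
        assume "\<not> v i x \<le> 0"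
        then have pos: "0 < v i x" by simp
        obtain t :: nat where "w k i < real t * v i x" using reals_Archimedean3[OF pos] by blast
        then show False using scaled[of "real t"] True e(1) by simp
      qed
      then show ?thesis using True by simp
    next
      case False
      then have pp: "0 < p q x" using pD(1)[of q x] by simp
      have "\<epsilon> / (2 * p q x) * v i x \<le> w k i" by (rule scaled) (use pp e(1) in auto)
      then show ?thesis using pp e(1) by (simp add: field_simps)
    qed
  qed
  then have "\<forall>x. \<forall>i\<in>I. v i x \<le> 2 / \<epsilon> * p q x * w k i" by blast
  moreover have "0 < 2 / \<epsilon>" using e(1) by simp
  ultimately show ?thesis by blast
qed

end

section \<open>The topology of \<open>L\<^sup>*(s)\<close>\<close>

lemma complete_seminorms_s: "complete_seminorms s_scale s_norm"
proof -
  interpret vector_space s_scale by (rule vector_space_s)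
  show ?thesis
  proof
    show "seminorm_on s_scale UNIV (s_norm q)" for q by (rule s_norm_seminorm)
    show "s_norm q \<xi> \<le> s_norm (Suc q) \<xi>" for q \<xi> by (rule s_norm_mono) simp
    fix \<sigma> :: "nat \<Rightarrow> s_space"
    assume C: "\<And>q \<epsilon>. 0 < \<epsilon> \<Longrightarrow> \<exists>N::nat. \<forall>m\<ge>N. \<forall>n\<ge>N. s_norm q (\<sigma> m - \<sigma> n) < \<epsilon>"
    have "convergent (\<lambda>n. seq (\<sigma> n) j)" for j
      unfolding Cauchy_convergent_iff[symmetric]
    proof (rule CauchyI)
      fix e :: real assume "0 < e"
      then obtain N where N: "\<And>m n. m \<ge> N \<Longrightarrow> n \<ge> N \<Longrightarrow> s_norm 0 (\<sigma> m - \<sigma> n) < e" using C by blast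
      have "norm (seq (\<sigma> m) j - seq (\<sigma> n) j) < e" if "m \<ge> N" "n \<ge> N" for m n
        using s_norm_coord[of "\<sigma> m - \<sigma> n" j 0] N[OF that] by (simp add: seq_diff)
      then show "\<exists>M. \<forall>m\<ge>M. \<forall>n\<ge>M. norm (seq (\<sigma> m) j - seq (\<sigma> n) j) < e" by blast
    qed
    then obtain l where l: "\<And>j. (\<lambda>n. seq (\<sigma> n) j) \<longlonglongrightarrow> l j"
      unfolding convergent_def by metis
    have key: "\<exists>N. \<forall>n\<ge>N. summable (\<lambda>j. (cmod ((seq (\<sigma> n) - l) j))\<^sup>2 * s_weight q j) \<and>
        weighted_norm (s_weight q) (seq (\<sigma> n) - l) \<le> \<epsilon>" if e: "0 < \<epsilon>" for q \<epsilon>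
    proof -
      obtain N where N: "\<And>m n. m \<ge> N \<Longrightarrow> n \<ge> N \<Longrightarrow> s_norm q (\<sigma> m - \<sigma> n) < \<epsilon>" using C[OF e] by blast
      \<comment> \<open>Only coordinatewise convergence is available, so the Cauchy bound is carried
        to \<open>l\<close> on each finite section, letting \<open>m\<close> tend to infinity with
        \<open>n\<close> fixed.\<close>
      have "(\<Sum>j<J. (cmod ((seq (\<sigma> n) - l) j))\<^sup>2 * s_weight q j) \<le> \<epsilon>\<^sup>2" if n: "n \<ge> N" for n J
      proof (rule LIMSEQ_le_const2)
        show "(\<lambda>m. \<Sum>j<J. (cmod (seq (\<sigma> n) j - seq (\<sigma> m) j))\<^sup>2 * s_weight q j)
            \<longlonglongrightarrow> (\<Sum>j<J. (cmod ((seq (\<sigma> n) - l) j))\<^sup>2 * s_weight q j)"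
          unfolding fun_diff_def by (intro tendsto_intros l)
        have "(\<Sum>j<J. (cmod (seq (\<sigma> n) j - seq (\<sigma> m) j))\<^sup>2 * s_weight q j) \<le> \<epsilon>\<^sup>2" if m: "m \<ge> N" for m
        proof -
          have "(\<Sum>j<J. (cmod (seq (\<sigma> n - \<sigma> m) j))\<^sup>2 * s_weight q j) \<le> (s_norm q (\<sigma> n - \<sigma> m))\<^sup>2"
            unfolding s_norm_eq by (rule weighted_partial_sum_le[OF _ s_summable]) simp
          also have "\<dots> \<le> \<epsilon>\<^sup>2" using N[OF n m] s_norm_nonneg by (intro power_mono) auto
          finally show ?thesis by (simp only: seq_diff minus_apply)
        qed
        then show "\<exists>N. \<forall>m\<ge>N. (\<Sum>j<J. (cmod (seq (\<sigma> n) j - seq (\<sigma> m) j))\<^sup>2 * s_weight q j) \<le> \<epsilon>\<^sup>2" by blast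
      qed
      then have "summable (\<lambda>j. (cmod ((seq (\<sigma> n) - l) j))\<^sup>2 * s_weight q j) \<and>
        weighted_norm (s_weight q) (seq (\<sigma> n) - l) \<le> \<epsilon>" if "n \<ge> N" for n
        using weighted_norm_boundI[of "s_weight q" \<epsilon> "seq (\<sigma> n) - l"] e that by simp
      then show ?thesis by blast
    qed
    have "l \<in> rapidly_decreasing"
      unfolding rapidly_decreasing_def
    proof (intro CollectI allI)
      fix q
      obtain n where n: "summable (\<lambda>j. (cmod ((seq (\<sigma> n) - l) j))\<^sup>2 * s_weight q j)"
        using key[of 1 q] by auto
      \<comment> \<open>\<open>l\<close> is recovered as the difference of
        \<open>seq (\<sigma> n)\<close> and \<open>seq (\<sigma> n) - l\<close>, both summable
        against the weight.\<close>
      have "summable (\<lambda>j. (cmod (seq (\<sigma> n) j + (- (seq (\<sigma> n) - l)) j))\<^sup>2 * s_weight q j)"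
        by (rule summable_weighted_add[OF s_summable]) (use n in \<open>simp_all add: norm_minus_commute\<close>)
      then show "summable (\<lambda>j. (cmod (l j))\<^sup>2 * real (Suc j) ^ (2 * q))" by simp
    qed
    then have L: "seq (Abs_s l) = l" by (rule Abs_s_inverse)
    have "(\<lambda>n. s_norm q (\<sigma> n - Abs_s l)) \<longlonglongrightarrow> 0" for q
    proof (rule LIMSEQ_I)
      fix r :: real assume "0 < r"
      then obtain N where "\<And>n. n \<ge> N \<Longrightarrow> weighted_norm (s_weight q) (seq (\<sigma> n) - l) \<le> r / 2"
        using key[of "r / 2" q] by auto
      then have N: "\<And>n. n \<ge> N \<Longrightarrow> s_norm q (\<sigma> n - Abs_s l) \<le> r / 2"
        unfolding s_norm_eq seq_diff L .
      have "norm (s_norm q (\<sigma> n - Abs_s l) - 0) < r" if "n \<ge> N" for n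
        using N[OF that] \<open>0 < r\<close> s_norm_nonneg[of q "\<sigma> n - Abs_s l"] by simp
      then show "\<exists>N. \<forall>n\<ge>N. norm (s_norm q (\<sigma> n - Abs_s l) - 0) < r" by blast
    qed
    then show "\<exists>l. \<forall>q. (\<lambda>n. s_norm q (\<sigma> n - l)) \<longlonglongrightarrow> 0" by blast
  qed
qed

interpretation s: complete_seminorms s_scale s_norm
  by (rule complete_seminorms_s)

text \<open>Carries the weight of \<open>s_norm N\<close> into the vector, so that this norm can be
  tested by pairing with the unit ball of \<open>s_norm 0\<close>. Being symmetric, it can also be
  moved to the test vector.\<close>

definition diag :: "nat \<Rightarrow> s_space \<Rightarrow> s_space"
  where "diag N \<xi> = Abs_s (\<lambda>j. of_nat (Suc j) ^ N * seq \<xi> j)"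

lemma seq_diag: "seq (diag N \<xi>) = (\<lambda>j. of_nat (Suc j) ^ N * seq \<xi> j)"
  unfolding diag_def
proof (rule Abs_s_inverse)
  have "summable (\<lambda>j. (cmod (of_nat (Suc j) ^ N * seq \<xi> j))\<^sup>2 * real (Suc j) ^ (2 * q))" for q
    using s_summable[of \<xi> "N + q"]
    by (simp only: norm_mult norm_power norm_of_nat power_mult_distrib power_mult[symmetric])
      (simp add: power_add mult_ac distrib_left)
  then show "(\<lambda>j. of_nat (Suc j) ^ N * seq \<xi> j) \<in> rapidly_decreasing"
    by (simp only: rapidly_decreasing_def mem_Collect_eq simp_thms)
qed

lemma s_norm_diag: "s_norm 0 (diag N \<xi>) = s_norm N \<xi>"
  unfolding s_norm_def seq_diag
  by (simp only: norm_mult norm_power norm_of_nat power_mult_distrib power_mult[symmetric])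
    (simp add: mult_ac)

lemma s_inner_diag: "s_inner (diag N \<xi>) \<eta> = s_inner \<xi> (diag N \<eta>)"
  unfolding s_inner_def ell2_inner_def seq_diag by (simp add: mult_ac)

lemma diag_linear: "diag N (\<xi> + \<eta>) = diag N \<xi> + diag N \<eta>" "diag N (s_scale c \<xi>) = s_scale c (diag N \<xi>)"
  by (simp_all only: seq_inject[symmetric] seq_diag seq_add seq_s_scale)
    (simp_all add: fun_eq_iff seq_scale_def algebra_simps)

lemma s_inner_op: "s_inner (op x \<xi>) \<eta> = s_inner \<xi> (op (Lstar_star x) \<eta>)"
  by (simp add: op_star s_inner_adj_s op)

text \<open>The Hellinger--Toeplitz theorem for \<open>L\<^sup>*(s)\<close>.\<close>

lemma op_continuous: "\<exists>k. \<exists>C>0. \<forall>\<xi>. s_norm N (op x \<xi>) \<le> C * s_norm k \<xi>"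
proof -
  let ?I = "{\<eta>. s_norm 0 \<eta> \<le> 1}"
  let ?v = "\<lambda>\<eta> \<xi>. cmod (s_inner (diag N (op x \<xi>)) \<eta>)"
  \<comment> \<open>The adjoint makes the functional given by each fixed \<open>\<eta>\<close>
    continuous in \<open>\<xi>\<close>, while for fixed \<open>\<xi>\<close> the values over the
    unit ball are bounded by \<open>s_norm N (op x \<xi>)\<close>. These are the hypotheses of
    \<open>uniform_bound\<close>.\<close>
  have eq: "s_inner (diag N (op x \<xi>)) \<eta> = s_inner \<xi> (op (Lstar_star x) (diag N \<eta>))" for \<xi> \<eta>
    by (simp add: s_inner_diag s_inner_op)
  have "\<exists>k q. \<exists>C>0. \<forall>\<xi>. \<forall>\<eta>\<in>?I. ?v \<eta> \<xi> \<le> C * s_norm q \<xi> * real k"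
  proof (rule s.uniform_bound)
    fix \<eta> assume "\<eta> \<in> ?I"
    show "seminorm_on s_scale UNIV (?v \<eta>)"
      unfolding seminorm_on_def
      by (auto simp: op_linear diag_linear s_inner_add_left s_inner_scale_left norm_mult intro: norm_triangle_ineq)
    show "\<exists>q C. \<forall>\<xi>. ?v \<eta> \<xi> \<le> C * s_norm q \<xi>"
      unfolding eq using s_inner_bound
      by (intro exI[of _ 0] exI[of _ "s_norm 0 (op (Lstar_star x) (diag N \<eta>))"]) (simp add: mult.commute)
  next
    fix \<xi>
    obtain k :: nat where k: "s_norm N (op x \<xi>) \<le> real k" using real_arch_simple by blast
    have "?v \<eta> \<xi> \<le> real k" if "\<eta> \<in> ?I" for \<eta>
    proof -
      have "?v \<eta> \<xi> \<le> s_norm N (op x \<xi>) * s_norm 0 \<eta>" using s_inner_bound[of "diag N (op x \<xi>)" \<eta>] by (simp add: s_norm_diag)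
      also have "\<dots> \<le> s_norm N (op x \<xi>) * 1" using that s_norm_nonneg by (intro mult_left_mono) auto
      finally show ?thesis using k by simp
    qed
    then show "\<exists>k. \<forall>\<eta>\<in>?I. ?v \<eta> \<xi> \<le> real k" by blast
  qed
  then obtain k q C where C: "C > 0" "\<And>\<xi> \<eta>. s_norm 0 \<eta> \<le> 1 \<Longrightarrow> ?v \<eta> \<xi> \<le> C * s_norm q \<xi> * real k" by blast
  have "s_norm N (op x \<xi>) \<le> (C * real k + 1) * s_norm q \<xi>" for \<xi>
  proof -
    let ?z = "diag N (op x \<xi>)"
    let ?n = "s_norm 0 ?z"
    have "?n \<le> C * s_norm q \<xi> * real k"
    proof (cases "?n = 0")
      case True
      then show ?thesis using C(1) s_norm_nonneg[of q \<xi>] by simp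
    next
      case False
      then have n: "0 < ?n" using s_norm_nonneg[of 0 ?z] by simp
      let ?c = "complex_of_real (1 / ?n)"
      have c: "cmod ?c = 1 / ?n" using n by (simp only: norm_of_real) simp
      have "s_norm 0 (s_scale ?c ?z) = 1" using seminorm_onD(3)[OF s_norm_seminorm, of ?z 0 ?c] c n by simp
      then have "?v (s_scale ?c ?z) \<xi> \<le> C * s_norm q \<xi> * real k" using C(2) by simp
      \<comment> \<open>Testing \<open>?z\<close> against its own normalization returns its
        norm.\<close>
      moreover have "?v (s_scale ?c ?z) \<xi> = ?n"
      proof -
        have "?v (s_scale ?c ?z) \<xi> = 1 / ?n * ?n\<^sup>2"
          using c by (simp only: s_inner_scale_right norm_mult complex_mod_cnj s_inner_self norm_of_real) simp
        then show ?thesis using n by (simp add: power2_eq_square)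
      qed
      ultimately show ?thesis by simp
    qed
    then show ?thesis using s_norm_nonneg[of q \<xi>] by (simp add: s_norm_diag algebra_simps)
  qed
  moreover have "0 < C * real k + 1" using C(1) by (simp add: add_nonneg_pos)
  ultimately show ?thesis by blast
qed

section \<open>Seminorms of the topology \<open>tau_star\<close>\<close>

lemma op_bdd_above:
  assumes "s_bounded B"
  shows "bdd_above ((\<lambda>\<xi>. s_norm N (op x \<xi>)) ` B)"
proof -
  obtain k C where C: "C > 0" "\<And>\<xi>. s_norm N (op x \<xi>) \<le> C * s_norm k \<xi>" using op_continuous by blast
  obtain M where M: "\<And>\<xi>. \<xi> \<in> B \<Longrightarrow> s_norm k \<xi> \<le> M" using assms unfolding s_bounded_def bdd_above_def by (meson image_eqI)
  have "s_norm N (op x \<xi>) \<le> C * M" if "\<xi> \<in> B" for \<xi>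
    using C M[OF that] by (meson mult_left_mono order_trans less_imp_le)
  then show ?thesis by (rule bdd_aboveI2)
qed

lemma Lstar_seminorm_upper:
  assumes "s_bounded B" "\<xi> \<in> B"
  shows "s_norm N (op x \<xi>) \<le> Lstar_seminorm N B x"
    "s_norm N (op (Lstar_star x) \<xi>) \<le> Lstar_seminorm N B x"
  using cSUP_upper[OF assms(2) op_bdd_above[OF assms(1)], of N x]
    cSUP_upper[OF assms(2) op_bdd_above[OF assms(1)], of N "Lstar_star x"]
  unfolding Lstar_seminorm_def by linarith+

lemma Lstar_seminorm_least:
  assumes "B \<noteq> {}" "\<And>\<xi>. \<xi> \<in> B \<Longrightarrow> s_norm N (op x \<xi>) \<le> M"
    "\<And>\<xi>. \<xi> \<in> B \<Longrightarrow> s_norm N (op (Lstar_star x) \<xi>) \<le> M"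
  shows "Lstar_seminorm N B x \<le> M"
  unfolding Lstar_seminorm_def by (intro max.boundedI cSUP_least assms)

lemma Lstar_seminorm_nonneg:
  assumes "s_bounded B" "B \<noteq> {}"
  shows "0 \<le> Lstar_seminorm N B x"
  using Lstar_seminorm_upper(1)[OF assms(1), of _ N x] assms(2) s_norm_nonneg[of N] by (meson all_not_in_conv order_trans)

interpretation Lstar: star_algebra Lstar_scale Lstar_star
  by (rule star_algebra_Lstar)

lemma Lstar_seminorm_seminorm:
  assumes B: "s_bounded B" "B \<noteq> {}"
  shows "seminorm_on Lstar_scale UNIV (Lstar_seminorm N B)"
proof -
  have le: "Lstar_seminorm N B (Lstar_scale c x) \<le> cmod c * Lstar_seminorm N B x" for c x
    using Lstar_seminorm_upper[OF B(1), of _ N x]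
    by (intro Lstar_seminorm_least B)
      (auto simp: Lstar.star_scale op_scale seminorm_onD(3)[OF s_norm_seminorm] intro: mult_left_mono)
  have eq: "Lstar_seminorm N B (Lstar_scale c x) = cmod c * Lstar_seminorm N B x" for c x
  proof (cases "c = 0")
    case True
    then show ?thesis using le[of c x] Lstar_seminorm_nonneg[OF B, of N "Lstar_scale c x"] by simp
  next
    case False
    have "Lstar_seminorm N B x \<le> cmod (inverse c) * Lstar_seminorm N B (Lstar_scale c x)"
      using le[of "inverse c" "Lstar_scale c x"] False by simp
    then have "cmod c * Lstar_seminorm N B x \<le> cmod c * (cmod (inverse c) * Lstar_seminorm N B (Lstar_scale c x))"
      by (intro mult_left_mono) auto
    also have "\<dots> = Lstar_seminorm N B (Lstar_scale c x)"
      using False by (simp add: norm_inverse)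
    finally have "cmod c * Lstar_seminorm N B x \<le> Lstar_seminorm N B (Lstar_scale c x)" .
    then show ?thesis using le[of c x] by simp
  qed
  have "Lstar_seminorm N B (x + y) \<le> Lstar_seminorm N B x + Lstar_seminorm N B y" for x y
  proof (rule Lstar_seminorm_least[OF B(2)])
    fix \<xi> assume xi: "\<xi> \<in> B"
    show "s_norm N (op (x + y) \<xi>) \<le> Lstar_seminorm N B x + Lstar_seminorm N B y"
      using seminorm_onD(2)[OF s_norm_seminorm, of "op x \<xi>" "op y \<xi>" N]
        Lstar_seminorm_upper(1)[OF B(1) xi, of N x] Lstar_seminorm_upper(1)[OF B(1) xi, of N y]
      by (simp add: op_add)
    show "s_norm N (op (Lstar_star (x + y)) \<xi>) \<le> Lstar_seminorm N B x + Lstar_seminorm N B y"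
      using seminorm_onD(2)[OF s_norm_seminorm, of "op (Lstar_star x) \<xi>" "op (Lstar_star y) \<xi>" N]
        Lstar_seminorm_upper(2)[OF B(1) xi, of N x] Lstar_seminorm_upper(2)[OF B(1) xi, of N y]
      by (simp add: op_add Lstar.star_add)
  qed
  then show ?thesis using eq Lstar_seminorm_nonneg[OF B] by (simp add: seminorm_on_def)
qed

lemma Lstar_seminorm_mono:
  assumes "N \<le> N'" "B \<subseteq> B'" "B \<noteq> {}" "s_bounded B'"
  shows "Lstar_seminorm N B x \<le> Lstar_seminorm N' B' x"
  using assms by (intro Lstar_seminorm_least) (auto intro: order_trans[OF s_norm_mono Lstar_seminorm_upper(1)]
      order_trans[OF s_norm_mono Lstar_seminorm_upper(2)])

lemma s_bounded_Un: "s_bounded B \<Longrightarrow> s_bounded B' \<Longrightarrow> s_bounded (B \<union> B')"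
  by (simp add: s_bounded_def image_Un)

lemma s_bounded_singleton: "s_bounded {\<xi>}"
  by (simp add: s_bounded_def)

text \<open>The family is directed: the larger \<open>N\<close> over the union of the two bounded
  sets majorizes two given members.\<close>

lemma tau_star_generated:
  "seminorm_generated UNIV {Lstar_seminorm N B | N B. s_bounded B \<and> B \<noteq> {}} tau_star"
  unfolding tau_star_def
proof (rule seminorm_generated_seminorm_topology)
  show "vector_space Lstar_scale" by (rule Lstar.vector_space_axioms)
  show "Lstar.subspace UNIV" by (rule Lstar.subspace_UNIV)
  show "{Lstar_seminorm N B | N B. s_bounded B \<and> B \<noteq> {}} \<noteq> {}"
    using s_bounded_singleton by blast
  show "seminorm_on Lstar_scale UNIV p" if "p \<in> {Lstar_seminorm N B | N B. s_bounded B \<and> B \<noteq> {}}" for p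
    using that Lstar_seminorm_seminorm by blast
  fix p q assume "p \<in> {Lstar_seminorm N B | N B. s_bounded B \<and> B \<noteq> {}}"
    "q \<in> {Lstar_seminorm N B | N B. s_bounded B \<and> B \<noteq> {}}"
  then obtain N B N' B' where p: "p = Lstar_seminorm N B" "s_bounded B" "B \<noteq> {}"
    and q: "q = Lstar_seminorm N' B'" "s_bounded B'" "B' \<noteq> {}" by blast
  show "\<exists>r\<in>{Lstar_seminorm N B | N B. s_bounded B \<and> B \<noteq> {}}. \<forall>x\<in>UNIV. p x \<le> r x \<and> q x \<le> r x"
  proof (intro bexI ballI conjI)
    show "p x \<le> Lstar_seminorm (max N N') (B \<union> B') x" "q x \<le> Lstar_seminorm (max N N') (B \<union> B') x" for x
      using p q by (auto intro!: Lstar_seminorm_mono s_bounded_Un)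
    show "Lstar_seminorm (max N N') (B \<union> B') \<in> {Lstar_seminorm N B | N B. s_bounded B \<and> B \<noteq> {}}"
      using p q s_bounded_Un by blast
  qed
qed

section \<open>Scalar products\<close>

locale scalar_product_space = complex_vector_space sc
  for sc :: "complex \<Rightarrow> 'v::ab_group_add \<Rightarrow> 'v" +
  fixes ip :: "'v \<Rightarrow> 'v \<Rightarrow> complex"
  assumes scalar_product: "scalar_product sc ip"
begin

lemma ip_add_left: "ip (x + y) z = ip x z + ip y z"
  and ip_scale_left: "ip (sc c x) y = c * ip x y"
  and ip_cnj: "ip y x = cnj (ip x y)"
  and ip_pos: "x \<noteq> 0 \<Longrightarrow> 0 < Re (ip x x)"
  using scalar_product unfolding scalar_product_def by blast+

lemma ip_add_right: "ip x (y + z) = ip x y + ip x z"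
  using arg_cong[OF ip_add_left[of y z x], of cnj] by (simp add: ip_cnj[symmetric])

lemma ip_scale_right: "ip x (sc c y) = cnj c * ip x y"
  using arg_cong[OF ip_scale_left[of c y x], of cnj] by (simp add: ip_cnj[symmetric])

lemma ip_zero [simp]: "ip 0 y = 0" "ip x 0 = 0"
  using ip_add_left[of 0 0 y] ip_add_right[of x 0 0] by simp_all

lemma ip_diff_left: "ip (x - y) z = ip x z - ip y z"
  using ip_add_left[of "x - y" y z] by (simp add: algebra_simps)

lemma ip_diff_right: "ip x (y - z) = ip x y - ip x z"
  using ip_add_right[of x "y - z" z] by (simp add: algebra_simps)

lemma ip_sum_right: "ip x (sum f A) = (\<Sum>a\<in>A. ip x (f a))"
proof (cases "finite A")
  case True
  then show ?thesis by induction (simp_all add: ip_add_right)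
qed simp

lemma ip_self: "ip x x = of_real (Re (ip x x))"
  using ip_cnj[of x x] by (metis complex_cnj_cancel_iff Reals_cnj_iff of_real_Re)

lemma ip_self_nonneg: "0 \<le> Re (ip x x)"
  using ip_pos[of x] by (cases "x = 0") auto

lemma hilbert_norm_sq: "(hilbert_norm ip x)\<^sup>2 = Re (ip x x)"
  by (simp add: hilbert_norm_def ip_self_nonneg)

lemma hilbert_norm_nonneg: "0 \<le> hilbert_norm ip x"
  by (simp add: hilbert_norm_def ip_self_nonneg)

lemma hilbert_norm_eq_zero: "hilbert_norm ip x = 0 \<Longrightarrow> x = 0"
  using ip_pos[of x] by (auto simp: hilbert_norm_def)

lemma Cauchy_Schwarz: "cmod (ip x y) \<le> hilbert_norm ip x * hilbert_norm ip y"
proof (cases "y = 0")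
  case True
  then show ?thesis by (simp add: hilbert_norm_def)
next
  case False
  define b where "b = Re (ip y y)"
  have b: "0 < b" "ip y y = of_real b" unfolding b_def by (rule ip_pos[OF False], rule ip_self)
  define a where "a = Re (ip x x)"
  have a: "ip x x = of_real a" unfolding a_def by (rule ip_self)
  \<comment> \<open>\<open>sc c y\<close> is the orthogonal projection of \<open>x\<close> onto the
    line through \<open>y\<close>.\<close>
  define c where "c = ip x y / of_real b"
  have cc: "ip x y = c * of_real b" using b by (simp add: c_def)
  have "ip (x - sc c y) (x - sc c y) = ip x x - cnj c * ip x y - c * cnj (ip x y) + c * cnj c * ip y y"
    using ip_cnj[of x y] by (simp add: ip_diff_left ip_diff_right ip_scale_left ip_scale_right algebra_simps)
  also have "\<dots> = ip x x - of_real b * (c * cnj c)"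
    unfolding cc b(2) by (simp add: algebra_simps)
  also have "\<dots> = of_real (a - b * (cmod c)\<^sup>2)"
    unfolding a by (simp add: complex_norm_square[symmetric])
  finally have "0 \<le> a - b * (cmod c)\<^sup>2"
    using ip_self_nonneg[of "x - sc c y"] by simp
  then have "b * (b * (cmod c)\<^sup>2) \<le> b * a" using b(1) by (intro mult_left_mono) auto
  moreover have "(cmod (ip x y))\<^sup>2 = b * (b * (cmod c)\<^sup>2)"
    using b(1) by (simp add: cc norm_mult power_mult_distrib) (simp add: power2_eq_square mult_ac)
  ultimately have "(cmod (ip x y))\<^sup>2 \<le> (hilbert_norm ip x * hilbert_norm ip y)\<^sup>2"
    by (simp add: power_mult_distrib hilbert_norm_sq a_def b_def mult.commute)
  then show ?thesis by (rule power2_le_imp_le) (simp add: hilbert_norm_nonneg)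
qed

lemma hilbert_norm_seminorm: "seminorm_on sc UNIV (hilbert_norm ip)"
proof -
  have "hilbert_norm ip (x + y) \<le> hilbert_norm ip x + hilbert_norm ip y" for x y
  proof (rule power2_le_imp_le)
    have "Re (ip (x + y) (x + y)) = Re (ip x x) + Re (ip y y) + 2 * Re (ip x y)"
      using ip_cnj[of x y] by (simp add: ip_add_left ip_add_right)
    also have "\<dots> \<le> Re (ip x x) + Re (ip y y) + 2 * (hilbert_norm ip x * hilbert_norm ip y)"
      using Cauchy_Schwarz[of x y] complex_Re_le_cmod[of "ip x y"] by simp
    finally show "(hilbert_norm ip (x + y))\<^sup>2 \<le> (hilbert_norm ip x + hilbert_norm ip y)\<^sup>2"
      by (simp add: hilbert_norm_sq power2_sum)
  qed (simp add: hilbert_norm_nonneg)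
  moreover have "hilbert_norm ip (sc c x) = cmod c * hilbert_norm ip x" for c x
  proof -
    have "ip (sc c x) (sc c x) = of_real ((cmod c)\<^sup>2 * Re (ip x x))"
      unfolding ip_scale_left ip_scale_right of_real_mult complex_norm_square ip_self[symmetric] by simp
    then show ?thesis by (simp add: hilbert_norm_def real_sqrt_mult)
  qed
  ultimately show ?thesis by (simp add: seminorm_on_def hilbert_norm_nonneg)
qed

end

section \<open>Frechet spaces with a fundamental system of seminorms\<close>

lemma seminorm_ball_open:
  assumes vs: "vector_space sc" and X: "module.subspace sc X"
    and T: "seminorm_generated X P T" and p: "p \<in> P" "seminorm_on sc X p" and a: "a \<in> X"
  shows "openin T {y \<in> X. p (y - a) < \<epsilon>}"
proof (rule seminorm_generated_openI[OF T])
  interpret complex_vector_space sc using vs by (simp add: complex_vector_space_def)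
  fix x assume x: "x \<in> {y \<in> X. p (y - a) < \<epsilon>}"
  have "p (y - a) < \<epsilon>" if "y \<in> X" "p (y - x) < \<epsilon> - p (x - a)" for y
    using seminorm_diff_triangle[OF X p(2) that(1), of x a] x a that by auto
  then show "\<exists>p'\<in>P. \<exists>\<delta>>0. \<forall>y\<in>X. p' (y - x) < \<delta> \<longrightarrow> y \<in> {y \<in> X. p (y - a) < \<epsilon>}"
    using x p(1) by (intro bexI[of _ p] exI[of _ "\<epsilon> - p (x - a)"]) auto
qed auto

text \<open>\<open>F\<close> may be a proper subset of \<open>Y\<close>: in one use it is the image
  of an algebra inside L*(s), in the other the whole power series space.\<close>

lemma seminorm_generated_pullback:
  fixes \<phi> :: "'v::ab_group_add \<Rightarrow> 'w::ab_group_add"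
  assumes vs: "vector_space sc" and Y: "module.subspace sc Y"
    and S: "seminorm_generated Y Q S" and Q: "\<And>q. q \<in> Q \<Longrightarrow> seminorm_on sc Y q"
    and F: "F \<subseteq> Y" and T: "topspace T = UNIV"
    and h: "homeomorphic_map T (subtopology S F) \<phi>"
    and \<phi>: "\<And>x y. \<phi> (x - y) = \<phi> x - \<phi> y"
  shows "seminorm_generated UNIV ((\<lambda>q. q \<circ> \<phi>) ` Q) T"
  unfolding seminorm_generated_def
proof (intro conjI allI iffI)
  interpret complex_vector_space sc using vs by (simp add: complex_vector_space_def)
  have Q0: "Q \<noteq> {}" using S unfolding seminorm_generated_def by (rule conjunct1)
  then show "(\<lambda>q. q \<circ> \<phi>) ` Q \<noteq> {}" by simp
  have im: "range \<phi> = F"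
    using homeomorphic_imp_surjective_map[OF h] T F seminorm_generated_topspace[OF S] by auto
  have inj: "inj \<phi>" using homeomorphic_imp_injective_map[OF h] T by simp
  have cont: "continuous_map T S \<phi>"
    using homeomorphic_imp_continuous_map[OF h] by (simp add: continuous_map_in_subtopology)
  fix U
  {
    assume U: "openin T U"
    have "openin (subtopology S F) (\<phi> ` U)"
      using homeomorphic_imp_open_map[OF h] U by (simp add: open_map_def)
    then obtain V where V: "openin S V" "\<phi> ` U = V \<inter> F" by (auto simp: openin_subtopology)
    have "\<exists>p\<in>(\<lambda>q. q \<circ> \<phi>) ` Q. \<exists>\<epsilon>>0. {y \<in> UNIV. p (y - x) < \<epsilon>} \<subseteq> U" if x: "x \<in> U" for x
    proof -
      have "\<phi> x \<in> V" using V(2) x by auto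
      from seminorm_generated_openD[OF S V(1) this] obtain q \<epsilon>
        where q: "q \<in> Q" "\<epsilon> > 0" "\<And>y. y \<in> Y \<Longrightarrow> q (y - \<phi> x) < \<epsilon> \<Longrightarrow> y \<in> V" by blast
      have "y \<in> U" if "q (\<phi> (y - x)) < \<epsilon>" for y
      proof -
        have "\<phi> y \<in> F" using im by auto
        moreover have "\<phi> y \<in> V" using q(3)[of "\<phi> y"] that F \<open>\<phi> y \<in> F\<close> by (auto simp: \<phi>)
        ultimately have "\<phi> y \<in> \<phi> ` U" using V(2) by auto
        then show ?thesis using inj by (auto dest: injD)
      qed
      then have "{y \<in> UNIV. (q \<circ> \<phi>) (y - x) < \<epsilon>} \<subseteq> U" by auto
      then show ?thesis using q(1,2) by blast
    qed
    then show "\<forall>x\<in>U. \<exists>p\<in>(\<lambda>q. q \<circ> \<phi>) ` Q. \<exists>\<epsilon>>0. {y \<in> UNIV. p (y - x) < \<epsilon>} \<subseteq> U" by (rule ballI)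
  }
  {
    assume U: "U \<subseteq> UNIV \<and> (\<forall>x\<in>U. \<exists>p\<in>(\<lambda>q. q \<circ> \<phi>) ` Q. \<exists>\<epsilon>>0. {y \<in> UNIV. p (y - x) < \<epsilon>} \<subseteq> U)"
    show "openin T U"
      unfolding openin_subopen[of T U]
    proof
      fix x assume "x \<in> U"
      then have "\<exists>p\<in>(\<lambda>q. q \<circ> \<phi>) ` Q. \<exists>\<epsilon>>0. {y \<in> UNIV. p (y - x) < \<epsilon>} \<subseteq> U" using U by (simp only: simp_thms)
      then obtain q \<epsilon> where q: "q \<in> Q" "\<epsilon> > 0" "{y. q (\<phi> (y - x)) < \<epsilon>} \<subseteq> U" by auto
      have Yx: "\<phi> y \<in> Y" for y using im F by auto
      have "openin T {y \<in> topspace T. \<phi> y \<in> {z \<in> Y. q (z - \<phi> x) < \<epsilon>}}"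
        by (rule openin_continuous_map_preimage[OF cont seminorm_ball_open[OF vs Y S q(1) Q[OF q(1)] Yx]])
      moreover have "{y \<in> topspace T. \<phi> y \<in> {z \<in> Y. q (z - \<phi> x) < \<epsilon>}} = {y. q (\<phi> (y - x)) < \<epsilon>}"
        using T Yx by (auto simp: \<phi>)
      moreover have "x \<in> {y. q (\<phi> (y - x)) < \<epsilon>}"
        using seminorm_zero[OF Y Q[OF q(1)]] q(2) by (simp add: \<phi>)
      ultimately show "\<exists>V. openin T V \<and> x \<in> V \<and> V \<subseteq> U" using q(3) by auto
    qed
  }
qed auto

lemma generated_imp_fundamental:
  assumes vs: "vector_space sc" and T: "seminorm_generated UNIV (range p) T"
    and p: "\<And>q. seminorm_on sc UNIV (p q)" "\<And>q x. p q x \<le> p (Suc q) x"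
  shows "fundamental_seminorms sc T p"
  unfolding fundamental_seminorms_def
proof (intro conjI allI impI ballI)
  interpret complex_vector_space sc using vs by (simp add: complex_vector_space_def)
  show "continuous_seminorm sc T (p q)" for q
    using seminorm_generated_continuous_seminorm[OF vs subspace_UNIV T p(1)[of q] rangeI p(1)[of q], of 1] by simp
  show "p q x \<le> p (Suc q) x" for q x by (rule p)
  fix U assume "openin T U \<and> 0 \<in> U"
  then show "\<exists>q. \<exists>\<epsilon>>0. {x \<in> topspace T. p q x < \<epsilon>} \<subseteq> U"
    using seminorm_generated_openD[OF T, of U 0] by auto
qed

lemma (in frechet_space) complete_seminorms:
  assumes T: "seminorm_generated UNIV (range p) T"
    and p: "\<And>q. seminorm_on sc UNIV (p q)" "\<And>q x. p q x \<le> p (Suc q) x"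
  shows "complete_seminorms sc p"
proof
  show "seminorm_on sc UNIV (p q)" "p q x \<le> p (Suc q) x" for q x by (rule p)+
  fix \<sigma> :: "nat \<Rightarrow> _"
  assume C: "\<And>q \<epsilon>. 0 < \<epsilon> \<Longrightarrow> \<exists>N. \<forall>m\<ge>N. \<forall>n\<ge>N. p q (\<sigma> m - \<sigma> n) < \<epsilon>"
  have "\<exists>l. limitin T \<sigma> l sequentially"
  proof (rule complete, intro allI impI)
    fix U assume "openin T U \<and> 0 \<in> U"
    then obtain q \<epsilon> where "\<epsilon> > 0" "\<And>y. p q y < \<epsilon> \<Longrightarrow> y \<in> U"
      using seminorm_generated_openD[OF T, of U 0] by auto
    then show "\<exists>N. \<forall>m\<ge>N. \<forall>n\<ge>N. \<sigma> m - \<sigma> n \<in> U" using C[of \<epsilon> q] by blast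
  qed
  then obtain l where l: "limitin T \<sigma> l sequentially" by blast
  have "(\<lambda>n. p q (\<sigma> n - l)) \<longlonglongrightarrow> 0" for q
  proof (rule LIMSEQ_I)
    fix r :: real assume r: "0 < r"
    have "openin T {y \<in> UNIV. p q (y - l) < r}"
      by (rule seminorm_ball_open[OF vector_space_axioms subspace_UNIV T rangeI p(1)]) simp
    moreover have "l \<in> {y \<in> UNIV. p q (y - l) < r}"
      using complex_vector_space.seminorm_zero[OF _ subspace_UNIV p(1), of q] r vector_space_axioms
      by (simp add: complex_vector_space_def)
    ultimately have "\<forall>\<^sub>F n in sequentially. \<sigma> n \<in> {y \<in> UNIV. p q (y - l) < r}"
      using l unfolding limitin_def by blast
    then show "\<exists>N. \<forall>n\<ge>N. norm (p q (\<sigma> n - l) - 0) < r"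
      using seminorm_onD(1)[OF p(1)] by (auto simp: eventually_sequentially)
  qed
  then show "\<exists>l. \<forall>q. (\<lambda>n. p q (\<sigma> n - l)) \<longlonglongrightarrow> 0" by blast
qed

text \<open>Metrizability gives a countable neighbourhood base at 0, and each of its members
  contains a ball of a single member of \<open>P\<close>. For \<open>tau_star\<close> the family is
  indexed by all bounded sets, so a sequence has to be selected.\<close>

lemma seminorm_generated_sequence:
  assumes T: "seminorm_generated UNIV P T" and m: "metrizable_space T"
  obtains p where "\<And>n::nat. p n \<in> P"
    "\<And>U. openin T U \<Longrightarrow> 0 \<in> U \<Longrightarrow> \<exists>n. \<exists>\<epsilon>>0. \<forall>x. p n x < \<epsilon> \<longrightarrow> x \<in> U"
proof -
  have ts: "topspace T = UNIV" by (rule seminorm_generated_topspace[OF T])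
  obtain \<B> where B: "countable \<B>" "\<And>V. V \<in> \<B> \<Longrightarrow> openin T V"
    "\<And>U. openin T U \<Longrightarrow> 0 \<in> U \<Longrightarrow> \<exists>V\<in>\<B>. 0 \<in> V \<and> V \<subseteq> U"
    using metrizable_imp_first_countable[OF m] ts unfolding first_countable_def by (metis UNIV_I)
  define \<C> where "\<C> = {V \<in> \<B>. 0 \<in> V}"
  have C: "countable \<C>" "\<C> \<noteq> {}"
    using B(1) B(3)[of UNIV] openin_topspace[of T] by (auto simp: \<C>_def ts)
  have "\<exists>p\<in>P. \<exists>\<epsilon>>0. \<forall>x. p x < \<epsilon> \<longrightarrow> x \<in> V" if "V \<in> \<C>" for V
    using seminorm_generated_openD[OF T B(2), of V 0] that by (auto simp: \<C>_def)
  then obtain g where g: "\<And>V. V \<in> \<C> \<Longrightarrow> g V \<in> P \<and> (\<exists>\<epsilon>>0. \<forall>x. g V x < \<epsilon> \<longrightarrow> x \<in> V)" by metis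
  have e: "from_nat_into \<C> n \<in> \<C>" for n by (rule from_nat_into[OF C(2)])
  show ?thesis
  proof (rule that[of "\<lambda>n. g (from_nat_into \<C> n)"])
    show "g (from_nat_into \<C> n) \<in> P" for n using g e by blast
    fix U assume U: "openin T U" "0 \<in> U"
    obtain V where V: "V \<in> \<C>" "V \<subseteq> U" using B(3)[OF U] by (auto simp: \<C>_def)
    obtain n where "from_nat_into \<C> n = V" using from_nat_into_surj[OF C(1) V(1)] by blast
    then show "\<exists>n. \<exists>\<epsilon>>0. \<forall>x. g (from_nat_into \<C> n) x < \<epsilon> \<longrightarrow> x \<in> U" using g[OF V(1)] V(2) by blast
  qed
qed

text \<open>The topology generated by \<open>P\<close> is translation invariant, so a base at 0
  suffices.\<close>

lemma seminorm_generated_subfamily: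
  assumes T: "seminorm_generated UNIV P T" and sub: "range p \<subseteq> P"
    and p: "\<And>U. openin T U \<Longrightarrow> 0 \<in> U \<Longrightarrow> \<exists>n. \<exists>\<epsilon>>0. \<forall>x. p n x < \<epsilon> \<longrightarrow> x \<in> U"
  shows "seminorm_generated UNIV (range p) T"
  unfolding seminorm_generated_def
proof (intro conjI allI iffI)
  fix U
  {
    assume U: "openin T U"
    show "\<forall>x\<in>U. \<exists>p'\<in>range p. \<exists>\<epsilon>>0. {y \<in> UNIV. p' (y - x) < \<epsilon>} \<subseteq> U"
    proof
      fix x assume x: "x \<in> U"
      have "openin T {y. y + x \<in> U}"
      proof (rule seminorm_generated_openI[OF T])
        fix y assume "y \<in> {y. y + x \<in> U}"
        then obtain p \<epsilon> where p: "p \<in> P" "\<epsilon> > 0" "\<And>z. p (z - (y + x)) < \<epsilon> \<Longrightarrow> z \<in> U"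
          using seminorm_generated_openD[OF T U, of "y + x"] by auto
        have "z \<in> {y. y + x \<in> U}" if "p (z - y) < \<epsilon>" for z using p(3)[of "z + x"] that by simp
        then show "\<exists>p\<in>P. \<exists>\<epsilon>>0. \<forall>z\<in>UNIV. p (z - y) < \<epsilon> \<longrightarrow> z \<in> {y. y + x \<in> U}" using p(1,2) by blast
      qed simp
      then obtain n \<epsilon> where "\<epsilon> > 0" "\<And>y. p n y < \<epsilon> \<Longrightarrow> y + x \<in> U" using p[of "{y. y + x \<in> U}"] x by auto
      then have "\<epsilon> > 0 \<and> {y \<in> UNIV. p n (y - x) < \<epsilon>} \<subseteq> U" by (auto, metis diff_add_cancel)
      then show "\<exists>p'\<in>range p. \<exists>\<epsilon>>0. {y \<in> UNIV. p' (y - x) < \<epsilon>} \<subseteq> U" by blast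
    qed
  }
  {
    assume U: "U \<subseteq> UNIV \<and> (\<forall>x\<in>U. \<exists>p'\<in>range p. \<exists>\<epsilon>>0. {y \<in> UNIV. p' (y - x) < \<epsilon>} \<subseteq> U)"
    show "openin T U"
    proof (rule seminorm_generated_openI[OF T])
      fix x assume "x \<in> U"
      then obtain n \<epsilon> where "\<epsilon> > 0" "{y \<in> UNIV. p n (y - x) < \<epsilon>} \<subseteq> U" using U by auto
      then show "\<exists>p\<in>P. \<exists>\<epsilon>>0. \<forall>y\<in>UNIV. p (y - x) < \<epsilon> \<longrightarrow> y \<in> U"
        using sub by (intro bexI[of _ "p n"] exI[of _ \<epsilon>]) auto
    qed simp
  }
qed auto

section \<open>Commutative subalgebras of \<open>L\<^sup>*(s)\<close>\<close>

definition unit_s :: "nat \<Rightarrow> s_space"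
  where "unit_s j = Abs_s (unit_seq j)"

lemma seq_unit_s: "seq (unit_s j) = unit_seq j"
  by (simp add: unit_s_def Abs_s_inverse unit_seq_rapidly_decreasing)

lemma s_inner_unit_s: "s_inner (unit_s j) \<eta> = cnj (seq \<eta> j)"
  by (simp add: s_inner_def seq_unit_s ell2_inner_unit)

lemma s_norm_unit_s: "s_norm k (unit_s j) = real (Suc j) ^ k"
proof -
  have "(\<Sum>i. (cmod (unit_seq j i))\<^sup>2 * real (Suc i) ^ (2 * k)) = (\<Sum>i\<in>{j}. (cmod (unit_seq j i))\<^sup>2 * real (Suc i) ^ (2 * k))"
    by (rule suminf_finite) (auto simp: unit_seq_def)
  then show ?thesis
    unfolding s_norm_def seq_unit_s by (simp add: unit_seq_def power_mult power_even_eq real_sqrt_power)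
qed

text \<open>The pairing of \<open>op x \<xi>\<close> with itself is expanded along the unit vectors.
  Moving \<open>op x\<close> to its adjoint reduces this to the coordinates of \<open>\<xi>\<close>,
  so the series of the vectors \<open>op x (unit_s j)\<close> itself is never summed.\<close>

lemma op_norm_le_suminf:
  assumes s: "summable (\<lambda>j. cmod (seq \<xi> j) * s_norm 0 (op x (unit_s j)))"
  shows "s_norm 0 (op x \<xi>) \<le> (\<Sum>j. cmod (seq \<xi> j) * s_norm 0 (op x (unit_s j)))" (is "_ \<le> ?S")
proof -
  let ?\<eta> = "op x \<xi>"
  let ?f = "\<lambda>j. seq \<xi> j * s_inner (op x (unit_s j)) ?\<eta>"
  have le: "norm (?f j) \<le> cmod (seq \<xi> j) * s_norm 0 (op x (unit_s j)) * s_norm 0 ?\<eta>" for j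
    using s_inner_bound[of "op x (unit_s j)" ?\<eta>]
    by (simp add: norm_mult mult.assoc mult_left_mono)
  have s2: "summable (\<lambda>j. cmod (seq \<xi> j) * s_norm 0 (op x (unit_s j)) * s_norm 0 ?\<eta>)"
    using s by (rule summable_mult2)
  have s3: "summable (\<lambda>j. norm (?f j))"
    by (rule summable_comparison_test[OF _ s2]) (use le in auto)
  have "s_inner ?\<eta> ?\<eta> = (\<Sum>j. ?f j)"
  proof -
    have "s_inner ?\<eta> ?\<eta> = s_inner \<xi> (op (Lstar_star x) ?\<eta>)" by (rule s_inner_op)
    also have "\<dots> = (\<Sum>j. seq \<xi> j * s_inner (unit_s j) (op (Lstar_star x) ?\<eta>))"
      by (simp add: s_inner_unit_s) (simp add: s_inner_def ell2_inner_def)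
    finally show ?thesis by (simp add: s_inner_op[symmetric])
  qed
  then have "norm (\<Sum>j. ?f j) = norm (complex_of_real ((s_norm 0 ?\<eta>)\<^sup>2))" by (simp only: s_inner_self)
  then have "(s_norm 0 ?\<eta>)\<^sup>2 = norm (\<Sum>j. ?f j)" by (simp only: norm_of_real) simp
  also have "\<dots> \<le> (\<Sum>j. norm (?f j))" by (rule summable_norm[OF s3])
  also have "\<dots> \<le> (\<Sum>j. cmod (seq \<xi> j) * s_norm 0 (op x (unit_s j)) * s_norm 0 ?\<eta>)"
    by (rule suminf_le[OF le s3 s2])
  also have "\<dots> = ?S * s_norm 0 ?\<eta>" using suminf_mult2[OF s] by simp
  finally have "s_norm 0 ?\<eta> * s_norm 0 ?\<eta> \<le> ?S * s_norm 0 ?\<eta>" by (simp add: power2_eq_square)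
  moreover have "0 \<le> ?S" using s by (intro suminf_nonneg) (auto simp: s_norm_nonneg)
  ultimately show ?thesis using s_norm_nonneg[of 0 ?\<eta>]
    by (cases "s_norm 0 ?\<eta> = 0") (auto simp: mult_le_cancel_right)
qed

lemma op_eq_zero:
  assumes "\<And>j. op x (unit_s j) = 0"
  shows "x = 0"
proof -
  have z: "s_norm q 0 = 0" for q by simp
  have "op x \<xi> = 0" for \<xi>
  proof (rule s_norm_zero_imp)
    have "s_norm 0 (op x \<xi>) \<le> 0" using op_norm_le_suminf[of \<xi> x] by (simp add: assms z)
    then show "s_norm 0 (op x \<xi>) = 0" using s_norm_nonneg[of 0 "op x \<xi>"] by simp
  qed
  then show ?thesis by (simp add: op_inject[symmetric] op_zero fun_eq_iff)
qed

lemma normal_op_norm: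
  assumes "x * Lstar_star x = Lstar_star x * x"
  shows "s_norm 0 (op (Lstar_star x) \<xi>) = s_norm 0 (op x \<xi>)"
proof -
  have "s_inner (op (Lstar_star x) \<xi>) (op (Lstar_star x) \<xi>) = s_inner \<xi> (op (x * Lstar_star x) \<xi>)"
    by (simp add: s_inner_op Lstar.star_star op_mult)
  also have "\<dots> = s_inner (op x \<xi>) (op x \<xi>)"
    unfolding assms by (simp add: s_inner_op op_mult)
  finally have "(s_norm 0 (op (Lstar_star x) \<xi>))\<^sup>2 = (s_norm 0 (op x \<xi>))\<^sup>2"
    by (simp only: s_inner_self of_real_eq_iff)
  then show ?thesis using s_norm_nonneg by (simp add: power2_eq_iff_nonneg)
qed

lemma extends_bounded_norm:
  assumes "extends_bounded x"
  shows "\<exists>C>0. \<forall>\<xi>. s_norm 0 (op x \<xi>) \<le> C * s_norm 0 \<xi>"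
proof -
  obtain X C where X: "\<And>\<xi>. \<xi> \<in> ell2 \<Longrightarrow> ell2_norm (X \<xi>) \<le> C * ell2_norm \<xi>" "\<And>\<xi>. X (seq \<xi>) = seq (op x \<xi>)"
    using assms unfolding extends_bounded_def by blast
  have "ell2_norm (seq \<xi>) = s_norm 0 \<xi>" for \<xi> by (simp add: ell2_norm_def s_norm_def)
  then have "s_norm 0 (op x \<xi>) \<le> C * s_norm 0 \<xi>" for \<xi> using X(1)[OF seq_ell2, of \<xi>] X(2)[of \<xi>] by simp
  moreover have "C * s_norm 0 \<xi> \<le> (\<bar>C\<bar> + 1) * s_norm 0 \<xi>" for \<xi>
    by (intro mult_right_mono s_norm_nonneg) auto
  ultimately have "s_norm 0 (op x \<xi>) \<le> (\<bar>C\<bar> + 1) * s_norm 0 \<xi>" for \<xi> by (rule order_trans)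
  then show ?thesis by (intro exI[of _ "\<bar>C\<bar> + 1"]) auto
qed

lemma summable_inverse_Suc_square: "summable (\<lambda>j. 1 / real (Suc j) ^ 2)"
  using inverse_power_summable[of 2, where 'a=real]
  by (subst summable_Suc_iff[of "\<lambda>j. 1 / real j ^ 2"]) (simp add: divide_inverse)

locale Lstar_representation = frechet_star_algebra sc star T
  for sc :: "complex \<Rightarrow> 'a::ring \<Rightarrow> 'a" and star T +
  fixes \<phi> :: "'a \<Rightarrow> Lstar" and F
  assumes lin: "lin_on sc Lstar_scale UNIV \<phi>"
    and mult: "\<phi> (x * y) = \<phi> x * \<phi> y"
    and star_hom: "\<phi> (star x) = Lstar_star (\<phi> x)"
    and homeo: "homeomorphic_map T (subtopology tau_star F) \<phi>"
begin

sublocale complex_vector_space sc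
  by (simp add: complex_vector_space_def vector_space_axioms)

lemma add: "\<phi> (x + y) = \<phi> x + \<phi> y" and scale_hom: "\<phi> (sc c x) = Lstar_scale c (\<phi> x)"
  using lin by (auto simp: lin_on_def)

lemma diff: "\<phi> (x - y) = \<phi> x - \<phi> y"
  using add[of "x - y" y] by (simp add: algebra_simps)

lemma hom_zero: "\<phi> 0 = 0"
  using diff[of 0 0] by simp

lemma inj: "inj \<phi>"
  using homeomorphic_imp_injective_map[OF homeo] topspace_UNIV by simp

abbreviation seminorms :: "('a \<Rightarrow> real) set"
  where "seminorms \<equiv> (\<lambda>q. q \<circ> \<phi>) ` {Lstar_seminorm N B | N B. s_bounded B \<and> B \<noteq> {}}"

lemma generated: "seminorm_generated UNIV seminorms T"
proof (rule seminorm_generated_pullback[OF Lstar.vector_space_axioms Lstar.subspace_UNIV tau_star_generated])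
  show "seminorm_on Lstar_scale UNIV q" if "q \<in> {Lstar_seminorm N B | N B. s_bounded B \<and> B \<noteq> {}}" for q
    using that Lstar_seminorm_seminorm by blast
qed (rule subset_UNIV topspace_UNIV homeo diff)+

lemma seminorm_hom:
  assumes "s_bounded B" "B \<noteq> {}"
  shows "seminorm_on sc UNIV (Lstar_seminorm N B \<circ> \<phi>)"
  using Lstar_seminorm_seminorm[OF assms, of N]
  by (simp add: seminorm_on_def add scale_hom)

text \<open>Partial sums of the selected orders and unions of the selected sets make the sequence
  increasing. The pairs \<open>N n\<close>, \<open>B n\<close> stay visible because the domination
  estimate passes from an order to its double over the same set.\<close>

lemma fundamental_Lstar_seminorms:
  "\<exists>N B. (\<forall>n::nat. s_bounded (B n)) \<and> (\<forall>n. B n \<noteq> {}) \<and>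
    (\<forall>n x. Lstar_seminorm (N n) (B n) (\<phi> x) \<le> Lstar_seminorm (N (Suc n)) (B (Suc n)) (\<phi> x)) \<and>
    seminorm_generated UNIV (range (\<lambda>n x. Lstar_seminorm (N n) (B n) (\<phi> x))) T"
proof -
  obtain p where p: "\<And>n::nat. p n \<in> seminorms"
    "\<And>U. openin T U \<Longrightarrow> 0 \<in> U \<Longrightarrow> \<exists>n. \<exists>\<epsilon>>0. \<forall>x. p n x < \<epsilon> \<longrightarrow> x \<in> U"
    by (rule seminorm_generated_sequence[OF generated metrizable]) blast+
  have "\<exists>N B. p n = Lstar_seminorm N B \<circ> \<phi> \<and> s_bounded B \<and> B \<noteq> {}" for n using p(1)[of n] by blast
  then obtain N B where NB: "\<And>n. p n = Lstar_seminorm (N n) (B n) \<circ> \<phi>" "\<And>n. s_bounded (B n)" "\<And>n. B n \<noteq> {}"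
    by metis
  define N' where "N' n = (\<Sum>i\<le>n. N i)" for n
  define B' where "B' n = (\<Union>i\<le>n. B i)" for n
  have B'Suc: "B' (Suc n) = B' n \<union> B (Suc n)" for n by (auto simp: B'_def le_Suc_eq)
  have bd: "s_bounded (B' n)" for n
  proof (induction n)
    case 0
    then show ?case using NB(2) by (simp add: B'_def)
  next
    case (Suc n)
    then show ?case using NB(2) by (simp add: B'Suc s_bounded_Un)
  qed
  have ne: "B' n \<noteq> {}" for n using NB(3) by (auto simp: B'_def)
  have le: "p n x \<le> Lstar_seminorm (N' n) (B' n) (\<phi> x)" for n x
  proof -
    have "N n \<le> N' n" unfolding N'_def by (rule member_le_sum) auto
    moreover have "B n \<subseteq> B' n" by (auto simp: B'_def)
    ultimately show ?thesis unfolding NB(1) o_def by (rule Lstar_seminorm_mono[OF _ _ NB(3) bd])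
  qed
  show ?thesis
  proof (intro exI[of _ N'] exI[of _ B'] conjI allI bd ne)
    show "Lstar_seminorm (N' n) (B' n) (\<phi> x) \<le> Lstar_seminorm (N' (Suc n)) (B' (Suc n)) (\<phi> x)" for n x
      by (rule Lstar_seminorm_mono[OF _ _ ne bd]) (auto simp: N'_def B'Suc)
    show "seminorm_generated UNIV (range (\<lambda>n x. Lstar_seminorm (N' n) (B' n) (\<phi> x))) T"
    proof (rule seminorm_generated_subfamily[OF generated])
      have "(\<lambda>x. Lstar_seminorm (N' n) (B' n) (\<phi> x)) \<in> seminorms" for n
        by (rule image_eqI[of _ _ "Lstar_seminorm (N' n) (B' n)"]) (simp add: o_def, use bd ne in blast)
      then show "range (\<lambda>n x. Lstar_seminorm (N' n) (B' n) (\<phi> x)) \<subseteq> seminorms" by blast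
      fix U assume "openin T U" "0 \<in> U"
      then obtain n \<epsilon> where "\<epsilon> > 0" "\<And>x. p n x < \<epsilon> \<Longrightarrow> x \<in> U" using p(2) by blast
      then show "\<exists>n. \<exists>\<epsilon>>0. \<forall>x. Lstar_seminorm (N' n) (B' n) (\<phi> x) < \<epsilon> \<longrightarrow> x \<in> U"
        using le by (intro exI[of _ n] exI[of _ \<epsilon>]) (auto intro: le_less_trans)
    qed
  qed
qed

end

locale commutative_Lstar_representation = Lstar_representation +
  assumes commute: "x * y = y * (x :: 'a)"
begin

text \<open>The scalar product is a weighted sum over the unit vectors, so (\<alpha>) holds term by
  term, and an l2 bound for \<open>\<phi> x\<close> passes with the same constant to left
  multiplication by \<open>x\<close>. Domination combines \<open>s_norm_interpolation\<close> with
  the estimate \<open>op_le\<close>.\<close>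

lemma dominating_scalar_product:
  "\<exists>ip. dominating_hilbert_norm sc T ip \<and> (\<forall>x y z. ip (x * y) z = ip y (star x * z)) \<and>
    (\<forall>x. extends_bounded (\<phi> x) \<longrightarrow> (\<exists>C>0. \<forall>y. hilbert_norm ip (x * y) \<le> C * hilbert_norm ip y))"
proof -
  obtain N B where NB: "(\<forall>n::nat. s_bounded (B n)) \<and> (\<forall>n. B n \<noteq> {}) \<and>
    (\<forall>n x. Lstar_seminorm (N n) (B n) (\<phi> x) \<le> Lstar_seminorm (N (Suc n)) (B (Suc n)) (\<phi> x)) \<and>
    seminorm_generated UNIV (range (\<lambda>n x. Lstar_seminorm (N n) (B n) (\<phi> x))) T"
    using fundamental_Lstar_seminorms by (elim exE)
  then have B: "\<And>n. s_bounded (B n)" "\<And>n. B n \<noteq> {}"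
    and mono: "\<And>n x. Lstar_seminorm (N n) (B n) (\<phi> x) \<le> Lstar_seminorm (N (Suc n)) (B (Suc n)) (\<phi> x)"
    and gen: "seminorm_generated UNIV (range (\<lambda>n x. Lstar_seminorm (N n) (B n) (\<phi> x))) T"
    by simp_all
  define p where "p n x = Lstar_seminorm (N n) (B n) (\<phi> x)" for n x
  have p_eq: "p n = Lstar_seminorm (N n) (B n) \<circ> \<phi>" for n by (simp add: p_def fun_eq_iff)
  have gen: "seminorm_generated UNIV (range p) T" using gen by (simp add: p_def[abs_def])
  have sp: "seminorm_on sc UNIV (p n)" for n unfolding p_eq by (rule seminorm_hom[OF B])
  have mono: "p n x \<le> p (Suc n) x" for n x using mono by (simp add: p_def)
  interpret p: complete_seminorms sc p by (rule complete_seminorms[OF gen sp mono])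
  have fund: "fundamental_seminorms sc T p" by (rule generated_imp_fundamental[OF vector_space_axioms gen sp mono])
  have bound: "\<exists>q. \<exists>C>0. \<forall>x. Lstar_seminorm M A (\<phi> x) \<le> C * p q x" if "s_bounded A" "A \<noteq> {}" for M A
  proof -
    have "continuous_seminorm sc T (Lstar_seminorm M A \<circ> \<phi>)"
      by (rule seminorm_generated_continuous_seminorm[OF vector_space_axioms subspace_UNIV generated
          seminorm_hom[OF that] _ seminorm_hom[OF that], of M M 1]) (use that in auto)
    from seminorm_le_of_fundamental[OF vector_space_axioms topspace_UNIV fund this]
    show ?thesis by simp
  qed
  let ?a = "\<lambda>x j. s_norm 0 (op (\<phi> x) (unit_s j))"
  \<comment> \<open>Each \<open>op (\<phi> x)\<close> grows polynomially along the unit vectors,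
    with constant and order depending on \<open>x\<close>. The weight
    \<open>real k * real (Suc j) ^ k\<close> merges both into the single index that
    \<open>uniform_bound\<close> handles.\<close>
  have "\<exists>k q. \<exists>C>0. \<forall>x. \<forall>j\<in>UNIV. ?a x j \<le> C * p q x * (real k * real (Suc j) ^ k)"
  proof (rule p.uniform_bound)
    fix j :: nat
    show "seminorm_on sc UNIV (\<lambda>x. ?a x j)"
      using s_norm_seminorm[of 0] unfolding seminorm_on_def by (simp add: add scale_hom op_add op_scale)
    obtain q C where "\<And>x. Lstar_seminorm 0 {unit_s j} (\<phi> x) \<le> C * p q x"
      using bound[OF s_bounded_singleton, of "unit_s j" 0] by auto
    then show "\<exists>q C. \<forall>x. ?a x j \<le> C * p q x"
      using Lstar_seminorm_upper(1)[OF s_bounded_singleton, of "unit_s j" "unit_s j" 0] by (meson insertI1 order_trans)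
  next
    fix x
    obtain k C where C: "C > 0" "\<And>\<xi>. s_norm 0 (op (\<phi> x) \<xi>) \<le> C * s_norm k \<xi>" using op_continuous by blast
    obtain m :: nat where m: "C \<le> real m" using real_arch_simple by blast
    have "?a x j \<le> real (max m k) * real (Suc j) ^ max m k" for j
    proof -
      have "?a x j \<le> C * real (Suc j) ^ k" using C(2)[of "unit_s j"] by (simp only: s_norm_unit_s)
      also have "\<dots> \<le> real (max m k) * real (Suc j) ^ max m k"
        using m C(1) by (intro mult_mono power_increasing) auto
      finally show ?thesis .
    qed
    then show "\<exists>k. \<forall>j\<in>UNIV. ?a x j \<le> real k * real (Suc j) ^ k" by blast
  qed
  then obtain k q0 C0 where C0: "C0 > 0" "\<And>x j. ?a x j \<le> C0 * p q0 x * (real k * real (Suc j) ^ k)" by blast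
  define K where "K = C0 * real k"
  have K: "0 \<le> K" "?a x j \<le> K * p q0 x * real (Suc j) ^ k" for x j
    using C0 by (auto simp: K_def mult_ac)
  \<comment> \<open>One power beyond \<open>k\<close>: then \<open>?a x j * w j\<close> is at most a
    multiple of \<open>1 / real (Suc j)\<close>, which is square summable.\<close>
  define w where "w j = 1 / real (Suc j) ^ (k + 1)" for j
  have w: "0 < w j" for j by (simp add: w_def)
  have aw: "?a x j * w j \<le> K * p q0 x * (1 / real (Suc j))" for x j
    using mult_right_mono[OF K(2)[of x j] less_imp_le[OF w[of j]]] by (simp add: w_def)
  have aw0: "0 \<le> ?a x j * w j" for x j using w[of j] s_norm_nonneg by (simp add: less_imp_le)
  have aw2: "(?a x j * w j)\<^sup>2 \<le> (K * p q0 x)\<^sup>2 * (1 / real (Suc j) ^ 2)" for x j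
    using power_mono[OF aw aw0, of x j 2] by (simp only: power_mult_distrib power_divide power_one)
  have sm: "summable (\<lambda>j. (?a x j * w j)\<^sup>2)" for x
    by (rule summable_comparison_test[OF _ summable_mult[OF summable_inverse_Suc_square]])
      (use aw2[of x] in auto)
  define t where "t x y j = s_inner (op (\<phi> x) (unit_s j)) (op (\<phi> y) (unit_s j)) * of_real ((w j)\<^sup>2)" for x y j
  define ip where "ip x y = (\<Sum>j. t x y j)" for x y
  have st: "summable (t x y)" for x y
  proof (rule summable_comparison_test[OF _ suminf_Cauchy_Schwarz(1)[OF sm[of x] sm[of y]]])
    have "norm (t x y j) \<le> \<bar>(?a x j * w j) * (?a y j * w j)\<bar>" for j
      using mult_right_mono[OF s_inner_bound[of "op (\<phi> x) (unit_s j)" "op (\<phi> y) (unit_s j)"], of "(w j)\<^sup>2"]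
        w[of j] s_norm_nonneg
      by (simp add: t_def norm_mult norm_power power2_eq_square abs_mult mult_ac)
    then show "\<exists>N. \<forall>n\<ge>N. norm (t x y n) \<le> \<bar>?a x n * w n * (?a y n * w n)\<bar>" by blast
  qed
  have txx: "t x x j = of_real ((?a x j * w j)\<^sup>2)" for x j
    by (simp add: t_def s_inner_self power_mult_distrib)
  then have "t x x = (\<lambda>j. of_real ((?a x j * w j)\<^sup>2))" for x by (intro ext)
  then have ipxx: "ip x x = of_real (\<Sum>j. (?a x j * w j)\<^sup>2)" for x
    by (simp only: ip_def suminf_of_real[OF sm])
  have hn: "hilbert_norm ip x = sqrt (\<Sum>j. (?a x j * w j)\<^sup>2)" for x by (simp add: hilbert_norm_def ipxx)
  have sprod: "scalar_product sc ip"
    unfolding scalar_product_def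
  proof (intro conjI allI impI)
    fix x y z c
    have "t (x + y) z j = t x z j + t y z j" for j
      by (simp add: t_def add op_add s_inner_add_left distrib_right)
    then show "ip (x + y) z = ip x z + ip y z" by (simp add: ip_def suminf_add[OF st st])
    have "t (sc c x) y j = c * t x y j" for j
      by (simp add: t_def scale_hom op_scale s_inner_scale_left)
    then show "ip (sc c x) y = c * ip x y" by (simp add: ip_def suminf_mult[OF st])
    have "t y x j = cnj (t x y j)" for j
      unfolding t_def by (subst s_inner_commute) simp
    then have "(\<lambda>j. t y x j) sums cnj (ip x y)"
      using summable_sums[OF st[of x y]] by (simp add: ip_def sums_cnj)
    then show "ip y x = cnj (ip x y)" by (simp add: ip_def sums_iff)
    assume "x \<noteq> 0"
    then have "\<phi> x \<noteq> 0" using inj hom_zero by (metis injD)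
    then obtain j where "op (\<phi> x) (unit_s j) \<noteq> 0" using op_eq_zero by blast
    then have "0 < ?a x j" using s_norm_zero_imp s_norm_nonneg by (metis less_eq_real_def)
    then have "0 < (?a x j * w j)\<^sup>2" using w[of j] by simp
    then show "0 < Re (ip x x)" unfolding ipxx Re_complex_of_real by (intro suminf_pos2[OF sm[of x], of j]) auto
  qed
  interpret scalar_product_space sc ip by standard (rule sprod)
  obtain S where S: "0 \<le> S" "\<And>x. hilbert_norm ip x \<le> S * p q0 x"
  proof (rule that)
    show "0 \<le> K * sqrt (\<Sum>j. 1 / real (Suc j) ^ 2)"
      using K summable_inverse_Suc_square by (intro mult_nonneg_nonneg real_sqrt_ge_zero suminf_nonneg) auto
    fix x
    have "(\<Sum>j. (?a x j * w j)\<^sup>2) \<le> (\<Sum>j. (K * p q0 x)\<^sup>2 * (1 / real (Suc j) ^ 2))"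
      by (rule suminf_le[OF aw2 sm summable_mult[OF summable_inverse_Suc_square]])
    also have "\<dots> = (K * p q0 x)\<^sup>2 * (\<Sum>j. 1 / real (Suc j) ^ 2)"
      by (rule suminf_mult[OF summable_inverse_Suc_square])
    finally have "hilbert_norm ip x \<le> sqrt ((K * p q0 x)\<^sup>2 * (\<Sum>j. 1 / real (Suc j) ^ 2))"
      unfolding hn by (rule real_sqrt_le_mono)
    also have "\<dots> = K * sqrt (\<Sum>j. 1 / real (Suc j) ^ 2) * p q0 x"
      using K(1) p.pD(1)[of q0 x] by (simp only: real_sqrt_mult real_sqrt_abs) (simp add: abs_mult)
    finally show "hilbert_norm ip x \<le> K * sqrt (\<Sum>j. 1 / real (Suc j) ^ 2) * p q0 x" .
  qed
  \<comment> \<open>The weight \<open>w j\<close> is given to \<open>?a x j\<close> and its inverse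
    to the coordinates of \<open>\<xi>\<close>, which raises the order of the norm of
    \<open>\<xi>\<close> to \<open>k + 1\<close>.\<close>
  have op_le: "s_norm 0 (op (\<phi> x) \<xi>) \<le> s_norm (k + 1) \<xi> * hilbert_norm ip x" for x \<xi>
  proof -
    have eq: "cmod (seq \<xi> j) * ?a x j = \<bar>(cmod (seq \<xi> j) * real (Suc j) ^ (k + 1)) * (?a x j * w j)\<bar>" for j
      using s_norm_nonneg w[of j] by (simp add: w_def abs_mult)
    have s1: "summable (\<lambda>j. (cmod (seq \<xi> j) * real (Suc j) ^ (k + 1))\<^sup>2)"
      using s_summable[of \<xi> "k + 1"] by (simp only: power_mult_distrib power_mult[symmetric] mult.commute)
    note CS = suminf_Cauchy_Schwarz[OF s1 sm[of x]]
    have "s_norm 0 (op (\<phi> x) \<xi>) \<le> (\<Sum>j. cmod (seq \<xi> j) * ?a x j)"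
      by (rule op_norm_le_suminf) (use CS(1) in \<open>simp only: eq\<close>)
    also have "\<dots> \<le> sqrt (\<Sum>j. (cmod (seq \<xi> j) * real (Suc j) ^ (k + 1))\<^sup>2) * hilbert_norm ip x"
      unfolding eq hn by (rule CS(2))
    also have "sqrt (\<Sum>j. (cmod (seq \<xi> j) * real (Suc j) ^ (k + 1))\<^sup>2) = s_norm (k + 1) \<xi>"
      unfolding s_norm_def by (simp only: power_mult_distrib power_mult[symmetric] mult.commute)
    finally show ?thesis .
  qed
  have dom: "dominating_norm sc T (hilbert_norm ip)"
    unfolding dominating_norm_def
  proof (intro conjI)
    show "continuous_seminorm sc T (hilbert_norm ip)"
      by (rule seminorm_generated_continuous_seminorm[OF vector_space_axioms subspace_UNIV gen
            hilbert_norm_seminorm rangeI sp S(2)])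
    show "\<forall>x\<in>topspace T. hilbert_norm ip x = 0 \<longrightarrow> x = 0" using hilbert_norm_eq_zero by blast
    show "\<exists>p. fundamental_seminorms sc T p \<and>
      (\<forall>q. \<exists>r. \<exists>C>0. \<forall>x\<in>topspace T. (p q x)\<^sup>2 \<le> C * hilbert_norm ip x * p r x)"
    proof (intro exI[of _ p] conjI fund allI)
      fix q
      obtain M where M: "\<And>\<xi>. \<xi> \<in> B q \<Longrightarrow> s_norm (k + 1) \<xi> \<le> M"
        using B(1)[of q] unfolding s_bounded_def bdd_above_def by (meson image_eqI)
      obtain r C where C: "C > 0" "\<And>x. Lstar_seminorm (2 * N q) (B q) (\<phi> x) \<le> C * p r x"
        using bound[OF B] by blast
      \<comment> \<open>Both entries of the maximum in \<open>Lstar_seminorm\<close> are treated at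
        once. Interpolation leaves one factor of order 0, bounded through the Hilbert norm, and one
        of order \<open>2 * N q\<close>, bounded by a seminorm of \<open>E\<close>.\<close>
      have est: "s_norm (N q) (op y \<xi>) \<le> sqrt (\<bar>M\<bar> * hilbert_norm ip x * (C * p r x))"
        if xi: "\<xi> \<in> B q" and y: "y = \<phi> x \<or> y = Lstar_star (\<phi> x)" for x y \<xi>
      proof (rule real_le_rsqrt)
        have nrm: "\<phi> x * Lstar_star (\<phi> x) = Lstar_star (\<phi> x) * \<phi> x"
          using arg_cong[OF commute[of x "star x"], of \<phi>] by (simp add: mult star_hom)
        have "s_norm 0 (op y \<xi>) = s_norm 0 (op (\<phi> x) \<xi>)"
          using y normal_op_norm[OF nrm] by auto
        also have "\<dots> \<le> s_norm (k + 1) \<xi> * hilbert_norm ip x" by (rule op_le)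
        also have "\<dots> \<le> \<bar>M\<bar> * hilbert_norm ip x"
          using M[OF xi] by (intro mult_right_mono hilbert_norm_nonneg) auto
        finally have 1: "s_norm 0 (op y \<xi>) \<le> \<bar>M\<bar> * hilbert_norm ip x" .
        have 2: "s_norm (2 * N q) (op y \<xi>) \<le> C * p r x"
          using y Lstar_seminorm_upper[OF B(1) xi, of "2 * N q" "\<phi> x"] C(2)[of x] by auto
        show "(s_norm (N q) (op y \<xi>))\<^sup>2 \<le> \<bar>M\<bar> * hilbert_norm ip x * (C * p r x)"
          by (rule order_trans[OF s_norm_interpolation])
            (intro mult_mono 1 2 s_norm_nonneg mult_nonneg_nonneg hilbert_norm_nonneg abs_ge_zero)
      qed
      have "(p q x)\<^sup>2 \<le> (\<bar>M\<bar> * C + 1) * hilbert_norm ip x * p r x" for x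
      proof -
        have nn: "0 \<le> \<bar>M\<bar> * hilbert_norm ip x * (C * p r x)"
          using C(1) p.pD(1) hilbert_norm_nonneg by (intro mult_nonneg_nonneg) auto
        have "p q x \<le> sqrt (\<bar>M\<bar> * hilbert_norm ip x * (C * p r x))"
          unfolding p_def[of q] by (rule Lstar_seminorm_least[OF B(2)]) (use est in blast)+
        then have "(p q x)\<^sup>2 \<le> (sqrt (\<bar>M\<bar> * hilbert_norm ip x * (C * p r x)))\<^sup>2"
          using p.pD(1) by (intro power_mono) auto
        also have "\<dots> = \<bar>M\<bar> * hilbert_norm ip x * (C * p r x)" using nn by simp
        also have "\<dots> = (\<bar>M\<bar> * C) * (hilbert_norm ip x * p r x)" by (simp add: mult_ac)
        \<comment> \<open>Adding 1 keeps the constant positive when \<open>M\<close> is 0.\<close>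
        also have "\<dots> \<le> (\<bar>M\<bar> * C + 1) * (hilbert_norm ip x * p r x)"
          using p.pD(1) hilbert_norm_nonneg by (intro mult_right_mono mult_nonneg_nonneg) auto
        finally show ?thesis by (simp add: mult.assoc)
      qed
      moreover have "0 < \<bar>M\<bar> * C + 1" using C(1) by (simp add: add_nonneg_pos)
      ultimately show "\<exists>r. \<exists>C>0. \<forall>x\<in>topspace T. (p q x)\<^sup>2 \<le> C * hilbert_norm ip x * p r x" by blast
    qed
  qed
  have "ip (x * y) z = ip y (star x * z)" for x y z
    unfolding ip_def t_def by (simp add: mult star_hom op_mult s_inner_op)
  moreover have "\<exists>C>0. \<forall>y. hilbert_norm ip (x * y) \<le> C * hilbert_norm ip y" if bd: "extends_bounded (\<phi> x)" for x
  proof -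
    obtain C where C: "C > 0" "\<And>\<xi>. s_norm 0 (op (\<phi> x) \<xi>) \<le> C * s_norm 0 \<xi>"
      using extends_bounded_norm[OF bd] by blast
    have "hilbert_norm ip (x * y) \<le> C * hilbert_norm ip y" for y
    proof -
      have "(?a (x * y) j * w j)\<^sup>2 \<le> C\<^sup>2 * (?a y j * w j)\<^sup>2" for j
      proof -
        have "?a (x * y) j * w j \<le> C * (?a y j * w j)"
          using mult_right_mono[OF C(2)[of "op (\<phi> y) (unit_s j)"] less_imp_le[OF w[of j]]]
          by (simp add: mult op_mult mult.assoc)
        from power_mono[OF this aw0, of 2] show ?thesis by (simp only: power_mult_distrib)
      qed
      then have "(\<Sum>j. (?a (x * y) j * w j)\<^sup>2) \<le> (\<Sum>j. C\<^sup>2 * (?a y j * w j)\<^sup>2)"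
        by (rule suminf_le[OF _ sm summable_mult[OF sm]])
      also have "\<dots> = C\<^sup>2 * (\<Sum>j. (?a y j * w j)\<^sup>2)" by (rule suminf_mult[OF sm])
      finally have "sqrt (\<Sum>j. (?a (x * y) j * w j)\<^sup>2) \<le> sqrt (C\<^sup>2 * (\<Sum>j. (?a y j * w j)\<^sup>2))"
        by (rule real_sqrt_le_mono)
      then show ?thesis using C(1) unfolding hn by (simp add: real_sqrt_mult)
    qed
    then show ?thesis using C(1) by blast
  qed
  ultimately show ?thesis using sprod dom unfolding dominating_hilbert_norm_def by blast
qed

end

theorem commutative_subalgebra_DN:
  fixes sc :: "complex \<Rightarrow> 'a::ring \<Rightarrow> 'a"
  assumes E: "frechet_star_algebra sc star T" and comm: "\<And>x y :: 'a. x * y = y * x"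
    and iso: "star_isomorphic_to sc star T F"
  shows "DN_algebra sc star T" and "bounded_operators F \<Longrightarrow> beta_DN_algebra sc star T"
proof -
  obtain \<phi> where \<phi>: "lin_on sc Lstar_scale UNIV \<phi>" "\<And>x y. \<phi> (x * y) = \<phi> x * \<phi> y"
    "\<And>x. \<phi> (star x) = Lstar_star (\<phi> x)" "homeomorphic_map T (subtopology tau_star F) \<phi>"
    using iso unfolding star_isomorphic_to_def by blast
  interpret frechet_star_algebra sc star T by (rule E)
  interpret commutative_Lstar_representation sc star T \<phi> F
    by unfold_locales (use \<phi> comm in auto)
  obtain ip where ip: "dominating_hilbert_norm sc T ip" "\<forall>x y z. ip (x * y) z = ip y (star x * z)"
    "\<forall>x. extends_bounded (\<phi> x) \<longrightarrow> (\<exists>C>0. \<forall>y. hilbert_norm ip (x * y) \<le> C * hilbert_norm ip y)"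
    using dominating_scalar_product by blast
  show "DN_algebra sc star T" unfolding DN_algebra_def using E ip by blast
  assume bd: "bounded_operators F"
  have "\<phi> x \<in> F" for x
    using homeomorphic_imp_surjective_map[OF homeo] topspace_UNIV by auto
  then have "extends_bounded (\<phi> x)" for x using bd by (auto simp: bounded_operators_def)
  then show "beta_DN_algebra sc star T" unfolding beta_DN_algebra_def using E ip by blast
qed

section \<open>Nuclear power series spaces\<close>

lemma weighted_norm_compare:
  assumes w: "\<And>j. 0 \<le> w j" "\<And>j. 0 \<le> w' j" and s: "summable (\<lambda>j. (cmod (\<eta> j))\<^sup>2 * w' j)" and M: "0 \<le> M"
    and le: "\<And>j. (cmod (\<xi> j))\<^sup>2 * w j \<le> M\<^sup>2 * ((cmod (\<eta> j))\<^sup>2 * w' j)"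
  shows "summable (\<lambda>j. (cmod (\<xi> j))\<^sup>2 * w j)" "weighted_norm w \<xi> \<le> M * weighted_norm w' \<eta>"
proof -
  have nn: "0 \<le> M * weighted_norm w' \<eta>" using M weighted_norm_nonneg[OF w(2) s] by simp
  have "(\<Sum>j<n. (cmod (\<xi> j))\<^sup>2 * w j) \<le> (M * weighted_norm w' \<eta>)\<^sup>2" for n
  proof -
    have "(\<Sum>j<n. (cmod (\<xi> j))\<^sup>2 * w j) \<le> (\<Sum>j<n. M\<^sup>2 * ((cmod (\<eta> j))\<^sup>2 * w' j))" by (intro sum_mono le)
    also have "\<dots> \<le> M\<^sup>2 * (weighted_norm w' \<eta>)\<^sup>2"
      using weighted_partial_sum_le[OF w(2) s] by (simp add: sum_distrib_left[symmetric] mult_left_mono)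
    finally show ?thesis by (simp add: power_mult_distrib)
  qed
  then show "summable (\<lambda>j. (cmod (\<xi> j))\<^sup>2 * w j)" "weighted_norm w \<xi> \<le> M * weighted_norm w' \<eta>"
    using weighted_norm_boundI[OF w(1) nn] by auto
qed

definition trunc :: "nat \<Rightarrow> (nat \<Rightarrow> complex) \<Rightarrow> nat \<Rightarrow> complex"
  where "trunc n \<xi> = (\<lambda>j. if j < n then \<xi> j else 0)"

lemma trunc_0: "trunc 0 \<xi> = 0"
  by (simp add: trunc_def fun_eq_iff)

lemma trunc_Suc: "trunc (Suc n) \<xi> = trunc n \<xi> + seq_scale (\<xi> n) (unit_seq n)"
  by (auto simp: trunc_def seq_scale_def unit_seq_def fun_eq_iff less_Suc_eq)

lemma vector_space_seq: "vector_space seq_scale"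
  by standard (simp_all add: seq_scale_def fun_eq_iff algebra_simps)

interpretation seqs: complex_vector_space seq_scale
  by (simp add: complex_vector_space_def vector_space_seq)

section \<open>Norms of initial sections and tails in power series spaces\<close>

abbreviation Lambda_weight :: "(nat \<Rightarrow> real) \<Rightarrow> nat \<Rightarrow> nat \<Rightarrow> real"
  where "Lambda_weight \<alpha> q \<equiv> (\<lambda>j. exp (2 * real q * \<alpha> j))"

lemma Lambda_norm_eq: "Lambda_norm \<alpha> q \<xi> = weighted_norm (Lambda_weight \<alpha> q) \<xi>"
  by (simp add: Lambda_norm_def weighted_norm_def)

lemma Lambda_summable:
  "\<xi> \<in> Lambda_inf \<alpha> \<Longrightarrow> summable (\<lambda>j. (cmod (\<xi> j))\<^sup>2 * Lambda_weight \<alpha> q j)"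
  by (simp add: Lambda_inf_def)

lemma Lambda_subspace: "seqs.subspace (Lambda_inf \<alpha>)"
proof (rule seqs.subspaceI)
  show "0 \<in> Lambda_inf \<alpha>" by (simp add: Lambda_inf_def)
  show "\<xi> + \<eta> \<in> Lambda_inf \<alpha>" if "\<xi> \<in> Lambda_inf \<alpha>" "\<eta> \<in> Lambda_inf \<alpha>" for \<xi> \<eta>
    using that by (auto simp: Lambda_inf_def intro!: summable_weighted_add)
  show "seq_scale c \<xi> \<in> Lambda_inf \<alpha>" if "\<xi> \<in> Lambda_inf \<alpha>" for c \<xi>
    using that by (auto simp: Lambda_inf_def seq_scale_def norm_mult power_mult_distrib mult.assoc intro!: summable_mult)
qed

lemma Lambda_norm_seminorm: "seminorm_on seq_scale (Lambda_inf \<alpha>) (Lambda_norm \<alpha> q)"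
  unfolding seminorm_on_def Lambda_norm_eq
  using weighted_norm_nonneg[OF _ Lambda_summable] weighted_norm_triangle[OF _ Lambda_summable Lambda_summable]
    weighted_norm_scale[OF Lambda_summable] by simp

lemma Lambda_norm_coord: "\<xi> \<in> Lambda_inf \<alpha> \<Longrightarrow> cmod (\<xi> j) \<le> Lambda_norm \<alpha> 0 \<xi>"
  using weighted_norm_coord[of "Lambda_weight \<alpha> 0" \<xi> j, OF _ Lambda_summable] by (simp add: Lambda_norm_eq)

lemma exponent_sequenceD:
  assumes "exponent_sequence \<alpha>"
  shows "0 < \<alpha> j" "i \<le> j \<Longrightarrow> \<alpha> i \<le> \<alpha> j"
  using assms by (auto simp: exponent_sequence_def mono_def)

lemma Lambda_norm_mono:
  assumes "exponent_sequence \<alpha>" "\<xi> \<in> Lambda_inf \<alpha>" "q \<le> r"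
  shows "Lambda_norm \<alpha> q \<xi> \<le> Lambda_norm \<alpha> r \<xi>"
proof -
  have "(cmod (\<xi> j))\<^sup>2 * Lambda_weight \<alpha> q j \<le> 1\<^sup>2 * ((cmod (\<xi> j))\<^sup>2 * Lambda_weight \<alpha> r j)" for j
    using assms(3) less_imp_le[OF exponent_sequenceD(1)[OF assms(1)]] by (simp add: mult_left_mono mult_right_mono)
  from weighted_norm_compare(2)[OF _ _ Lambda_summable[OF assms(2)] _ this] show ?thesis
    by (simp add: Lambda_norm_eq)
qed

text \<open>A Bernstein inequality: on the coordinates up to and including \<open>n\<close> no
  weight exceeds that at \<open>n\<close>, as \<open>\<alpha>\<close> is increasing.\<close>

lemma Lambda_norm_initial:
  assumes \<alpha>: "exponent_sequence \<alpha>" and \<xi>: "\<xi> \<in> Lambda_inf \<alpha>" and z: "\<And>j. n < j \<Longrightarrow> \<xi> j = 0"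
  shows "Lambda_norm \<alpha> q \<xi> \<le> exp (real q * \<alpha> n) * Lambda_norm \<alpha> 0 \<xi>"
proof -
  have "(cmod (\<xi> j))\<^sup>2 * Lambda_weight \<alpha> q j \<le> (exp (real q * \<alpha> n))\<^sup>2 * ((cmod (\<xi> j))\<^sup>2 * Lambda_weight \<alpha> 0 j)" for j
  proof (cases "n < j")
    case False
    then have "\<alpha> j \<le> \<alpha> n" using exponent_sequenceD(2)[OF \<alpha>] by simp
    then have "exp (2 * real q * \<alpha> j) \<le> exp (2 * real q * \<alpha> n)" by (simp add: mult_left_mono)
    then show ?thesis by (simp add: exp_double[symmetric] mult_left_mono mult.commute mult.left_commute)
  qed (simp add: z)
  from weighted_norm_compare(2)[OF _ _ Lambda_summable[OF \<xi>] _ this] show ?thesis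
    by (simp add: Lambda_norm_eq)
qed

lemma trunc_Lambda: "\<xi> \<in> Lambda_inf \<alpha> \<Longrightarrow> trunc n \<xi> \<in> Lambda_inf \<alpha>"
  and Lambda_norm_trunc: "\<xi> \<in> Lambda_inf \<alpha> \<Longrightarrow> Lambda_norm \<alpha> q (trunc n \<xi>) \<le> Lambda_norm \<alpha> q \<xi>"
proof -
  assume \<xi>: "\<xi> \<in> Lambda_inf \<alpha>"
  have le: "(cmod (trunc n \<xi> j))\<^sup>2 * Lambda_weight \<alpha> q j \<le> 1\<^sup>2 * ((cmod (\<xi> j))\<^sup>2 * Lambda_weight \<alpha> q j)" for q j
    by (simp add: trunc_def)
  note c = weighted_norm_compare[OF _ _ Lambda_summable[OF \<xi>] _ le]
  show "trunc n \<xi> \<in> Lambda_inf \<alpha>" unfolding Lambda_inf_def using c(1) by simp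
  show "Lambda_norm \<alpha> q (trunc n \<xi>) \<le> Lambda_norm \<alpha> q \<xi>" using c(2)[of q] by (simp add: Lambda_norm_eq)
qed

text \<open>The matching Jackson inequality: from index \<open>n\<close> on, \<open>q\<close> extra
  orders of the norm are worth the factor \<open>exp (- (real q * \<alpha> n))\<close>.\<close>

lemma Lambda_norm_tail:
  assumes \<alpha>: "exponent_sequence \<alpha>" and \<xi>: "\<xi> \<in> Lambda_inf \<alpha>"
  shows "Lambda_norm \<alpha> r (\<xi> - trunc n \<xi>) \<le> exp (- (real q * \<alpha> n)) * Lambda_norm \<alpha> (r + q) \<xi>"
proof -
  have "(cmod ((\<xi> - trunc n \<xi>) j))\<^sup>2 * Lambda_weight \<alpha> r j
      \<le> (exp (- (real q * \<alpha> n)))\<^sup>2 * ((cmod (\<xi> j))\<^sup>2 * Lambda_weight \<alpha> (r + q) j)" for j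
  proof (cases "j < n")
    case False
    then have "\<alpha> n \<le> \<alpha> j" using exponent_sequenceD(2)[OF \<alpha>] by simp
    then have "real q * \<alpha> n \<le> real q * \<alpha> j" by (simp add: mult_left_mono)
    then have "exp (2 * real r * \<alpha> j) \<le> exp (2 * (- (real q * \<alpha> n)) + 2 * real (r + q) * \<alpha> j)"
      by (simp add: algebra_simps)
    also have "\<dots> = (exp (- (real q * \<alpha> n)))\<^sup>2 * exp (2 * real (r + q) * \<alpha> j)"
      unfolding exp_add exp_double ..
    finally have "(cmod (\<xi> j))\<^sup>2 * exp (2 * real r * \<alpha> j)
        \<le> (cmod (\<xi> j))\<^sup>2 * ((exp (- (real q * \<alpha> n)))\<^sup>2 * exp (2 * real (r + q) * \<alpha> j))"
      by (rule mult_left_mono) simp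
    then show ?thesis using False by (simp only: trunc_def minus_apply if_False diff_0_right mult.left_commute)
  qed (simp add: trunc_def)
  from weighted_norm_compare(2)[OF _ _ Lambda_summable[OF \<xi>] _ this] show ?thesis
    by (simp add: Lambda_norm_eq fun_diff_def)
qed

lemma unit_seq_Lambda: "unit_seq i \<in> Lambda_inf \<alpha>"
  unfolding Lambda_inf_def unit_seq_def
  by (auto intro!: summable_finite[of "{i}"] split: if_splits)

lemma Lambda_generated:
  assumes "exponent_sequence \<alpha>"
  shows "seminorm_generated (Lambda_inf \<alpha>) (range (Lambda_norm \<alpha>)) (Lambda_topology \<alpha>)"
  unfolding Lambda_topology_def
proof (rule seminorm_generated_seminorm_topology[OF vector_space_seq Lambda_subspace])
  show "seminorm_on seq_scale (Lambda_inf \<alpha>) p" if "p \<in> range (Lambda_norm \<alpha>)" for p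
    using that Lambda_norm_seminorm by blast
  fix p q assume "p \<in> range (Lambda_norm \<alpha>)" "q \<in> range (Lambda_norm \<alpha>)"
  then obtain i j where "p = Lambda_norm \<alpha> i" "q = Lambda_norm \<alpha> j" by blast
  then show "\<exists>r\<in>range (Lambda_norm \<alpha>). \<forall>x\<in>Lambda_inf \<alpha>. p x \<le> r x \<and> q x \<le> r x"
    using Lambda_norm_mono[OF assms] by (intro bexI[of _ "Lambda_norm \<alpha> (max i j)"]) auto
qed simp

lemma lin_on_trunc:
  assumes f: "lin_on seq_scale (*) (Lambda_inf \<alpha>) f" and \<xi>: "\<xi> \<in> Lambda_inf \<alpha>"
  shows "f (trunc n \<xi>) = (\<Sum>i<n. \<xi> i * f (unit_seq i))"
proof (induction n)
  case 0
  have "f (seq_scale 0 0) = 0 * f 0"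
    using f seqs.subspace_0[OF Lambda_subspace] unfolding lin_on_def by blast
  then show ?case
    unfolding trunc_0 by (simp only: seqs.scale_zero_left mult_zero_left lessThan_0 sum.empty)
next
  case (Suc n)
  have "f (trunc (Suc n) \<xi>) = f (trunc n \<xi>) + f (seq_scale (\<xi> n) (unit_seq n))"
    unfolding trunc_Suc using f trunc_Lambda[OF \<xi>] seqs.subspace_scale[OF Lambda_subspace unit_seq_Lambda]
    unfolding lin_on_def by blast
  also have "f (seq_scale (\<xi> n) (unit_seq n)) = \<xi> n * f (unit_seq n)"
    using f unit_seq_Lambda unfolding lin_on_def by blast
  finally show ?case by (simp add: Suc)
qed

text \<open>Compute the trace of the \<open>n\<close>-th coordinate projection from the nuclear representation.\<close>

lemma nuclear_Lambda_growth:
  assumes \<alpha>: "exponent_sequence \<alpha>" and nuc: "nuclear_space seq_scale (Lambda_topology \<alpha>)"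
  shows "\<exists>C>0. \<exists>m::nat. \<forall>n. real (Suc n) \<le> C * exp (real m * \<alpha> n)"
proof -
  let ?L = "Lambda_inf \<alpha>" and ?T = "Lambda_topology \<alpha>" and ?p = "Lambda_norm \<alpha> 0"
  note gen = Lambda_generated[OF \<alpha>]
  note ts = seminorm_generated_topspace[OF gen]
  have "continuous_seminorm seq_scale ?T ?p"
    using seminorm_generated_continuous_seminorm[OF vector_space_seq Lambda_subspace gen
        Lambda_norm_seminorm[of \<alpha> 0] rangeI Lambda_norm_seminorm[of \<alpha> 0], of 1] by simp
  then obtain q where q: "continuous_seminorm seq_scale ?T q" "nuclear_map_on seq_scale ?L q ?p"
    using nuc unfolding nuclear_space_def ts by blast
  obtain f y a where f: "\<And>k. lin_on seq_scale (*) ?L (f k)"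
    and a: "\<And>k. 0 \<le> a k" "\<And>k x. x \<in> ?L \<Longrightarrow> cmod (f k x) \<le> a k * q x"
    and y: "\<And>k::nat. y k \<in> ?L" and s: "summable (\<lambda>k. a k * ?p (y k))"
    and conv: "\<And>x. x \<in> ?L \<Longrightarrow> (\<lambda>n. ?p (x - (\<Sum>k<n. seq_scale (f k x) (y k)))) \<longlonglongrightarrow> 0"
    using q(2) unfolding nuclear_map_on_def by blast
  obtain m C where C: "C > 0" "\<And>x. x \<in> ?L \<Longrightarrow> q x \<le> C * Lambda_norm \<alpha> m x"
    using seminorm_generated_dominates[OF vector_space_seq Lambda_subspace gen _ q(1)] Lambda_norm_seminorm by blast
  define S where "S = (\<Sum>k. a k * ?p (y k))"
  have pn: "0 \<le> ?p x" if "x \<in> ?L" for x using seminorm_onD(1)[OF Lambda_norm_seminorm that] .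
  have "real (Suc n) \<le> (C * S) * exp (real m * \<alpha> n)" for n
  proof -
    have app: "(\<Sum>k<K. seq_scale (f k x) (y k)) i = (\<Sum>k<K. f k x * y k i)" for K x i
      by (induction K) (simp_all add: seq_scale_def)
    \<comment> \<open>The nuclear expansion of \<open>unit_seq i\<close> converges to it in
      \<open>?p\<close>, which bounds coordinates; the \<open>i\<close>-th coordinate of the
      expansion therefore tends to 1.\<close>
    have co: "(\<lambda>K. \<Sum>k<K. f k (unit_seq i) * y k i) \<longlonglongrightarrow> 1" for i
    proof -
      have "(\<lambda>K. 1 - (\<Sum>k<K. f k (unit_seq i) * y k i)) \<longlonglongrightarrow> 0"
      proof (rule Lim_null_comparison[OF _ conv[OF unit_seq_Lambda[of i]]], intro always_eventually allI)
        fix K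
        have "unit_seq i - (\<Sum>k<K. seq_scale (f k (unit_seq i)) (y k)) \<in> ?L"
          by (intro seqs.subspace_diff[OF Lambda_subspace] unit_seq_Lambda seqs.subspace_sum[OF Lambda_subspace]
              seqs.subspace_scale[OF Lambda_subspace] y)
        from Lambda_norm_coord[OF this, of i]
        show "norm (1 - (\<Sum>k<K. f k (unit_seq i) * y k i)) \<le> ?p (unit_seq i - (\<Sum>k<K. seq_scale (f k (unit_seq i)) (y k)))"
          by (simp add: app) (simp add: unit_seq_def)
      qed
      then show ?thesis using tendsto_diff[OF tendsto_const[of 1]] by fastforce
    qed
    \<comment> \<open>Adding these limits over the first \<open>Suc n\<close> indices gives the
      trace \<open>Suc n\<close>.\<close>
    have "(\<lambda>K. \<Sum>i<Suc n. \<Sum>k<K. f k (unit_seq i) * y k i) \<longlonglongrightarrow> (\<Sum>i<Suc n. 1)"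
      by (intro tendsto_sum co)
    then have "(\<lambda>K. norm (\<Sum>i<Suc n. \<Sum>k<K. f k (unit_seq i) * y k i)) \<longlonglongrightarrow> norm (\<Sum>i<Suc n. 1 :: complex)"
      by (rule tendsto_norm)
    moreover have "norm (\<Sum>i<Suc n. 1 :: complex) = real (Suc n)"
      by (simp only: sum_constant card_lessThan mult_1_right norm_of_nat)
    ultimately have lim: "(\<lambda>K. norm (\<Sum>i<Suc n. \<Sum>k<K. f k (unit_seq i) * y k i)) \<longlonglongrightarrow> real (Suc n)" by simp
    have le: "norm (\<Sum>i<Suc n. \<Sum>k<K. f k (unit_seq i) * y k i) \<le> (C * S) * exp (real m * \<alpha> n)" for K
    proof -
      have "norm (f k (trunc (Suc n) (y k))) \<le> C * exp (real m * \<alpha> n) * (a k * ?p (y k))" for k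
      proof -
        have "norm (f k (trunc (Suc n) (y k))) \<le> a k * q (trunc (Suc n) (y k))"
          by (rule a(2)[OF trunc_Lambda[OF y]])
        also have "\<dots> \<le> a k * (C * (exp (real m * \<alpha> n) * ?p (trunc (Suc n) (y k))))"
        proof (intro mult_left_mono a(1) order_trans[OF C(2)[OF trunc_Lambda[OF y]]])
          show "Lambda_norm \<alpha> m (trunc (Suc n) (y k)) \<le> exp (real m * \<alpha> n) * ?p (trunc (Suc n) (y k))"
            by (rule Lambda_norm_initial[OF \<alpha> trunc_Lambda[OF y]]) (simp add: trunc_def)
        qed (use C(1) in simp)
        also have "\<dots> \<le> a k * (C * (exp (real m * \<alpha> n) * ?p (y k)))"
          using C(1) by (intro mult_left_mono a(1) Lambda_norm_trunc[OF y]) auto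
        finally show ?thesis by (simp add: mult_ac)
      qed
      then have "(\<Sum>k<K. norm (f k (trunc (Suc n) (y k)))) \<le> (\<Sum>k<K. C * exp (real m * \<alpha> n) * (a k * ?p (y k)))"
        by (rule sum_mono)
      also have "\<dots> = C * exp (real m * \<alpha> n) * (\<Sum>k<K. a k * ?p (y k))" by (simp add: sum_distrib_left)
      also have "\<dots> \<le> C * exp (real m * \<alpha> n) * S"
        unfolding S_def using C(1) a(1) pn[OF y] by (intro mult_left_mono sum_le_suminf s) auto
      finally have 1: "(\<Sum>k<K. norm (f k (trunc (Suc n) (y k)))) \<le> C * exp (real m * \<alpha> n) * S" .
      \<comment> \<open>Summed first over \<open>i\<close>, the trace of one rank-one term is
        \<open>f k\<close> at the truncation of \<open>y k\<close>, to which the bound for initial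
        sections applies.\<close>
      have "(\<Sum>i<Suc n. \<Sum>k<K. f k (unit_seq i) * y k i) = (\<Sum>k<K. \<Sum>i<Suc n. y k i * f k (unit_seq i))"
        by (subst sum.swap) (simp add: mult.commute)
      also have "\<dots> = (\<Sum>k<K. f k (trunc (Suc n) (y k)))" by (simp only: lin_on_trunc[OF f y])
      finally show ?thesis using 1 norm_sum[of "\<lambda>k. f k (trunc (Suc n) (y k))" "{..<K}"] by (simp add: mult_ac)
    qed
    show ?thesis by (rule LIMSEQ_le_const2[OF lim]) (use le in blast)
  qed
  moreover have "(C * S) * exp (real m * \<alpha> n) \<le> (C * S + 1) * exp (real m * \<alpha> n)" for n
    by (intro mult_right_mono) auto
  ultimately have "real (Suc n) \<le> (C * S + 1) * exp (real m * \<alpha> n)" for n by (rule order_trans)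
  moreover have "0 \<le> S" unfolding S_def using a(1) pn[OF y] s by (intro suminf_nonneg) auto
  then have "0 < C * S + 1" using C(1) by (simp add: add_nonneg_pos)
  ultimately show ?thesis by blast
qed

section \<open>Extension to \<open>\<ell>\<^sub>2\<close>\<close>

lemma trunc_rapidly_decreasing: "trunc n \<xi> \<in> rapidly_decreasing"
  unfolding rapidly_decreasing_def trunc_def
  by (auto intro!: summable_finite[of "{..<n}"] split: if_splits)

lemma s_inner_unit_s_right: "s_inner \<xi> (unit_s i) = seq \<xi> i"
  using s_inner_commute[of \<xi> "unit_s i"] by (simp add: s_inner_unit_s)

text \<open>Coordinate \<open>i\<close> of \<open>op x \<xi>\<close> is the pairing of
  \<open>\<xi>\<close> with the adjoint at \<open>unit_s i\<close>, and this pairing makes sense on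
  all of \<open>ell2\<close>. So the extension is written down explicitly, and its bound follows by
  truncating the argument.\<close>

lemma extends_boundedI:
  assumes C: "0 \<le> C" "\<And>\<xi>. s_norm 0 (op x \<xi>) \<le> C * s_norm 0 \<xi>"
  shows "extends_bounded x"
proof -
  define X where "X \<xi> = (\<lambda>i. ell2_inner \<xi> (seq (op (Lstar_star x) (unit_s i))))" for \<xi>
  have Xs: "X (seq \<xi>) = seq (op x \<xi>)" for \<xi>
    by (simp add: X_def fun_eq_iff s_inner_def[symmetric] s_inner_op[symmetric] s_inner_unit_s_right)
  have bd: "summable (\<lambda>i. (cmod (X \<xi> i))\<^sup>2 * 1) \<and> weighted_norm (\<lambda>_. 1) (X \<xi>) \<le> C * ell2_norm \<xi>" if \<xi>: "\<xi> \<in> ell2" for \<xi>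
  proof -
    have s: "summable (\<lambda>j. (cmod (\<xi> j))\<^sup>2)" using \<xi> by (simp add: ell2_def)
    have nn: "0 \<le> C * ell2_norm \<xi>" using C(1) s by (simp add: ell2_norm_def suminf_nonneg)
    let ?t = "\<lambda>n. Abs_s (trunc n \<xi>)"
    have t: "seq (?t n) = trunc n \<xi>" for n by (simp add: Abs_s_inverse trunc_rapidly_decreasing)
    have tn: "s_norm 0 (?t n) \<le> ell2_norm \<xi>" for n
    proof -
      have "s_norm 0 (?t n) \<le> 1 * weighted_norm (\<lambda>_. 1) \<xi>"
        unfolding s_norm_eq t by (rule weighted_norm_compare(2)) (use s in \<open>auto simp: trunc_def\<close>)
      then show ?thesis by (simp add: weighted_norm_def ell2_norm_def)
    qed
    have lim: "(\<lambda>n. X (trunc n \<xi>) i) \<longlonglongrightarrow> X \<xi> i" for i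
    proof -
      let ?\<eta> = "seq (op (Lstar_star x) (unit_s i))"
      have "X (trunc n \<xi>) i = (\<Sum>j<n. \<xi> j * cnj (?\<eta> j))" for n
      proof -
        have "X (trunc n \<xi>) i = (\<Sum>j<n. trunc n \<xi> j * cnj (?\<eta> j))"
          unfolding X_def ell2_inner_def by (rule suminf_finite) (auto simp: trunc_def)
        then show ?thesis by (simp add: trunc_def)
      qed
      then show ?thesis
        using summable_LIMSEQ[OF summable_ell2_inner[OF \<xi> seq_ell2]] by (simp add: X_def ell2_inner_def)
    qed
    \<comment> \<open>On finitely many coordinates of the image the limit of the truncations can be
      taken; the bound is independent of \<open>m\<close>. The factor 1 is the constant weight of
      \<open>weighted_norm\<close>.\<close>
    have "(\<Sum>i<m. (cmod (X \<xi> i))\<^sup>2 * 1) \<le> (C * ell2_norm \<xi>)\<^sup>2" for m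
    proof (rule LIMSEQ_le_const2)
      show "(\<lambda>n. \<Sum>i<m. (cmod (X (trunc n \<xi>) i))\<^sup>2 * 1) \<longlonglongrightarrow> (\<Sum>i<m. (cmod (X \<xi> i))\<^sup>2 * 1)"
        by (intro tendsto_intros lim)
      have "(\<Sum>i<m. (cmod (X (trunc n \<xi>) i))\<^sup>2 * 1) \<le> (C * ell2_norm \<xi>)\<^sup>2" for n
      proof -
        have "(\<Sum>i<m. (cmod (seq (op x (?t n)) i))\<^sup>2 * s_weight 0 i) \<le> (s_norm 0 (op x (?t n)))\<^sup>2"
          unfolding s_norm_eq by (rule weighted_partial_sum_le[OF _ s_summable]) simp
        also have "\<dots> \<le> (C * ell2_norm \<xi>)\<^sup>2"
          using C(2)[of "?t n"] mult_left_mono[OF tn[of n] C(1)] s_norm_nonneg by (intro power_mono) auto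
        finally show ?thesis using Xs[of "?t n"] by (simp add: t)
      qed
      then show "\<exists>N. \<forall>n\<ge>N. (\<Sum>i<m. (cmod (X (trunc n \<xi>) i))\<^sup>2 * 1) \<le> (C * ell2_norm \<xi>)\<^sup>2" by blast
    qed
    then show ?thesis using weighted_norm_boundI[of "\<lambda>_. 1" "C * ell2_norm \<xi>" "X \<xi>"] nn by auto
  qed
  show ?thesis
    unfolding extends_bounded_def
  proof (intro exI[of _ X] conjI exI[of _ C] ballI allI Xs)
    show "X ` ell2 \<subseteq> ell2" using bd by (auto simp: ell2_def)
    show "ell2_norm (X \<xi>) \<le> C * ell2_norm \<xi>" if "\<xi> \<in> ell2" for \<xi>
      using bd[OF that] by (simp add: ell2_norm_def weighted_norm_def)
    show "lin_on seq_scale seq_scale ell2 X"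
      unfolding lin_on_def X_def ell2_inner_def
      by (auto simp: fun_eq_iff seq_scale_def distrib_right mult.assoc suminf_add[symmetric] suminf_mult
          summable_ell2_inner[OF _ seq_ell2])
  qed
qed

section \<open>Embedding a space with a frame into \<open>s\<close>\<close>

text \<open>An orthonormal system padded with zero vectors, whence the alternative in
  \<open>normalized\<close>. \<open>coeff_decay\<close> makes the coefficient map
  (\<open>frame_coeffs\<close>, the V of the overview) continuous into s;
  \<open>frame_growth\<close> makes the synthesis map (\<open>synth\<close>, its W) continuous on
  s.\<close>

locale s_frame = complete_seminorms sc p + scalar_product_space sc ip
  for sc :: "complex \<Rightarrow> 'v::ab_group_add \<Rightarrow> 'v" and p ip +
  fixes g :: "nat \<Rightarrow> 'v"
  assumes norm_bound: "\<exists>r C. \<forall>x. hilbert_norm ip x \<le> C * p r x"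
    and coeff_decay: "\<exists>r. \<exists>C\<ge>0. \<forall>x m. cmod (ip x (g m)) * real (Suc m) ^ q \<le> C * p r x"
    and frame_growth: "\<exists>r. \<exists>C\<ge>0. \<forall>m. p q (g m) \<le> C * real (Suc m) ^ r"
    and orthogonal: "m \<noteq> n \<Longrightarrow> ip (g m) (g n) = 0"
    and normalized: "g m = 0 \<or> ip (g m) (g m) = 1"
    and total: "(\<And>m. ip x (g m) = 0) \<Longrightarrow> x = 0"
begin

text \<open>Decay of order \<open>Suc q\<close> leaves a factor \<open>1 / real (Suc m) ^ 2\<close>
  in the weighted squares, which makes their sum converge.\<close>

lemma coeff_weighted:
  "\<exists>r. \<exists>C\<ge>0. \<forall>x. summable (\<lambda>m. (cmod (ip x (g m)))\<^sup>2 * s_weight q m) \<and>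
    weighted_norm (s_weight q) (\<lambda>m. ip x (g m)) \<le> C * p r x"
proof -
  obtain r C where C: "C \<ge> 0" "\<And>x m. cmod (ip x (g m)) * real (Suc m) ^ Suc q \<le> C * p r x"
    using coeff_decay[of "Suc q"] by blast
  define S where "S = (\<Sum>m. 1 / real (Suc m) ^ 2)"
  have S: "0 \<le> S" unfolding S_def using summable_inverse_Suc_square by (intro suminf_nonneg) auto
  have "summable (\<lambda>m. (cmod (ip x (g m)))\<^sup>2 * s_weight q m) \<and>
    weighted_norm (s_weight q) (\<lambda>m. ip x (g m)) \<le> C * sqrt S * p r x" for x
  proof -
    have "(\<Sum>m<n. (cmod (ip x (g m)))\<^sup>2 * s_weight q m) \<le> (C * sqrt S * p r x)\<^sup>2" for n
    proof -
      have "(cmod (ip x (g m)))\<^sup>2 * s_weight q m \<le> (C * p r x)\<^sup>2 * (1 / real (Suc m) ^ 2)" for m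
      proof -
        have "(cmod (ip x (g m)) * real (Suc m) ^ Suc q)\<^sup>2 \<le> (C * p r x)\<^sup>2"
          using C(2) by (rule power_mono) simp
        moreover have "(cmod (ip x (g m)) * real (Suc m) ^ Suc q)\<^sup>2 = (cmod (ip x (g m)))\<^sup>2 * s_weight q m * real (Suc m) ^ 2"
          unfolding power_mult_distrib power_mult[symmetric] power_Suc by (simp add: power_mult mult_ac)
        ultimately show ?thesis by (simp add: field_simps)
      qed
      then have "(\<Sum>m<n. (cmod (ip x (g m)))\<^sup>2 * s_weight q m) \<le> (\<Sum>m<n. (C * p r x)\<^sup>2 * (1 / real (Suc m) ^ 2))"
        by (rule sum_mono)
      also have "\<dots> = (C * p r x)\<^sup>2 * (\<Sum>m<n. 1 / real (Suc m) ^ 2)" by (simp only: sum_distrib_left)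
      also have "\<dots> \<le> (C * p r x)\<^sup>2 * S"
        unfolding S_def by (intro mult_left_mono sum_le_suminf summable_inverse_Suc_square) auto
      finally show ?thesis using S by (simp add: power_mult_distrib mult_ac)
    qed
    moreover have "0 \<le> C * sqrt S * p r x" using C(1) S pD(1) by simp
    ultimately show ?thesis using weighted_norm_boundI[of "s_weight q" "C * sqrt S * p r x" "\<lambda>m. ip x (g m)"] by simp
  qed
  moreover have "0 \<le> C * sqrt S" using C(1) S by simp
  ultimately show ?thesis by blast
qed

definition frame_coeffs :: "'v \<Rightarrow> s_space"
  where "frame_coeffs x = Abs_s (\<lambda>m. ip x (g m))"

lemma seq_coeffs: "seq (frame_coeffs x) = (\<lambda>m. ip x (g m))"
  unfolding frame_coeffs_def
proof (rule Abs_s_inverse)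
  show "(\<lambda>m. ip x (g m)) \<in> rapidly_decreasing"
    unfolding rapidly_decreasing_def using coeff_weighted by (intro CollectI allI) blast
qed

lemma coeffs_continuous: "\<exists>r. \<exists>C\<ge>0. \<forall>x. s_norm q (frame_coeffs x) \<le> C * p r x"
  unfolding s_norm_eq seq_coeffs using coeff_weighted[of q] by blast

lemma coeffs_linear: "frame_coeffs (x + y) = frame_coeffs x + frame_coeffs y" "frame_coeffs (sc c x) = s_scale c (frame_coeffs x)"
  by (simp_all add: seq_inject[symmetric] seq_coeffs seq_add seq_s_scale seq_scale_def ip_add_left ip_scale_left fun_eq_iff)

text \<open>Two orders beyond the growth of the frame make the synthesis series converge absolutely
  in every seminorm.\<close>

lemma synthesis_bound:
  "\<exists>r. \<exists>C\<ge>0. \<forall>\<eta>. summable (\<lambda>m. cmod (seq \<eta> m) * p q (g m)) \<and>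
    (\<Sum>m. cmod (seq \<eta> m) * p q (g m)) \<le> C * s_norm r \<eta>"
proof -
  obtain r C where C: "C \<ge> 0" "\<And>m. p q (g m) \<le> C * real (Suc m) ^ r" using frame_growth by blast
  have sS: "summable (\<lambda>m. 1 / real (Suc m) ^ 2)" by (rule summable_inverse_Suc_square)
  have "summable (\<lambda>m. cmod (seq \<eta> m) * p q (g m)) \<and>
    (\<Sum>m. cmod (seq \<eta> m) * p q (g m)) \<le> C * (\<Sum>m. 1 / real (Suc m) ^ 2) * s_norm (r + 2) \<eta>" for \<eta>
  proof -
    have le: "cmod (seq \<eta> m) * p q (g m) \<le> (C * s_norm (r + 2) \<eta>) * (1 / real (Suc m) ^ 2)" for m
    proof -
      have "cmod (seq \<eta> m) * p q (g m) \<le> cmod (seq \<eta> m) * (C * real (Suc m) ^ r)"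
        by (intro mult_left_mono C(2)) simp
      also have "\<dots> = C * (cmod (seq \<eta> m) * real (Suc m) ^ (r + 2)) * (1 / real (Suc m) ^ 2)"
        by (simp only: power_add) (simp add: mult_ac)
      also have "\<dots> \<le> (C * s_norm (r + 2) \<eta>) * (1 / real (Suc m) ^ 2)"
        by (intro mult_right_mono mult_left_mono C(1) s_norm_coord) simp
      finally show ?thesis .
    qed
    have s: "summable (\<lambda>m. cmod (seq \<eta> m) * p q (g m))"
      by (rule summable_comparison_test[OF _ summable_mult[OF sS]]) (use le pD(1) in auto)
    have "(\<Sum>m. cmod (seq \<eta> m) * p q (g m)) \<le> (\<Sum>m. (C * s_norm (r + 2) \<eta>) * (1 / real (Suc m) ^ 2))"
      by (rule suminf_le[OF le s summable_mult[OF sS]])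
    also have "\<dots> = (C * s_norm (r + 2) \<eta>) * (\<Sum>m. 1 / real (Suc m) ^ 2)" by (rule suminf_mult[OF sS])
    finally show ?thesis using s by (simp add: mult_ac)
  qed
  moreover have "0 \<le> C * (\<Sum>m. 1 / real (Suc m) ^ 2)" using C(1) sS by (intro mult_nonneg_nonneg suminf_nonneg) auto
  ultimately show ?thesis by blast
qed

lemma synthesis_converges: "\<exists>l. \<forall>q. (\<lambda>n. p q ((\<Sum>m<n. sc (seq \<eta> m) (g m)) - l)) \<longlonglongrightarrow> 0"
proof (rule Cauchy_converges)
  fix q :: nat and \<epsilon> :: real assume e: "0 < \<epsilon>"
  let ?\<sigma> = "\<lambda>n. \<Sum>m<n. sc (seq \<eta> m) (g m)"
  have "summable (\<lambda>m. cmod (seq \<eta> m) * p q (g m))" using synthesis_bound[of q] by blast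
  then obtain N where N: "\<And>m n. m \<ge> N \<Longrightarrow> norm (\<Sum>i\<in>{m..<n}. cmod (seq \<eta> i) * p q (g i)) < \<epsilon>"
    using e unfolding summable_Cauchy by blast
  have le: "p q (?\<sigma> n - ?\<sigma> m) < \<epsilon>" if "N \<le> m" "m \<le> n" for m n
  proof -
    have "?\<sigma> n - ?\<sigma> m = (\<Sum>i\<in>{m..<n}. sc (seq \<eta> i) (g i))"
      using that(2) by (simp add: sum_diff_nat_ivl lessThan_atLeast0)
    then have "p q (?\<sigma> n - ?\<sigma> m) \<le> (\<Sum>i\<in>{m..<n}. p q (sc (seq \<eta> i) (g i)))"
      using seminorm_sum_le[OF seminorm] by simp
    also have "\<dots> \<le> norm (\<Sum>i\<in>{m..<n}. cmod (seq \<eta> i) * p q (g i))" by (simp add: pD(3))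
    also have "\<dots> < \<epsilon>" using N that by blast
    finally show ?thesis .
  qed
  have "p q (?\<sigma> m - ?\<sigma> n) < \<epsilon>" if "m \<ge> N" "n \<ge> N" for m n
    using le[of m n] le[of n m] that p_minus_commute[of q "?\<sigma> m" "?\<sigma> n"] by (cases "m \<le> n") auto
  then show "\<exists>N. \<forall>m\<ge>N. \<forall>n\<ge>N. p q (?\<sigma> m - ?\<sigma> n) < \<epsilon>" by blast
qed

text \<open>The completeness assumption provides a limit without uniqueness, hence the choice;
  \<open>ip_synth\<close> shows that the scalar product determines the value.\<close>

definition synth :: "s_space \<Rightarrow> 'v"
  where "synth \<eta> = (SOME l. \<forall>q. (\<lambda>n. p q ((\<Sum>m<n. sc (seq \<eta> m) (g m)) - l)) \<longlonglongrightarrow> 0)"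

lemma synth_limit: "(\<lambda>n. p q ((\<Sum>m<n. sc (seq \<eta> m) (g m)) - synth \<eta>)) \<longlonglongrightarrow> 0"
  using someI_ex[OF synthesis_converges] unfolding synth_def by blast

lemma synth_continuous: "\<exists>r. \<exists>C\<ge>0. \<forall>\<eta>. p q (synth \<eta>) \<le> C * s_norm r \<eta>"
proof -
  obtain r C where C: "C \<ge> 0" "\<And>\<eta>. summable (\<lambda>m. cmod (seq \<eta> m) * p q (g m))"
    "\<And>\<eta>. (\<Sum>m. cmod (seq \<eta> m) * p q (g m)) \<le> C * s_norm r \<eta>" using synthesis_bound[of q] by auto
  have "p q (synth \<eta>) \<le> C * s_norm r \<eta>" for \<eta>
  proof (rule LIMSEQ_le_const)
    let ?\<sigma> = "\<lambda>n. \<Sum>m<n. sc (seq \<eta> m) (g m)"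
    show "(\<lambda>n. p q (?\<sigma> n - synth \<eta>) + C * s_norm r \<eta>) \<longlonglongrightarrow> C * s_norm r \<eta>"
      using tendsto_add[OF synth_limit tendsto_const] by fastforce
    have "p q (synth \<eta>) \<le> p q (?\<sigma> n - synth \<eta>) + C * s_norm r \<eta>" for n
    proof -
      have "p q (synth \<eta>) \<le> p q (synth \<eta> - ?\<sigma> n) + p q (?\<sigma> n)" using pD(2)[of q "synth \<eta> - ?\<sigma> n" "?\<sigma> n"] by simp
      moreover have "p q (?\<sigma> n) \<le> (\<Sum>m<n. cmod (seq \<eta> m) * p q (g m))"
        using seminorm_sum_le[OF seminorm, of q "\<lambda>m. sc (seq \<eta> m) (g m)" "{..<n}"] by (simp add: pD(3))
      moreover have "\<dots> \<le> (\<Sum>m. cmod (seq \<eta> m) * p q (g m))"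
        by (rule sum_le_suminf[OF C(2)]) (simp_all add: pD(1))
      ultimately show ?thesis using C(3)[of \<eta>] p_minus_commute[of q "synth \<eta>" "?\<sigma> n"] by linarith
    qed
    then show "\<exists>N. \<forall>n\<ge>N. p q (synth \<eta>) \<le> p q (?\<sigma> n - synth \<eta>) + C * s_norm r \<eta>" by blast
  qed
  then show ?thesis using C(1) by blast
qed

lemma ip_limit:
  assumes "\<And>q. (\<lambda>n. p q (\<sigma> n - l)) \<longlonglongrightarrow> 0"
  shows "(\<lambda>n. ip x (\<sigma> n)) \<longlonglongrightarrow> ip x l"
proof -
  obtain r C where C: "\<And>x. hilbert_norm ip x \<le> C * p r x" using norm_bound by blast
  have "(\<lambda>n. ip x (\<sigma> n) - ip x l) \<longlonglongrightarrow> 0"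
  proof (rule Lim_null_comparison, intro always_eventually allI)
    show "(\<lambda>n. hilbert_norm ip x * (C * p r (\<sigma> n - l))) \<longlonglongrightarrow> 0"
      using tendsto_mult[OF tendsto_const[of "hilbert_norm ip x"] tendsto_mult[OF tendsto_const[of C] assms[of r]]] by simp
    show "norm (ip x (\<sigma> n) - ip x l) \<le> hilbert_norm ip x * (C * p r (\<sigma> n - l))" for n
      using Cauchy_Schwarz[of x "\<sigma> n - l"] mult_left_mono[OF C[of "\<sigma> n - l"] hilbert_norm_nonneg[of x]]
      by (simp add: ip_diff_right)
  qed
  then show ?thesis by (simp add: LIM_zero_iff)
qed

text \<open>\<open>synth\<close> is the adjoint of \<open>frame_coeffs\<close>. Linearity of
  \<open>synth\<close> and the inversion formula are read off from this identity, by testing with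
  scalar products, rather than from the defining limit.\<close>

lemma ip_synth: "ip x (synth \<eta>) = s_inner (frame_coeffs x) \<eta>"
proof -
  have "(\<lambda>n. ip x (\<Sum>m<n. sc (seq \<eta> m) (g m))) \<longlonglongrightarrow> ip x (synth \<eta>)"
    by (rule ip_limit[OF synth_limit])
  moreover have "(\<lambda>n. \<Sum>m<n. seq (frame_coeffs x) m * cnj (seq \<eta> m)) \<longlonglongrightarrow> s_inner (frame_coeffs x) \<eta>"
    unfolding s_inner_def ell2_inner_def by (rule summable_LIMSEQ[OF summable_ell2_inner[OF seq_ell2 seq_ell2]])
  moreover have "ip x (\<Sum>m<n. sc (seq \<eta> m) (g m)) = (\<Sum>m<n. seq (frame_coeffs x) m * cnj (seq \<eta> m))" for n
    by (simp add: ip_sum_right ip_scale_right seq_coeffs mult.commute)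
  ultimately show ?thesis using LIMSEQ_unique by fastforce
qed

lemma eq_if_ip_eq: "(\<And>x. ip x y = ip x z) \<Longrightarrow> y = z"
proof (rule ccontr)
  assume eq: "\<And>x. ip x y = ip x z" and "y \<noteq> z"
  then have "0 < Re (ip (y - z) (y - z))" by (intro ip_pos) simp
  then show False by (simp add: ip_diff_right eq)
qed

lemma synth_linear: "synth (\<xi> + \<eta>) = synth \<xi> + synth \<eta>" "synth (s_scale c \<xi>) = sc c (synth \<xi>)"
  by (rule eq_if_ip_eq, simp add: ip_synth ip_add_right ip_scale_right s_inner_add_right s_inner_scale_right)+

text \<open>Parseval in weak form: paired with \<open>g k\<close>, the coefficient series reduces to
  its \<open>k\<close>-th term, and \<open>total\<close> concludes. If \<open>g k\<close> is a
  padding zero, both sides vanish.\<close>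

lemma synth_coeffs: "synth (frame_coeffs x) = x"
proof -
  have "synth (frame_coeffs x) - x = 0"
  proof (rule total)
    fix k
    have "s_inner (frame_coeffs (g k)) (frame_coeffs x) = (\<Sum>m. ip (g k) (g m) * cnj (ip x (g m)))"
      by (simp add: s_inner_def ell2_inner_def seq_coeffs)
    also have "\<dots> = (\<Sum>m\<in>{k}. ip (g k) (g m) * cnj (ip x (g m)))"
      by (rule suminf_finite) (auto simp: orthogonal)
    also have "\<dots> = cnj (ip x (g k))" using normalized[of k] by auto
    finally have "ip (g k) (synth (frame_coeffs x)) = ip (g k) x" by (simp add: ip_synth ip_cnj[of x "g k"])
    then show "ip (synth (frame_coeffs x) - x) (g k) = 0"
      using ip_cnj[of "g k" "synth (frame_coeffs x)"] ip_cnj[of "g k" x] by (simp add: ip_diff_left)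
  qed
  then show ?thesis by simp
qed

lemma s_inner_coeffs: "s_inner (frame_coeffs x) (frame_coeffs y) = ip x y"
  by (simp add: ip_synth[symmetric] synth_coeffs)

lemma s_norm_coeffs: "s_norm 0 (frame_coeffs x) = hilbert_norm ip x"
proof -
  have "(s_norm 0 (frame_coeffs x))\<^sup>2 = (hilbert_norm ip x)\<^sup>2"
    using arg_cong[OF s_inner_coeffs[of x x], of Re] by (simp add: s_inner_self hilbert_norm_sq)
  then show ?thesis using s_norm_nonneg hilbert_norm_nonneg by (simp add: power2_eq_iff_nonneg)
qed

text \<open>The adjoint of an isometry is a contraction: the squared norm is a pairing with
  \<open>\<eta>\<close>, and Cauchy-Schwarz returns the norm itself as a factor to cancel.\<close>

lemma hilbert_norm_synth: "hilbert_norm ip (synth \<eta>) \<le> s_norm 0 \<eta>"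
proof -
  have "(hilbert_norm ip (synth \<eta>))\<^sup>2 = Re (s_inner (frame_coeffs (synth \<eta>)) \<eta>)"
    by (simp add: hilbert_norm_sq ip_synth)
  also have "\<dots> \<le> hilbert_norm ip (synth \<eta>) * s_norm 0 \<eta>"
    using complex_Re_le_cmod s_inner_bound[of "frame_coeffs (synth \<eta>)" \<eta>] unfolding s_norm_coeffs by (rule order_trans)
  finally show ?thesis using hilbert_norm_nonneg[of "synth \<eta>"] s_norm_nonneg[of 0 \<eta>]
    by (cases "hilbert_norm ip (synth \<eta>) = 0") (auto simp: power2_eq_square)
qed

end

section \<open>The left regular representation\<close>

locale framed_algebra = frechet_star_algebra sc star T + s_frame sc p ip g
  for sc :: "complex \<Rightarrow> 'a::ring \<Rightarrow> 'a" and star T p ip g +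
  fixes e :: 'a
  assumes gen: "seminorm_generated UNIV (range p) T"
    and unit: "e * x = x" "x * e = x"
    and adjoint: "ip (x * y) z = ip y (star x * z)"
begin

lemma continuous_linear_bound:
  assumes f: "continuous_map T T f" and lin: "\<And>x y. f (x + y) = f x + f y" "\<And>c x. f (sc c x) = sc c (f x)"
  shows "\<exists>r. \<exists>C>0. \<forall>x. p q (f x) \<le> C * p r x"
proof -
  have cs: "continuous_seminorm sc T (p q)"
    using seminorm_generated_continuous_seminorm[OF vector_space_axioms subspace_UNIV gen seminorm[of q] rangeI seminorm[of q], of 1] by simp
  have "continuous_seminorm sc T (p q \<circ> f)"
    unfolding continuous_seminorm_def
  proof
    show "continuous_map T euclideanreal (p q \<circ> f)"
      using cs f by (auto simp: continuous_seminorm_def intro: continuous_map_compose)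
    show "seminorm_on sc (topspace T) (p q \<circ> f)"
      using pD by (simp add: seminorm_on_def topspace_UNIV lin)
  qed
  from seminorm_generated_dominates[OF vector_space_axioms subspace_UNIV gen _ this] seminorm
  show ?thesis by auto
qed

text \<open>For each \<open>\<xi>\<close> right multiplication by \<open>synth \<xi>\<close> is
  continuous, and for each \<open>x\<close> left multiplication is bounded on the image of
  \<open>B\<close>. Uniformity over \<open>B\<close> then comes from
  \<open>uniform_bound\<close>.\<close>

lemma mult_bounded_set:
  assumes B: "s_bounded B"
  shows "\<exists>r. \<exists>C\<ge>0. \<forall>x. \<forall>\<xi>\<in>B. p q (x * synth \<xi>) \<le> C * p r x"
proof -
  have "\<exists>k r. \<exists>C>0. \<forall>x. \<forall>\<xi>\<in>B. p q (x * synth \<xi>) \<le> C * p r x * real k"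
  proof (rule uniform_bound)
    fix \<xi> assume "\<xi> \<in> B"
    show "seminorm_on sc UNIV (\<lambda>x. p q (x * synth \<xi>))"
      using pD by (simp add: seminorm_on_def distrib_right scale_mult_left)
    show "\<exists>r C. \<forall>x. p q (x * synth \<xi>) \<le> C * p r x"
      using continuous_linear_bound[OF continuous_mult_right, of "synth \<xi>" q]
      by (auto simp: distrib_right scale_mult_left)
  next
    fix x
    obtain r C where C: "C > 0" "\<And>y. p q (x * y) \<le> C * p r y"
      using continuous_linear_bound[OF continuous_mult_left, of x q] by (auto simp: distrib_left scale_mult_right)
    obtain r' C' where C': "C' \<ge> 0" "\<And>\<eta>. p r (synth \<eta>) \<le> C' * s_norm r' \<eta>" using synth_continuous[of r] by auto
    obtain M where M: "\<And>\<xi>. \<xi> \<in> B \<Longrightarrow> s_norm r' \<xi> \<le> M"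
      using B unfolding s_bounded_def bdd_above_def by (meson image_eqI)
    obtain k :: nat where k: "C * (C' * M) \<le> real k" using real_arch_simple by blast
    have "p q (x * synth \<xi>) \<le> real k" if "\<xi> \<in> B" for \<xi>
    proof -
      have "p q (x * synth \<xi>) \<le> C * p r (synth \<xi>)" by (rule C)
      also have "\<dots> \<le> C * (C' * M)"
        using C(1) C'(1) M[OF that] by (intro mult_left_mono order_trans[OF C'(2)]) auto
      finally show ?thesis using k by simp
    qed
    then show "\<exists>k. \<forall>\<xi>\<in>B. p q (x * synth \<xi>) \<le> real k" by blast
  qed
  then obtain k r C where C: "C > 0" "\<And>x \<xi>. \<xi> \<in> B \<Longrightarrow> p q (x * synth \<xi>) \<le> C * p r x * real k" by blast
  then show ?thesis by (intro exI[of _ r] exI[of _ "C * real k"]) (auto simp: mult_ac)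
qed

text \<open>The adjoint is exhibited: \<open>frame_coeffs\<close> and \<open>synth\<close> are
  adjoint to each other, and \<open>adjoint\<close> moves \<open>x\<close> to
  \<open>star x\<close>.\<close>

lemma regular_carrier:
  shows "(\<lambda>\<xi>. frame_coeffs (x * synth \<xi>)) \<in> Lstar_carrier"
    and "adj_s (\<lambda>\<xi>. frame_coeffs (x * synth \<xi>)) = (\<lambda>\<xi>. frame_coeffs (star x * synth \<xi>))"
proof -
  have l: "lin_on s_scale s_scale UNIV (\<lambda>\<xi>. frame_coeffs (x * synth \<xi>))"
    by (simp add: lin_on_def synth_linear distrib_left scale_mult_right coeffs_linear)
  have a: "s_inner (frame_coeffs (x * synth \<xi>)) \<eta> = s_inner \<xi> (frame_coeffs (star x * synth \<eta>))" for \<xi> \<eta>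
  proof -
    have "s_inner (frame_coeffs (x * synth \<xi>)) \<eta> = ip (synth \<xi>) (star x * synth \<eta>)"
      by (simp add: ip_synth[symmetric] adjoint)
    also have "\<dots> = cnj (ip (star x * synth \<eta>) (synth \<xi>))" by (rule ip_cnj)
    also have "\<dots> = s_inner \<xi> (frame_coeffs (star x * synth \<eta>))"
      unfolding ip_synth by (rule s_inner_commute[symmetric])
    finally show ?thesis .
  qed
  show "(\<lambda>\<xi>. frame_coeffs (x * synth \<xi>)) \<in> Lstar_carrier"
    "adj_s (\<lambda>\<xi>. frame_coeffs (x * synth \<xi>)) = (\<lambda>\<xi>. frame_coeffs (star x * synth \<xi>))"
    using Lstar_carrierI[OF l a] by auto
qed

definition regular :: "'a \<Rightarrow> Lstar"
  where "regular x = Abs_Lstar (\<lambda>\<xi>. frame_coeffs (x * synth \<xi>))"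

lemma op_regular: "op (regular x) = (\<lambda>\<xi>. frame_coeffs (x * synth \<xi>))"
  by (simp add: regular_def Abs_Lstar_inverse regular_carrier)

lemma regular_star: "regular (star x) = Lstar_star (regular x)"
  by (simp add: op_inject[symmetric] op_star op_regular regular_carrier)

text \<open>Between the two operators \<open>synth\<close> meets \<open>frame_coeffs\<close> and
  cancels it.\<close>

lemma regular_mult: "regular (x * y) = regular x * regular y"
  by (simp add: op_inject[symmetric] op_mult op_regular synth_coeffs mult.assoc fun_eq_iff)

lemma regular_linear: "regular (x + y) = regular x + regular y" "regular (sc c x) = Lstar_scale c (regular x)"
  by (simp_all add: op_inject[symmetric] op_add op_scale op_regular distrib_right scale_mult_left coeffs_linear)

lemma regular_diff: "regular (x - y) = regular x - regular y"
  using regular_linear(1)[of "x - y" y] by (simp add: algebra_simps)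

definition evaluate :: "Lstar \<Rightarrow> 'a"
  where "evaluate t = synth (op t (frame_coeffs e))"

lemma evaluate_regular: "evaluate (regular x) = x"
  by (simp add: evaluate_def op_regular synth_coeffs unit)

lemma evaluate_linear: "evaluate (t + u) = evaluate t + evaluate u" "evaluate (Lstar_scale c t) = sc c (evaluate t)"
  by (simp_all add: evaluate_def op_add op_scale synth_linear)

lemma evaluate_diff: "evaluate (t - u) = evaluate t - evaluate u"
  using evaluate_linear(1)[of "t - u" u] by (simp add: algebra_simps)

lemma regular_continuous: "continuous_map T tau_star regular"
proof (rule seminorm_generated_continuous_map[OF gen tau_star_generated])
  fix u assume "u \<in> {Lstar_seminorm N B | N B. s_bounded B \<and> B \<noteq> {}}"
  then obtain N B where u: "u = Lstar_seminorm N B" and B: "s_bounded B" "B \<noteq> {}" by blast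
  obtain q C where C: "C \<ge> 0" "\<And>x. s_norm N (frame_coeffs x) \<le> C * p q x" using coeffs_continuous[of N] by auto
  obtain r D where D: "D \<ge> 0" "\<And>x \<xi>. \<xi> \<in> B \<Longrightarrow> p q (x * synth \<xi>) \<le> D * p r x" using mult_bounded_set[OF B(1), of q] by auto
  \<comment> \<open>The second entry of the maximum in \<open>Lstar_seminorm\<close> is the operator
    of \<open>star x\<close>, so continuity of the involution is brought in as a seminorm bound. The
    later factor \<open>1 + D'\<close> and index \<open>max r r'\<close> cover both entries.\<close>
  obtain r' D' where D': "D' > 0" "\<And>x. p r (star x) \<le> D' * p r' x"
  proof -
    have "seminorm_on sc UNIV (\<lambda>x. p r (star x))"
      using pD by (simp add: seminorm_on_def star_add star_scale)
    moreover have "continuous_seminorm sc T (p r)"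
      using seminorm_generated_continuous_seminorm[OF vector_space_axioms subspace_UNIV gen seminorm[of r] rangeI seminorm[of r], of 1] by simp
    then have "continuous_map T euclideanreal (p r \<circ> star)"
      using continuous_star by (auto simp: continuous_seminorm_def intro: continuous_map_compose)
    ultimately have "continuous_seminorm sc T (\<lambda>x. p r (star x))"
      by (simp add: continuous_seminorm_def topspace_UNIV o_def)
    from seminorm_generated_dominates[OF vector_space_axioms subspace_UNIV gen _ this] seminorm that
    show ?thesis by auto
  qed
  have est: "s_norm N (op (regular x) \<xi>) \<le> C * D * p r x" if "\<xi> \<in> B" for x \<xi>
  proof -
    have "s_norm N (op (regular x) \<xi>) \<le> C * p q (x * synth \<xi>)" unfolding op_regular by (rule C)
    also have "\<dots> \<le> C * (D * p r x)" by (intro mult_left_mono D(2)[OF that] C(1))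
    finally show ?thesis by (simp add: mult.assoc)
  qed
  have "u (regular x) \<le> (C * D * (1 + D')) * p (max r r') x" for x
    unfolding u
  proof (rule Lstar_seminorm_least[OF B(2)])
    have CD: "0 \<le> C * D" using C(1) D(1) by simp
    have r: "p r x \<le> p (max r r') x" "p r' x \<le> p (max r r') x" by (simp_all add: p_mono)
    fix \<xi> assume xi: "\<xi> \<in> B"
    have "s_norm N (op (regular x) \<xi>) \<le> C * D * (1 * p r x)" using est[OF xi] by simp
    also have "\<dots> \<le> C * D * ((1 + D') * p (max r r') x)"
      using CD D'(1) r(1) pD(1) by (intro mult_left_mono mult_mono) auto
    finally show "s_norm N (op (regular x) \<xi>) \<le> (C * D * (1 + D')) * p (max r r') x" by (simp add: mult.assoc)
    have "s_norm N (op (Lstar_star (regular x)) \<xi>) \<le> C * D * p r (star x)"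
      using est[OF xi, of "star x"] by (simp add: regular_star)
    also have "\<dots> \<le> C * D * (D' * p r' x)" by (intro mult_left_mono D'(2) CD)
    also have "\<dots> \<le> C * D * ((1 + D') * p (max r r') x)"
      using CD D'(1) r(2) pD(1) by (intro mult_left_mono mult_mono) auto
    finally show "s_norm N (op (Lstar_star (regular x)) \<xi>) \<le> (C * D * (1 + D')) * p (max r r') x" by (simp add: mult.assoc)
  qed
  then show "\<exists>v\<in>range p. \<exists>C. \<forall>x\<in>UNIV. u (regular x) \<le> C * v x" by blast
qed (auto simp: regular_diff pD(1))

lemma evaluate_continuous: "continuous_map tau_star T evaluate"
proof (rule seminorm_generated_continuous_map[OF tau_star_generated gen])
  fix u assume "u \<in> range p"
  then obtain q where u: "u = p q" by blast
  obtain r C where C: "C \<ge> 0" "\<And>\<eta>. p q (synth \<eta>) \<le> C * s_norm r \<eta>" using synth_continuous[of q] by auto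
  have "u (evaluate t) \<le> C * Lstar_seminorm r {frame_coeffs e} t" for t
    unfolding u evaluate_def
    by (rule order_trans[OF C(2) mult_left_mono[OF Lstar_seminorm_upper(1)[OF s_bounded_singleton] C(1)]]) simp
  then have "\<forall>t\<in>UNIV. u (evaluate t) \<le> C * Lstar_seminorm r {frame_coeffs e} t" by blast
  moreover have "Lstar_seminorm r {frame_coeffs e} \<in> {Lstar_seminorm N B | N B. s_bounded B \<and> B \<noteq> {}}"
    using s_bounded_singleton by blast
  ultimately show "\<exists>v\<in>{Lstar_seminorm N B | N B. s_bounded B \<and> B \<noteq> {}}. \<exists>C. \<forall>t\<in>UNIV. u (evaluate t) \<le> C * v t" by blast
next
  fix v t assume "v \<in> {Lstar_seminorm N B | N B. s_bounded B \<and> B \<noteq> {}}"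
  then show "0 \<le> v t" using Lstar_seminorm_nonneg by blast
qed (auto simp: evaluate_diff)

lemma star_subalgebra_regular: "star_subalgebra (range regular)"
proof -
  have "0 = regular 0" using regular_diff[of 0 0] by simp
  then show ?thesis
    unfolding star_subalgebra_def
    by (auto simp: regular_linear[symmetric] regular_mult[symmetric] regular_star[symmetric])
qed

lemma complemented_regular: "complemented (range regular)"
  unfolding complemented_def
proof (intro exI[of _ "regular \<circ> evaluate"] conjI allI)
  show "lin_on Lstar_scale Lstar_scale UNIV (regular \<circ> evaluate)"
    by (simp add: lin_on_def evaluate_linear regular_linear)
  show "continuous_map tau_star tau_star (regular \<circ> evaluate)"
    by (rule continuous_map_compose[OF evaluate_continuous regular_continuous])
  show "(regular \<circ> evaluate) ((regular \<circ> evaluate) t) = (regular \<circ> evaluate) t" for t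
    by (simp add: evaluate_regular)
  show "range (regular \<circ> evaluate) = range regular"
    using evaluate_regular by (auto simp: image_iff) (metis evaluate_regular)
qed

lemma star_isomorphic_regular: "star_isomorphic_to sc star T (range regular)"
  unfolding star_isomorphic_to_def
proof (intro exI[of _ regular] conjI allI regular_mult regular_star)
  show "lin_on sc Lstar_scale UNIV regular" by (simp add: lin_on_def regular_linear)
  have "homeomorphic_maps T (subtopology tau_star (range regular)) regular evaluate"
    unfolding homeomorphic_maps_def
    using regular_continuous evaluate_continuous
    by (auto simp: continuous_map_in_subtopology evaluate_regular intro: continuous_map_from_subtopology)
  then show "homeomorphic_map T (subtopology tau_star (range regular)) regular"
    using homeomorphic_maps_map by blast
qed

text \<open>\<open>frame_coeffs\<close> is isometric and \<open>synth\<close> is a contraction for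
  the norms of order 0, so the constant of (\<beta>) is an operator bound.\<close>

lemma bounded_operators_regular:
  assumes "\<And>x. \<exists>C>0. \<forall>y. hilbert_norm ip (x * y) \<le> C * hilbert_norm ip y"
  shows "bounded_operators (range regular)"
  unfolding bounded_operators_def
proof
  fix t assume "t \<in> range regular"
  then obtain x where t: "t = regular x" by blast
  obtain C where C: "C > 0" "\<And>y. hilbert_norm ip (x * y) \<le> C * hilbert_norm ip y" using assms by blast
  show "extends_bounded t"
  proof (rule extends_boundedI)
    show "0 \<le> C" using C(1) by simp
    show "s_norm 0 (op t \<xi>) \<le> C * s_norm 0 \<xi>" for \<xi>
      unfolding t op_regular s_norm_coeffs
      using C(1) by (intro order_trans[OF C(2)] mult_left_mono hilbert_norm_synth) auto
  qed
qed

end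

section \<open>Orthonormalization in a nuclear power series space\<close>

locale dominated_power_series_space = frechet_space sc T + scalar_product_space sc ip
  for sc :: "complex \<Rightarrow> 'v::ab_group_add \<Rightarrow> 'v" and T and ip +
  fixes \<phi> :: "'v \<Rightarrow> nat \<Rightarrow> complex" and \<alpha> :: "nat \<Rightarrow> real"
  assumes exponent: "exponent_sequence \<alpha>"
    and nuclear: "nuclear_space seq_scale (Lambda_topology \<alpha>)"
    and lin: "lin_on sc seq_scale UNIV \<phi>"
    and homeo: "homeomorphic_map T (Lambda_topology \<alpha>) \<phi>"
    and dominating: "dominating_norm sc T (hilbert_norm ip)"
begin

lemma coord_add: "\<phi> (x + y) = \<phi> x + \<phi> y" and coord_scale: "\<phi> (sc c x) = seq_scale c (\<phi> x)"
  using lin by (auto simp: lin_on_def)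

lemma coord_diff: "\<phi> (x - y) = \<phi> x - \<phi> y"
  using coord_add[of "x - y" y] by (simp add: algebra_simps)

lemma coord_zero: "\<phi> 0 = 0"
  using coord_diff[of 0 0] by simp

lemma topspace_Lambda: "topspace (Lambda_topology \<alpha>) = Lambda_inf \<alpha>"
  by (rule seminorm_generated_topspace[OF Lambda_generated[OF exponent]])

lemma coord_range: "range \<phi> = Lambda_inf \<alpha>"
  using homeomorphic_imp_surjective_map[OF homeo] topspace_UNIV topspace_Lambda by simp

lemma coord_inj: "inj \<phi>"
  using homeomorphic_imp_injective_map[OF homeo] topspace_UNIV by simp

lemma coord_Lambda: "\<phi> x \<in> Lambda_inf \<alpha>"
  using coord_range by blast

lemma coord_inv: "\<xi> \<in> Lambda_inf \<alpha> \<Longrightarrow> \<phi> (inv \<phi> \<xi>) = \<xi>"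
  using coord_range by (metis f_inv_into_f)

definition coord_norm :: "nat \<Rightarrow> 'v \<Rightarrow> real"
  where "coord_norm q x = Lambda_norm \<alpha> q (\<phi> x)"

lemma coord_norm_generated: "seminorm_generated UNIV (range coord_norm) T"
proof -
  have "seminorm_generated UNIV ((\<lambda>q. q \<circ> \<phi>) ` range (Lambda_norm \<alpha>)) T"
  proof (rule seminorm_generated_pullback[OF vector_space_seq Lambda_subspace Lambda_generated[OF exponent]])
    show "seminorm_on seq_scale (Lambda_inf \<alpha>) q" if "q \<in> range (Lambda_norm \<alpha>)" for q
      using that Lambda_norm_seminorm by blast
    show "homeomorphic_map T (subtopology (Lambda_topology \<alpha>) (Lambda_inf \<alpha>)) \<phi>"
      using homeo subtopology_topspace[of "Lambda_topology \<alpha>"] by (simp add: topspace_Lambda)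
  qed (rule order_refl topspace_UNIV coord_diff)+
  moreover have "(\<lambda>q. q \<circ> \<phi>) ` range (Lambda_norm \<alpha>) = range coord_norm"
    by (auto simp: image_image coord_norm_def fun_eq_iff image_iff)
  ultimately show ?thesis by simp
qed

lemma coord_norm_seminorm: "seminorm_on sc UNIV (coord_norm q)"
  using Lambda_norm_seminorm[of \<alpha> q]
  by (simp add: seminorm_on_def coord_norm_def coord_add coord_scale coord_Lambda)

lemma coord_norm_mono: "q \<le> r \<Longrightarrow> coord_norm q x \<le> coord_norm r x"
  unfolding coord_norm_def by (rule Lambda_norm_mono[OF exponent coord_Lambda])

sublocale p: complete_seminorms sc coord_norm
  by (rule complete_seminorms[OF coord_norm_generated coord_norm_seminorm]) (simp add: coord_norm_mono)

lemma fundamental: "fundamental_seminorms sc T coord_norm"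
  by (rule generated_imp_fundamental[OF vector_space_axioms coord_norm_generated coord_norm_seminorm])
    (simp add: coord_norm_mono)

lemma dominated: "\<exists>r. \<exists>C>0. \<forall>x. (coord_norm q x)\<^sup>2 \<le> C * hilbert_norm ip x * coord_norm r x"
  using dominating_norm_indep[OF vector_space_axioms topspace_UNIV dominating fundamental] by blast

lemma hilbert_norm_le: "\<exists>r. \<exists>C>0. \<forall>x. hilbert_norm ip x \<le> C * coord_norm r x"
proof -
  have "continuous_seminorm sc T (hilbert_norm ip)"
    using dominating unfolding dominating_norm_def by (rule conjunct1)
  from seminorm_le_of_fundamental[OF vector_space_axioms topspace_UNIV fundamental this] show ?thesis .
qed

section \<open>Gram-Schmidt along the coordinate filtration\<close>

definition initial :: "nat \<Rightarrow> 'v set"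
  where "initial k = {x. \<forall>j\<ge>k. \<phi> x j = 0}"

lemma initial_add: "x \<in> initial k \<Longrightarrow> y \<in> initial k \<Longrightarrow> x + y \<in> initial k"
  and initial_scale: "x \<in> initial k \<Longrightarrow> sc c x \<in> initial k"
  and initial_mono: "k \<le> l \<Longrightarrow> x \<in> initial k \<Longrightarrow> x \<in> initial l"
  by (auto simp: initial_def coord_add coord_diff coord_scale seq_scale_def)

lemma initial_0: "x \<in> initial 0 \<Longrightarrow> x = 0"
proof -
  assume "x \<in> initial 0"
  then have "\<phi> x = \<phi> 0" by (simp add: initial_def coord_zero fun_eq_iff)
  then show "x = 0" using coord_inj by (simp add: inj_eq)
qed

text \<open>The elimination step behind the inductions on \<open>k\<close>: subtracting a multiple
  of \<open>g\<close> removes the last coordinate.\<close>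

lemma initial_reduce:
  assumes "z \<in> initial (Suc k)" "g \<in> initial (Suc k)" "\<phi> g k \<noteq> 0"
  shows "z - sc (\<phi> z k / \<phi> g k) g \<in> initial k"
  unfolding initial_def
proof (intro CollectI allI impI)
  fix j assume "k \<le> j"
  then show "\<phi> (z - sc (\<phi> z k / \<phi> g k) g) j = 0"
    using assms by (cases "j = k") (auto simp: initial_def coord_diff coord_scale seq_scale_def)
qed

text \<open>The projection of the \<open>k\<close>-th unit vector is subtracted from it. Existence
  of projections is a hypothesis here because the result is used both inside the induction that
  proves it and afterwards.\<close>

lemma orthogonal_vector_of_projection:
  assumes "\<And>x. \<exists>y\<in>initial k. \<forall>z\<in>initial k. ip (x - y) z = 0"
  shows "\<exists>g\<in>initial (Suc k). \<phi> g k = 1 \<and> (\<forall>z\<in>initial k. ip g z = 0)"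
proof -
  let ?f = "inv \<phi> (unit_seq k)"
  have f: "\<phi> ?f = unit_seq k" by (rule coord_inv[OF unit_seq_Lambda])
  obtain y where y: "y \<in> initial k" "\<forall>z\<in>initial k. ip (?f - y) z = 0" using assms by blast
  have "?f - y \<in> initial (Suc k)" "\<phi> (?f - y) k = 1"
    using y(1) f by (auto simp: initial_def coord_diff unit_seq_def)
  then show ?thesis using y(2) by blast
qed

text \<open>Projections onto these finite-dimensional spaces exist without completeness of the
  Hilbert norm: each step adds the component along one new vector \<open>g\<close> orthogonal to the
  previous space.\<close>

lemma projection: "\<exists>y\<in>initial k. \<forall>z\<in>initial k. ip (x - y) z = 0"
proof (induction k arbitrary: x)
  case 0
  have "0 \<in> initial 0" by (simp add: initial_def coord_zero)
  moreover have "\<forall>z\<in>initial 0. ip (x - 0) z = 0" by (auto dest!: initial_0)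
  ultimately show ?case by blast
next
  case (Suc k)
  obtain g where g: "g \<in> initial (Suc k)" "\<phi> g k = 1" "\<And>z. z \<in> initial k \<Longrightarrow> ip g z = 0"
    using orthogonal_vector_of_projection[OF Suc.IH] by blast
  have "g \<noteq> 0" using g(2) coord_zero by auto
  then have gg: "ip g g \<noteq> 0" using ip_pos[of g] by auto
  obtain y where y: "y \<in> initial k" "\<And>z. z \<in> initial k \<Longrightarrow> ip (x - y) z = 0" using Suc.IH by blast
  define c where "c = ip x g / ip g g"
  have yg: "ip y g = 0" using g(3)[OF y(1)] ip_cnj[of g y] by simp
  have "ip (x - (y + sc c g)) z = 0" if z: "z \<in> initial (Suc k)" for z
  proof -
    \<comment> \<open>\<open>z\<close> is tested in two pieces, one in \<open>initial k\<close> and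
      one along \<open>g\<close>.\<close>
    let ?z = "z - sc (\<phi> z k) g"
    have z': "?z \<in> initial k" using initial_reduce[OF z g(1)] g(2) by simp
    have e: "x - (y + sc c g) = (x - y) - sc c g" by simp
    have 1: "ip (x - (y + sc c g)) ?z = 0"
      unfolding e ip_diff_left[of "x - y"] using y(2)[OF z'] g(3)[OF z'] by (simp add: ip_scale_left)
    have 2: "ip (x - (y + sc c g)) g = 0"
      unfolding e using yg gg by (simp add: ip_diff_left ip_scale_left c_def)
    have "ip (x - (y + sc c g)) z = ip (x - (y + sc c g)) ?z + cnj (\<phi> z k) * ip (x - (y + sc c g)) g"
      by (simp add: ip_diff_right ip_scale_right)
    then show ?thesis unfolding 1 2 by simp
  qed
  moreover have "y + sc c g \<in> initial (Suc k)"
    using initial_mono[OF _ y(1), of "Suc k"] g(1) by (intro initial_add initial_scale) auto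
  ultimately show ?case by blast
qed

lemma orthonormal_vector: "\<exists>e\<in>initial (Suc k). ip e e = 1 \<and> (\<forall>z\<in>initial k. ip e z = 0)"
proof -
  obtain g where g: "g \<in> initial (Suc k)" "\<phi> g k = 1" "\<And>z. z \<in> initial k \<Longrightarrow> ip g z = 0"
    using orthogonal_vector_of_projection[OF projection] by blast
  have "g \<noteq> 0" using g(2) coord_zero by auto
  then have pos: "0 < Re (ip g g)" by (rule ip_pos)
  define b where "b = sqrt (Re (ip g g))"
  have b: "0 < b" "ip g g = of_real (b * b)"
    using pos ip_self[of g] by (auto simp: b_def)
  let ?e = "sc (of_real (1 / b)) g"
  have "ip ?e ?e = 1" using b by (simp add: ip_scale_left ip_scale_right)
  moreover have "?e \<in> initial (Suc k)" by (rule initial_scale[OF g(1)])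
  moreover have "\<forall>z\<in>initial k. ip ?e z = 0" using g(3) by (simp add: ip_scale_left)
  ultimately show ?thesis by blast
qed

definition onb :: "nat \<Rightarrow> 'v"
  where "onb k = (SOME e. e \<in> initial (Suc k) \<and> ip e e = 1 \<and> (\<forall>z\<in>initial k. ip e z = 0))"

lemma onb: "onb k \<in> initial (Suc k)" "ip (onb k) (onb k) = 1" "z \<in> initial k \<Longrightarrow> ip (onb k) z = 0"
proof -
  have "\<exists>e. e \<in> initial (Suc k) \<and> ip e e = 1 \<and> (\<forall>z\<in>initial k. ip e z = 0)"
    using orthonormal_vector by blast
  from someI_ex[OF this]
  have "onb k \<in> initial (Suc k) \<and> ip (onb k) (onb k) = 1 \<and> (\<forall>z\<in>initial k. ip (onb k) z = 0)"
    unfolding onb_def .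
  then show "onb k \<in> initial (Suc k)" "ip (onb k) (onb k) = 1" "z \<in> initial k \<Longrightarrow> ip (onb k) z = 0" by blast+
qed

lemma onb_orthogonal: "i \<noteq> k \<Longrightarrow> ip (onb i) (onb k) = 0"
proof -
  have less: "ip (onb k) (onb i) = 0" if "i < k" for i k
    using onb(3)[of "onb i" k] initial_mono[OF _ onb(1), of i k] that by simp
  assume "i \<noteq> k"
  then show ?thesis using less[of i k] less[of k i] ip_cnj[of "onb k" "onb i"] by (cases "i < k") auto
qed

lemma hilbert_norm_onb: "hilbert_norm ip (onb k) = 1"
  by (simp add: hilbert_norm_def onb(2))

text \<open>Domination bounds the square of the \<open>q\<close>-norm by a multiple of the
  \<open>r\<close>-norm. On \<open>initial (Suc k)\<close> the latter is at most
  \<open>exp (real r * \<alpha> k)\<close> times the 0-norm, hence times the \<open>q\<close>-norm,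
  and one factor cancels.\<close>

lemma onb_growth: "\<exists>r. \<exists>C>0. \<forall>k. coord_norm q (onb k) \<le> C * exp (real r * \<alpha> k)"
proof -
  obtain r C where C: "C > 0" "\<And>x. (coord_norm q x)\<^sup>2 \<le> C * hilbert_norm ip x * coord_norm r x"
    using dominated[of q] by auto
  have "coord_norm q (onb k) \<le> C * exp (real r * \<alpha> k)" for k
  proof -
    let ?n = "coord_norm q (onb k)"
    have "coord_norm r (onb k) \<le> exp (real r * \<alpha> k) * coord_norm 0 (onb k)"
      unfolding coord_norm_def
      by (rule Lambda_norm_initial[OF exponent coord_Lambda]) (use onb(1)[of k] in \<open>auto simp: initial_def\<close>)
    also have "\<dots> \<le> exp (real r * \<alpha> k) * ?n" by (intro mult_left_mono coord_norm_mono) auto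
    finally have "C * 1 * coord_norm r (onb k) \<le> C * 1 * (exp (real r * \<alpha> k) * ?n)"
      using C(1) by (intro mult_left_mono) auto
    then have "?n * ?n \<le> (C * exp (real r * \<alpha> k)) * ?n"
      using C(2)[of "onb k"] unfolding hilbert_norm_onb power2_eq_square by (simp add: mult_ac)
    then show ?thesis using p.pD(1)[of q "onb k"] C(1)
      by (cases "?n = 0") (auto simp: mult_le_cancel_right)
  qed
  then show ?thesis using C(1) by blast
qed

definition cut :: "nat \<Rightarrow> 'v \<Rightarrow> 'v"
  where "cut n x = inv \<phi> (trunc n (\<phi> x))"

lemma coord_cut: "\<phi> (cut n x) = trunc n (\<phi> x)"
  unfolding cut_def by (rule coord_inv[OF trunc_Lambda[OF coord_Lambda]])

lemma cut_initial: "cut n x \<in> initial n"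
  by (simp add: initial_def coord_cut trunc_def)

lemma coord_norm_tail: "coord_norm r (x - cut n x) \<le> exp (- (real q * \<alpha> n)) * coord_norm (r + q) x"
  unfolding coord_norm_def coord_diff coord_cut by (rule Lambda_norm_tail[OF exponent coord_Lambda])

lemma onb_coeff_decay: "\<exists>r. \<exists>C>0. \<forall>x k. cmod (ip x (onb k)) \<le> C * exp (- (real q * \<alpha> k)) * coord_norm r x"
proof -
  obtain r C where C: "C > 0" "\<And>x. hilbert_norm ip x \<le> C * coord_norm r x" using hilbert_norm_le by blast
  have "cmod (ip x (onb k)) \<le> C * exp (- (real q * \<alpha> k)) * coord_norm (r + q) x" for x k
  proof -
    have "ip (cut k x) (onb k) = 0" using onb(3)[OF cut_initial] ip_cnj[of "onb k" "cut k x"] by simp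
    then have "cmod (ip x (onb k)) = cmod (ip (x - cut k x) (onb k))" by (simp add: ip_diff_left)
    also have "\<dots> \<le> hilbert_norm ip (x - cut k x)"
      using Cauchy_Schwarz[of "x - cut k x" "onb k"] by (simp add: hilbert_norm_onb)
    also have "\<dots> \<le> C * coord_norm r (x - cut k x)" by (rule C)
    also have "\<dots> \<le> C * (exp (- (real q * \<alpha> k)) * coord_norm (r + q) x)"
      using C(1) by (intro mult_left_mono coord_norm_tail) auto
    finally show ?thesis by (simp add: mult.assoc)
  qed
  then show ?thesis using C(1) by blast
qed

text \<open>A vector orthogonal to all \<open>onb k\<close> is orthogonal to every
  \<open>initial k\<close>, hence to its own truncations, and these converge to it in the Hilbert
  norm.\<close>

lemma onb_total:
  assumes "\<And>k. ip x (onb k) = 0"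
  shows "x = 0"
proof -
  have ort: "ip x z = 0" if "z \<in> initial k" for z k
    using that
  proof (induction k arbitrary: z)
    case 0
    then have "z = 0" by (rule initial_0)
    then show ?case by simp
  next
    case (Suc k)
    \<comment> \<open>A zero here would put \<open>onb k\<close> into \<open>initial k\<close>, to
      which it is orthogonal, against its norm 1.\<close>
    have nz: "\<phi> (onb k) k \<noteq> 0"
    proof
      assume "\<phi> (onb k) k = 0"
      then have "\<phi> (onb k) j = 0" if "k \<le> j" for j
        using onb(1)[of k] that by (cases "j = k") (auto simp: initial_def)
      then have "onb k \<in> initial k" by (simp add: initial_def)
      then show False using onb(3)[of "onb k" k] onb(2)[of k] by simp
    qed
    have "ip x (z - sc (\<phi> z k / \<phi> (onb k) k) (onb k)) = 0"
      by (rule Suc.IH[OF initial_reduce[OF Suc.prems onb(1) nz]])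
    then show ?case by (simp add: ip_diff_right ip_scale_right assms)
  qed
  obtain r C where C: "C > 0" "\<And>x. hilbert_norm ip x \<le> C * coord_norm r x" using hilbert_norm_le by blast
  have "filterlim (\<lambda>n. - \<alpha> n) at_bot sequentially"
    using exponent by (simp add: exponent_sequence_def filterlim_uminus_at_bot)
  then have e0: "(\<lambda>n. exp (- \<alpha> n)) \<longlonglongrightarrow> 0" using exp_at_bot filterlim_compose by blast
  have "cmod (ip x x) \<le> hilbert_norm ip x * C * coord_norm (r + 1) x * exp (- \<alpha> n)" for n
  proof -
    have "ip x x = ip x (x - cut n x)" using ort[OF cut_initial] by (simp add: ip_diff_right)
    then have "cmod (ip x x) \<le> hilbert_norm ip x * hilbert_norm ip (x - cut n x)" using Cauchy_Schwarz by metis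
    also have "\<dots> \<le> hilbert_norm ip x * (C * (exp (- \<alpha> n) * coord_norm (r + 1) x))"
    proof (intro mult_left_mono hilbert_norm_nonneg order_trans[OF C(2)])
      show "coord_norm r (x - cut n x) \<le> exp (- \<alpha> n) * coord_norm (r + 1) x"
        using coord_norm_tail[of r x n 1] by simp
    qed (use C(1) in simp)
    finally show ?thesis by (simp add: mult_ac)
  qed
  moreover have "(\<lambda>n. hilbert_norm ip x * C * coord_norm (r + 1) x * exp (- \<alpha> n)) \<longlonglongrightarrow> 0"
    using tendsto_mult[OF tendsto_const e0] by fastforce
  ultimately have "cmod (ip x x) \<le> 0" by (intro LIMSEQ_le_const) auto
  then show ?thesis using ip_pos[of x] by force
qed

text \<open>Position \<open>index j\<close> in \<open>s\<close> is comparable with \<open>exp (\<alpha> j)\<close> up to powers.\<close>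

definition index :: "nat \<Rightarrow> nat"
  where "index j = j + nat \<lceil>exp (\<alpha> j)\<rceil>"

text \<open>\<open>\<alpha>\<close> may be constant on stretches, where the ceiling repeats; the
  summand \<open>j\<close> in \<open>index\<close> separates the positions.\<close>

lemma index_strict_mono: "strict_mono index"
  unfolding strict_mono_Suc_iff
proof
  fix j
  have "exp (\<alpha> j) \<le> exp (\<alpha> (Suc j))" using exponent_sequenceD(2)[OF exponent, of j "Suc j"] by simp
  then have "nat \<lceil>exp (\<alpha> j)\<rceil> \<le> nat \<lceil>exp (\<alpha> (Suc j))\<rceil>" by (intro nat_mono ceiling_mono)
  then show "index j < index (Suc j)" unfolding index_def by linarith
qed

lemma index_lower: "exp (\<alpha> j) \<le> real (Suc (index j))"
proof -
  have "exp (\<alpha> j) \<le> real (nat \<lceil>exp (\<alpha> j)\<rceil>)" by (rule real_nat_ceiling_ge)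
  also have "\<dots> \<le> real (Suc (index j))" unfolding of_nat_le_iff index_def by (rule le_SucI, rule le_add2)
  finally show ?thesis .
qed

text \<open>The place where nuclearity enters: it bounds the summand \<open>j\<close> of
  \<open>index\<close> by a power of \<open>exp (\<alpha> j)\<close>.\<close>

lemma index_upper: "\<exists>C>0. \<exists>m::nat. \<forall>j. real (Suc (index j)) \<le> C * exp (real m * \<alpha> j)"
proof -
  obtain C m where C: "C > 0" "\<And>n. real (Suc n) \<le> C * exp (real m * \<alpha> n)"
    using nuclear_Lambda_growth[OF exponent nuclear] by auto
  \<comment> \<open>\<open>C\<close> pays for \<open>Suc j\<close>, and 2 for
    \<open>exp (\<alpha> j)\<close> and the rounding error of the ceiling.\<close>
  have "real (Suc (index j)) \<le> (C + 2) * exp (real (Suc m) * \<alpha> j)" for j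
  proof -
    have a: "0 \<le> \<alpha> j" using exponent_sequenceD(1)[OF exponent, of j] by simp
    then have "0 \<le> real m * \<alpha> j" by simp
    have E: "exp (real m * \<alpha> j) \<le> exp (real (Suc m) * \<alpha> j)" "exp (\<alpha> j) \<le> exp (real (Suc m) * \<alpha> j)"
      "1 \<le> exp (real (Suc m) * \<alpha> j)"
      using a \<open>0 \<le> real m * \<alpha> j\<close> by (simp_all add: distrib_right)
    have "0 \<le> \<lceil>exp (\<alpha> j)\<rceil>" using less_trans[OF _ exp_gt_zero, of "- 1" "\<alpha> j"] by simp
    then have "real (nat \<lceil>exp (\<alpha> j)\<rceil>) = real_of_int \<lceil>exp (\<alpha> j)\<rceil>" by (rule of_nat_nat)
    moreover have "real (Suc (index j)) = real (Suc j) + real (nat \<lceil>exp (\<alpha> j)\<rceil>)"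
      unfolding index_def by (simp only: of_nat_Suc of_nat_add add_ac)
    ultimately have "real (Suc (index j)) \<le> real (Suc j) + (exp (\<alpha> j) + 1)"
      using of_int_ceiling_le_add_one[of "exp (\<alpha> j)"] by linarith
    also have "\<dots> \<le> C * exp (real (Suc m) * \<alpha> j) + (exp (real (Suc m) * \<alpha> j) + exp (real (Suc m) * \<alpha> j))"
      using C(1) E by (intro add_mono order_trans[OF C(2)] mult_left_mono) auto
    also have "\<dots> = (C + 2) * exp (real (Suc m) * \<alpha> j)" by (simp add: distrib_right)
    finally show ?thesis .
  qed
  moreover have "C + 2 > 0" using C(1) by simp
  ultimately show ?thesis by blast
qed

text \<open>Positions of s outside the range of \<open>index\<close> receive the zero vector, so
  that the system is indexed by all natural numbers.\<close>

definition frame :: "nat \<Rightarrow> 'v"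
  where "frame m = (if m \<in> range index then onb (inv index m) else 0)"

lemma frame_index: "frame (index j) = onb j"
  using strict_mono_imp_inj_on[OF index_strict_mono] by (simp add: frame_def)

lemma frame_cases:
  obtains j where "m = index j" "frame m = onb j" | "frame m = 0"
  using frame_index by (cases "m \<in> range index") (auto simp: frame_def)

text \<open>By \<open>index_upper\<close> the weight \<open>real (Suc m) ^ q\<close> costs decay of
  order \<open>M * q\<close> in \<open>exp (\<alpha> j)\<close>, which
  \<open>onb_coeff_decay\<close> supplies. Conversely \<open>index_lower\<close> turns the growth of
  \<open>onb\<close> into polynomial growth in the position.\<close>

lemma s_frame: "s_frame sc coord_norm ip frame"
proof
  show "\<exists>r C. \<forall>x. hilbert_norm ip x \<le> C * coord_norm r x" using hilbert_norm_le by blast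
  show "\<exists>r. \<exists>C\<ge>0. \<forall>x m. cmod (ip x (frame m)) * real (Suc m) ^ q \<le> C * coord_norm r x" for q
  proof -
    obtain D M where D: "D > 0" "\<And>j. real (Suc (index j)) \<le> D * exp (real M * \<alpha> j)"
      using index_upper by auto
    obtain r C where C: "C > 0" "\<And>x k. cmod (ip x (onb k)) \<le> C * exp (- (real (M * q) * \<alpha> k)) * coord_norm r x"
      using onb_coeff_decay[of "M * q"] by auto
    have "cmod (ip x (frame m)) * real (Suc m) ^ q \<le> (C * D ^ q) * coord_norm r x" for x m
    proof (cases rule: frame_cases[of m])
      case (1 j)
      have "real (Suc m) ^ q \<le> (D * exp (real M * \<alpha> j)) ^ q"
        unfolding 1(1) by (rule power_mono[OF D(2)]) simp
      also have "\<dots> = D ^ q * exp (real (M * q) * \<alpha> j)"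
        by (simp add: power_mult_distrib exp_of_nat_mult[symmetric] mult_ac)
      finally have "cmod (ip x (frame m)) * real (Suc m) ^ q
          \<le> (C * exp (- (real (M * q) * \<alpha> j)) * coord_norm r x) * (D ^ q * exp (real (M * q) * \<alpha> j))"
        unfolding 1(2) using C p.pD(1) by (intro mult_mono) auto
      also have "\<dots> = (C * D ^ q) * coord_norm r x * (exp (- (real (M * q) * \<alpha> j)) * exp (real (M * q) * \<alpha> j))"
        by (simp only: mult_ac)
      also have "exp (- (real (M * q) * \<alpha> j)) * exp (real (M * q) * \<alpha> j) = 1"
        by (simp add: exp_add[symmetric])
      finally show ?thesis by simp
    next
      case 2
      then show ?thesis using C(1) D(1) p.pD(1)[of r x] by simp
    qed
    moreover have "0 \<le> C * D ^ q" using C(1) D(1) by simp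
    ultimately show ?thesis by blast
  qed
  show "\<exists>r. \<exists>C\<ge>0. \<forall>m. coord_norm q (frame m) \<le> C * real (Suc m) ^ r" for q
  proof -
    obtain r C where C: "C > 0" "\<And>k. coord_norm q (onb k) \<le> C * exp (real r * \<alpha> k)" using onb_growth[of q] by auto
    have "coord_norm q (frame m) \<le> C * real (Suc m) ^ r" for m
    proof (cases rule: frame_cases[of m])
      case (1 j)
      have "exp (real r * \<alpha> j) \<le> real (Suc m) ^ r"
        unfolding 1(1) exp_of_nat_mult by (rule power_mono[OF index_lower]) simp
      then show ?thesis unfolding 1(2) using C(1) by (intro order_trans[OF C(2)] mult_left_mono) auto
    next
      case 2
      then show ?thesis using C(1) by simp
    qed
    then show ?thesis using C(1) by (meson less_imp_le)
  qed
  show "ip (frame m) (frame n) = 0" if "m \<noteq> n" for m n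
    using that by (cases rule: frame_cases[of m]; cases rule: frame_cases[of n]) (auto intro!: onb_orthogonal)
  show "frame m = 0 \<or> ip (frame m) (frame m) = 1" for m
    by (cases rule: frame_cases[of m]) (auto simp: onb(2))
  show "x = 0" if "\<And>m. ip x (frame m) = 0" for x
    by (rule onb_total) (metis frame_index that)
qed

end

text \<open>The bound on left multiplication enters as an implication for the given
  \<open>ip\<close>, so that one construction of \<open>F\<close> serves both halves of (a).\<close>

theorem DN_algebra_embedding:
  fixes sc :: "complex \<Rightarrow> 'a::ring \<Rightarrow> 'a" and e :: 'a
  assumes E: "frechet_star_algebra sc star T" and e: "\<And>x. e * x = x" "\<And>x. x * e = x"
    and \<alpha>: "exponent_sequence \<alpha>" "nuclear_space seq_scale (Lambda_topology \<alpha>)"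
    and iso: "frechet_isomorphic sc T seq_scale (Lambda_topology \<alpha>)"
    and ip: "dominating_hilbert_norm sc T ip" and adj: "\<And>x y z. ip (x * y) z = ip y (star x * z)"
  shows "\<exists>F. star_subalgebra F \<and> complemented F \<and> star_isomorphic_to sc star T F \<and>
    ((\<forall>x. \<exists>C>0. \<forall>y. hilbert_norm ip (x * y) \<le> C * hilbert_norm ip y) \<longrightarrow> bounded_operators F)"
proof -
  interpret frechet_star_algebra sc star T by (rule E)
  obtain \<phi> where \<phi>: "lin_on sc seq_scale UNIV \<phi>" "homeomorphic_map T (Lambda_topology \<alpha>) \<phi>"
    using iso topspace_UNIV unfolding frechet_isomorphic_def by auto
  interpret dominated_power_series_space sc T ip \<phi> \<alpha>
    by unfold_locales (use \<phi> \<alpha> ip in \<open>auto simp: dominating_hilbert_norm_def\<close>)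
  interpret s_frame sc coord_norm ip frame by (rule s_frame)
  interpret framed_algebra sc star T coord_norm ip frame e
    by unfold_locales (use coord_norm_generated e adj in auto)
  show ?thesis
    using star_subalgebra_regular complemented_regular star_isomorphic_regular bounded_operators_regular by blast
qed

theorem mainTheorem3:
  fixes sc :: "complex \<Rightarrow> 'a::ring \<Rightarrow> 'a" and star :: "'a \<Rightarrow> 'a" and T :: "'a topology"
  assumes "frechet_star_algebra sc star T"
  shows
    "(\<forall>\<alpha>. (\<exists>e :: 'a. \<forall>x. e * x = x \<and> x * e = x) \<and>
        exponent_sequence \<alpha> \<and>
        nuclear_space seq_scale (Lambda_topology \<alpha>) \<and>
        frechet_isomorphic sc T seq_scale (Lambda_topology \<alpha>) \<longrightarrow>
        (DN_algebra sc star T \<longrightarrow>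
          (\<exists>F. star_subalgebra F \<and> complemented F \<and> star_isomorphic_to sc star T F)) \<and>
        (beta_DN_algebra sc star T \<longrightarrow>
          (\<exists>F. star_subalgebra F \<and> complemented F \<and> bounded_operators F \<and>
            star_isomorphic_to sc star T F)))
     \<and>
     ((\<forall>x y :: 'a. x * y = y * x) \<longrightarrow>
        ((\<exists>F. star_subalgebra F \<and> closedin tau_star F \<and>
            star_isomorphic_to sc star T F) \<longrightarrow>
          DN_algebra sc star T) \<and>
        ((\<exists>F. star_subalgebra F \<and> closedin tau_star F \<and> bounded_operators F \<and>
            star_isomorphic_to sc star T F) \<longrightarrow>
          beta_DN_algebra sc star T))"
proof (intro conjI allI impI)
  fix \<alpha>
  assume "(\<exists>e :: 'a. \<forall>x. e * x = x \<and> x * e = x) \<and> exponent_sequence \<alpha> \<and>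
        nuclear_space seq_scale (Lambda_topology \<alpha>) \<and>
        frechet_isomorphic sc T seq_scale (Lambda_topology \<alpha>)"
  then obtain e :: 'a where e: "\<And>x. e * x = x" "\<And>x. x * e = x" and \<alpha>: "exponent_sequence \<alpha>"
    "nuclear_space seq_scale (Lambda_topology \<alpha>)" "frechet_isomorphic sc T seq_scale (Lambda_topology \<alpha>)"
    by blast
  note emb = DN_algebra_embedding[OF assms e \<alpha>]
  {
    assume "DN_algebra sc star T"
    then obtain ip where "dominating_hilbert_norm sc T ip" "\<And>x y z. ip (x * y) z = ip y (star x * z)"
      unfolding DN_algebra_def by blast
    from emb[OF this] show "\<exists>F. star_subalgebra F \<and> complemented F \<and> star_isomorphic_to sc star T F" by blast
  next
    assume "beta_DN_algebra sc star T"
    then obtain ip where "dominating_hilbert_norm sc T ip" "\<And>x y z. ip (x * y) z = ip y (star x * z)"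
      and bd: "\<forall>x. \<exists>C>0. \<forall>y. hilbert_norm ip (x * y) \<le> C * hilbert_norm ip y"
      unfolding beta_DN_algebra_def by blast
    from emb[OF this(1,2)] bd
    show "\<exists>F. star_subalgebra F \<and> complemented F \<and> bounded_operators F \<and> star_isomorphic_to sc star T F" by blast
  }
next
  assume comm: "\<forall>x y :: 'a. x * y = y * x"
  assume "\<exists>F. star_subalgebra F \<and> closedin tau_star F \<and> star_isomorphic_to sc star T F"
  then show "DN_algebra sc star T" using commutative_subalgebra_DN(1)[OF assms] comm by blast
next
  assume comm: "\<forall>x y :: 'a. x * y = y * x"
  assume "\<exists>F. star_subalgebra F \<and> closedin tau_star F \<and> bounded_operators F \<and> star_isomorphic_to sc star T F"
  then show "beta_DN_algebra sc star T" using commutative_subalgebra_DN(2)[OF assms] comm by blast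
qed

end
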